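(* Let $\mathcal{G}$ be an ultragraph, $K$ a field and $(H,S)$ an admissible pair in $\mathcal{G}$. The graded ideal $I_{(H,S)}$ of $L_K(\mathcal{G})$ is primitive if and only if one of the following holds: (i) $S=B_H$, $\mathcal{G}^0\setminus H$ is downward directed and every loop in $\mathcal{G}^0\setminus H$ has an exit in $\mathcal{G}^0\setminus H$. (ii) $S=B_H\setminus\{w\}$ for some $w\in B_H$ and $A\geq\{w\}$ for all $A\in\mathcal{G}^0\setminus H$.
   Context: An ultragraph $\mathcal{G}=(G^0,\mathcal{G}^1,r_{\mathcal{G}},s_{\mathcal{G}})$ consists of a countable set of vertices $G^0$, a countable set of edges $\mathcal{G}^1$, a source map $s_{\mathcal{G}}:\mathcal{G}^1\to G^0$ and a range map $r_{\mathcal{G}}:\mathcal{G}^1\to\mathcal{P}(G^0)\setminus\{\emptyset\}$. An algebra in $\mathcal{P}(X)$ is a collection of subsets of $X$ closed under $\cup,\cap,\setminus$. $\mathcal{G}^0$ (not to be confused with $G^0$) is the smallest algebra in $\mathcal{P}(G^0)$ containing all $\{v\}$, $v\in G^0$, and all $r_{\mathcal{G}}(e)$, $e\in\mathcal{G}^1$. A path of positive length in $\mathcal{G}$ is a sequence of edges $\alpha=e_1\cdots e_n$ ($n\ge1$) with $s_{\mathcal{G}}(e_{i+1})\in r_{\mathcal{G}}(e_i)$ for $1\le i\le n-1$; $s_{\mathcal{G}}(\alpha)=s_{\mathcal{G}}(e_1)$, $r_{\mathcal{G}}(\alpha)=r_{\mathcal{G}}(e_n)$. It is a loop if $s_{\mathcal{G}}(\alpha)\in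 r_{\mathcal{G}}(\alpha)$; for a loop put $e_{n+1}:=e_1$. A subcollection $H\subseteq\mathcal{G}^0$ (with $\emptyset\in H$) is hereditary if (1) $\{s_{\mathcal{G}}(e)\}\in H$ implies $r_{\mathcal{G}}(e)\in H$ for all $e\in\mathcal{G}^1$; (2) $A\cup B\in H$ for all $A,B\in H$; (3) $A\in H$, $B\in\mathcal{G}^0$, $B\subseteq A$ imply $B\in H$. It is saturated if, whenever $v\in G^0$ satisfies $0<|s_{\mathcal{G}}^{-1}(v)|<\infty$ and $r_{\mathcal{G}}(e)\in H$ for all $e\in s_{\mathcal{G}}^{-1}(v)$, then $\{v\}\in H$. For saturated hereditary $H$, the set of breaking vertices is $$B_H=\{v\in G^0: |s_{\mathcal{G}}^{-1}(v)|=\infty \text{ and } 0<|s_{\mathcal{G}}^{-1}(v)\cap\{e: r_{\mathcal{G}}(e)\notin H\}|<\infty\}.$$ An admissible pair is $(H,S)$ with $H$ saturated hereditary and $S\subseteq B_H$. The ultragraph Leavitt path algebra $L_K(\mathcal{G})$ is the universal $K$-algebra generated by elements $p_A$ ($A\in\mathcal{G}^0$), $s_e,s_{e^*}$ ($e\in\mathcal{G}^1$) subject to: (1) $p_\emptyset=0$, $p_Ap_B=p_{A\cap B}$, $p_{A\cup B}=p_A+p_B-p_{A\cap B}$; (2) $p_{s_{\mathcal{G}}(e)}s_e=s_ep_{r_{\mathcal{G}}(e)}=s_e$ and $p_{r_{\mathcal{G}}(e)}s_{e^*}=s_{e^*}p_{s_{\mathcal{G}}(e)}=s_{e^*}$;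 (3) $s_{e^*}s_f=\delta_{e,f}p_{r_{\mathcal{G}}(e)}$; (4) $p_v=\sum_{s_{\mathcal{G}}(e)=v}s_es_{e^*}$ whenever $0<|s_{\mathcal{G}}^{-1}(v)|<\infty$ (writing $p_v=p_{\{v\}}$). It is $\mathbb{Z}$-graded, with $p_A$, $s_e$, $s_{e^*}$ of degree $0,1,-1$. Ideals are two-sided. For an admissible pair $(H,S)$ and $w\in B_H$ put $p_w^H=p_w-\sum_{s_{\mathcal{G}}(e)=w,\ r_{\mathcal{G}}(e)\notin H}s_es_{e^*}$. $I_{(H,S)}$ is the ideal of $L_K(\mathcal{G})$ generated by $\{p_A:A\in H\}\cup\{p_w^H:w\in S\}$; it is a graded ideal, and every graded ideal is of this form. For $A,B\in\mathcal{G}^0$ write $A\geq B$ if either $B\subseteq A$ or there is a path $\alpha$ of positive length with $s_{\mathcal{G}}(\alpha)\in A$ and $B\subseteq r_{\mathcal{G}}(\alpha)$. A nonempty subset $M\subseteq\mathcal{G}^0$ is downward directed if for all $A,B\in M$ there exists $\emptyset\ne C\in M$ with $A\geq C$ and $B\geq C$. A loop $\gamma=e_1\cdots e_n$ in $\mathcal{G}$ is a loop in $\mathcal{G}^0\setminus H$ if $r_{\mathcal{G}}(\gamma)\in\mathcal{G}^0\setminus H$. It has an exit in $\mathcal{G}^0\setminus H$ if either $r_{\mathcal{G}}(e_i)\setminus\{s_{\mathcal{G}}(e_{i+1})\}\in\mathcal{G}^0\setminus H$ for some $1\le i\le n$, or there exist an edge $f\in\mathcal{G}^1$ and an index $i$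 such that $r_{\mathcal{G}}(f)\in\mathcal{G}^0\setminus H$, $s_{\mathcal{G}}(f)\in r_{\mathcal{G}}(e_i)$ and $f\neq e_{i+1}$. A ring is left (right) primitive if it has a faithful simple left (right) module; a two-sided ideal $I$ of a ring $R$ is left (right) primitive if $R/I$ is a left (right) primitive ring. The graded ideal $I_{(H,S)}$ is left primitive iff it is right primitive, and one simply says primitive. *)

theory Defs
  imports
    "HOL-Algebra.QuotRing"
    "HOL-Algebra.Module"
    "HOL-Library.Poly_Mapping"
    "HOL-Library.Countable_Set"
begin

section \<open>Ultragraphs\<close>

record ('v, 'e) ultragraph =
  vertices :: "'v set"
  edges :: "'e set"
  source :: "'e \<Rightarrow> 'v"
  erange :: "'e \<Rightarrow> 'v set"

locale ultragraph =
  fixes G :: "('v, 'e) ultragraph"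
  assumes countable_vertices: "countable (vertices G)"
    and countable_edges: "countable (edges G)"
    and source_closed: "e \<in> edges G \<Longrightarrow> source G e \<in> vertices G"
    and erange_closed: "e \<in> edges G \<Longrightarrow> erange G e \<subseteq> vertices G"
    and erange_nonempty: "e \<in> edges G \<Longrightarrow> erange G e \<noteq> {}"

text \<open>The smallest algebra of vertex sets containing all singletons and all ranges of edges.
  The rule \<open>empty\<close> is redundant as soon as there is a vertex; it makes sure that the
  generator belonging to the empty set also exists for the ultragraph without vertices.\<close>

inductive_set gen_vertices :: "('v, 'e) ultragraph \<Rightarrow> 'v set set"
  for G :: "('v, 'e) ultragraph" where
  empty: "{} \<in> gen_vertices G"
| singleton: "v \<in> vertices G \<Longrightarrow> {v} \<in> gen_vertices G"
| erange: "e \<in> edges G \<Longrightarrow> erange G e \<in> gen_vertices G"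
| union: "A \<in> gen_vertices G \<Longrightarrow> B \<in> gen_vertices G \<Longrightarrow> A \<union> B \<in> gen_vertices G"
| inter: "A \<in> gen_vertices G \<Longrightarrow> B \<in> gen_vertices G \<Longrightarrow> A \<inter> B \<in> gen_vertices G"
| diff: "A \<in> gen_vertices G \<Longrightarrow> B \<in> gen_vertices G \<Longrightarrow> A - B \<in> gen_vertices G"

definition out_edges :: "('v, 'e) ultragraph \<Rightarrow> 'v \<Rightarrow> 'e set" where
  "out_edges G v = {e \<in> edges G. source G e = v}"

definition is_path :: "('v, 'e) ultragraph \<Rightarrow> 'e list \<Rightarrow> bool" where
  "is_path G p \<longleftrightarrow> p \<noteq> [] \<and> set p \<subseteq> edges G \<and> successively (\<lambda>e f. source G f \<in> erange G e) p"

definition path_source :: "('v, 'e) ultragraph \<Rightarrow> 'e list \<Rightarrow> 'v" where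
  "path_source G p = source G (hd p)"

definition path_range :: "('v, 'e) ultragraph \<Rightarrow> 'e list \<Rightarrow> 'v set" where
  "path_range G p = erange G (last p)"

definition is_loop :: "('v, 'e) ultragraph \<Rightarrow> 'e list \<Rightarrow> bool" where
  "is_loop G p \<longleftrightarrow> is_path G p \<and> path_source G p \<in> path_range G p"

definition hereditary :: "('v, 'e) ultragraph \<Rightarrow> 'v set set \<Rightarrow> bool" where
  "hereditary G H \<longleftrightarrow> H \<subseteq> gen_vertices G \<and> {} \<in> H
     \<and> (\<forall>e \<in> edges G. {source G e} \<in> H \<longrightarrow> erange G e \<in> H)
     \<and> (\<forall>A \<in> H. \<forall>B \<in> H. A \<union> B \<in> H)
     \<and> (\<forall>A \<in> H. \<forall>B \<in> gen_vertices G. B \<subseteq> A \<longrightarrow> B \<in> H)"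

definition saturated :: "('v, 'e) ultragraph \<Rightarrow> 'v set set \<Rightarrow> bool" where
  "saturated G H \<longleftrightarrow>
     (\<forall>v \<in> vertices G. out_edges G v \<noteq> {} \<and> finite (out_edges G v)
        \<and> (\<forall>e \<in> out_edges G v. erange G e \<in> H) \<longrightarrow> {v} \<in> H)"

definition breaking_vertices :: "('v, 'e) ultragraph \<Rightarrow> 'v set set \<Rightarrow> 'v set" where
  "breaking_vertices G H =
     {v \<in> vertices G. infinite (out_edges G v)
        \<and> {e \<in> out_edges G v. erange G e \<notin> H} \<noteq> {}
        \<and> finite {e \<in> out_edges G v. erange G e \<notin> H}}"

definition admissible_pair :: "('v, 'e) ultragraph \<Rightarrow> 'v set set \<Rightarrow> 'v set \<Rightarrow> bool" where
  "admissible_pair G H S \<longleftrightarrow> hereditary G H \<and> saturated G H \<and> S \<subseteq> breaking_vertices G H"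

definition connects :: "('v, 'e) ultragraph \<Rightarrow> 'v set \<Rightarrow> 'v set \<Rightarrow> bool" where
  "connects G A B \<longleftrightarrow> B \<subseteq> A \<or> (\<exists>p. is_path G p \<and> path_source G p \<in> A \<and> B \<subseteq> path_range G p)"

definition downward_directed :: "('v, 'e) ultragraph \<Rightarrow> 'v set set \<Rightarrow> bool" where
  "downward_directed G M \<longleftrightarrow> M \<noteq> {} \<and>
     (\<forall>A \<in> M. \<forall>B \<in> M. \<exists>C \<in> M. C \<noteq> {} \<and> connects G A C \<and> connects G B C)"

definition loop_outside :: "('v, 'e) ultragraph \<Rightarrow> 'v set set \<Rightarrow> 'e list \<Rightarrow> bool" where
  "loop_outside G H p \<longleftrightarrow> is_loop G p \<and> path_range G p \<in> gen_vertices G - H"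

text \<open>Edges of a path are numbered from \<open>0\<close>; the successor index is taken modulo the length,
  so that the last edge of a loop is followed by the first one.\<close>

definition has_exit_outside :: "('v, 'e) ultragraph \<Rightarrow> 'v set set \<Rightarrow> 'e list \<Rightarrow> bool" where
  "has_exit_outside G H p \<longleftrightarrow>
     (\<exists>i < length p.
        erange G (p ! i) - {source G (p ! (Suc i mod length p))} \<in> gen_vertices G - H)
   \<or> (\<exists>f \<in> edges G. \<exists>i < length p.
        erange G f \<in> gen_vertices G - H \<and> source G f \<in> erange G (p ! i)
          \<and> f \<noteq> p ! (Suc i mod length p))"


section \<open>Rings without unit, ideals and primitivity\<close>

text \<open>Ultragraph Leavitt path algebras need not be unital, whereas the ring locales of HOL-Algebra
  are. We keep the ring record of HOL-Algebra, so that its additive theory and its quotient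
  \<^const>\<open>FactRing\<close> apply, but disregard its field \<^const>\<open>one\<close>.\<close>

locale rng = abelian_group R for R (structure) +
  assumes m_closed: "x \<in> carrier R \<Longrightarrow> y \<in> carrier R \<Longrightarrow> x \<otimes> y \<in> carrier R"
    and m_assoc: "x \<in> carrier R \<Longrightarrow> y \<in> carrier R \<Longrightarrow> z \<in> carrier R \<Longrightarrow>
      (x \<otimes> y) \<otimes> z = x \<otimes> (y \<otimes> z)"
    and l_distr: "x \<in> carrier R \<Longrightarrow> y \<in> carrier R \<Longrightarrow> z \<in> carrier R \<Longrightarrow>
      (x \<oplus> y) \<otimes> z = x \<otimes> z \<oplus> y \<otimes> z"
    and r_distr: "x \<in> carrier R \<Longrightarrow> y \<in> carrier R \<Longrightarrow> z \<in> carrier R \<Longrightarrow>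
      z \<otimes> (x \<oplus> y) = z \<otimes> x \<oplus> z \<otimes> y"

locale rng_ideal = additive_subgroup I R + rng R for I and R (structure) +
  assumes I_l_closed: "a \<in> I \<Longrightarrow> x \<in> carrier R \<Longrightarrow> x \<otimes> a \<in> I"
    and I_r_closed: "a \<in> I \<Longrightarrow> x \<in> carrier R \<Longrightarrow> a \<otimes> x \<in> I"

definition rng_genideal :: "('a, 'b) ring_scheme \<Rightarrow> 'a set \<Rightarrow> 'a set" where
  "rng_genideal R X = \<Inter> {I. rng_ideal I R \<and> X \<subseteq> I}"

text \<open>A left or right module is an abelian group with a biadditive action of \<open>R\<close>. For a right module,
  \<open>a \<odot>\<^bsub>M\<^esub> x\<close> stands for what is usually written \<open>x \<cdot> a\<close>; the two notions only differ in the
  associativity law.\<close>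

locale rng_action = R?: rng R + M?: abelian_group M for R (structure) and M (structure) +
  assumes smult_closed: "a \<in> carrier R \<Longrightarrow> x \<in> carrier M \<Longrightarrow> a \<odot>\<^bsub>M\<^esub> x \<in> carrier M"
    and smult_l_distr: "a \<in> carrier R \<Longrightarrow> b \<in> carrier R \<Longrightarrow> x \<in> carrier M \<Longrightarrow>
      (a \<oplus>\<^bsub>R\<^esub> b) \<odot>\<^bsub>M\<^esub> x = a \<odot>\<^bsub>M\<^esub> x \<oplus>\<^bsub>M\<^esub> b \<odot>\<^bsub>M\<^esub> x"
    and smult_r_distr: "a \<in> carrier R \<Longrightarrow> x \<in> carrier M \<Longrightarrow> y \<in> carrier M \<Longrightarrow>
      a \<odot>\<^bsub>M\<^esub> (x \<oplus>\<^bsub>M\<^esub> y) = a \<odot>\<^bsub>M\<^esub> x \<oplus>\<^bsub>M\<^esub> a \<odot>\<^bsub>M\<^esub> y"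

locale rng_left_module = rng_action +
  assumes smult_assoc_left: "a \<in> carrier R \<Longrightarrow> b \<in> carrier R \<Longrightarrow> x \<in> carrier M \<Longrightarrow>
      (a \<otimes>\<^bsub>R\<^esub> b) \<odot>\<^bsub>M\<^esub> x = a \<odot>\<^bsub>M\<^esub> (b \<odot>\<^bsub>M\<^esub> x)"

locale rng_right_module = rng_action +
  assumes smult_assoc_right: "a \<in> carrier R \<Longrightarrow> b \<in> carrier R \<Longrightarrow> x \<in> carrier M \<Longrightarrow>
      (a \<otimes>\<^bsub>R\<^esub> b) \<odot>\<^bsub>M\<^esub> x = b \<odot>\<^bsub>M\<^esub> (a \<odot>\<^bsub>M\<^esub> x)"

text \<open>Over a ring without unit, simplicity includes that the action is not zero.\<close>

definition simple_action :: "('r, 'a) ring_scheme \<Rightarrow> ('r, 'm, 'b) module_scheme \<Rightarrow> bool" where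
  "simple_action R M \<longleftrightarrow>
     (\<exists>a \<in> carrier R. \<exists>x \<in> carrier M. a \<odot>\<^bsub>M\<^esub> x \<noteq> \<zero>\<^bsub>M\<^esub>)
   \<and> (\<forall>N. submodule N R M \<longrightarrow> N = {\<zero>\<^bsub>M\<^esub>} \<or> N = carrier M)"

definition faithful_action :: "('r, 'a) ring_scheme \<Rightarrow> ('r, 'm, 'b) module_scheme \<Rightarrow> bool" where
  "faithful_action R M \<longleftrightarrow>
     (\<forall>a \<in> carrier R. (\<forall>x \<in> carrier M. a \<odot>\<^bsub>M\<^esub> x = \<zero>\<^bsub>M\<^esub>) \<longrightarrow> a = \<zero>\<^bsub>R\<^esub>)"

text \<open>The elements of the module are taken from the element type of the ring, since a definition
  cannot quantify over types. This is no restriction, because a simple module is cyclic: see the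
  lemmas \<open>left_primitiveI\<close> and \<open>right_primitiveI\<close> below.\<close>

definition left_primitive :: "'r ring \<Rightarrow> bool" where
  "left_primitive R \<longleftrightarrow>
     (\<exists>M :: ('r, 'r) module. rng_left_module R M \<and> simple_action R M \<and> faithful_action R M)"

definition right_primitive :: "'r ring \<Rightarrow> bool" where
  "right_primitive R \<longleftrightarrow>
     (\<exists>M :: ('r, 'r) module. rng_right_module R M \<and> simple_action R M \<and> faithful_action R M)"

definition left_primitive_ideal :: "'r set \<Rightarrow> 'r ring \<Rightarrow> bool" where
  "left_primitive_ideal I R \<longleftrightarrow> rng_ideal I R \<and> left_primitive (R Quot I)"

definition right_primitive_ideal :: "'r set \<Rightarrow> 'r ring \<Rightarrow> bool" where
  "right_primitive_ideal I R \<longleftrightarrow> rng_ideal I R \<and> right_primitive (R Quot I)"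

lemma (in rng_ideal) quotient_is_rng: "rng (R Quot I)"
proof -
  have sub: "abelian_subgroup I R"
    by (simp add: abelian_group_axioms abelian_subgroupI3 is_additive_subgroup)
  interpret S: abelian_subgroup I R by (rule sub)
  have mult: "rcoset_mult R I (I +> x) (I +> y) = I +> (x \<otimes> y)"
    if x: "x \<in> carrier R" and y: "y \<in> carrier R" for x y
  proof -
    have eq: "I +> (x' \<otimes> y') = I +> (x \<otimes> y)"
      if x': "x' \<in> I +> x" and y': "y' \<in> I +> y" for x' y'
    proof -
      obtain a where a: "a \<in> I" "x' = a \<oplus> x" using x' by (auto simp: a_r_coset_def')
      obtain b where b: "b \<in> I" "y' = b \<oplus> y" using y' by (auto simp: a_r_coset_def')
      have ac: "a \<in> carrier R" and bc: "b \<in> carrier R" using a b by auto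
      have "x' \<otimes> y' = (a \<otimes> b \<oplus> x \<otimes> b \<oplus> a \<otimes> y) \<oplus> x \<otimes> y"
        using x y ac bc by (simp add: a b l_distr r_distr m_closed a_ac)
      moreover have "a \<otimes> b \<oplus> x \<otimes> b \<oplus> a \<otimes> y \<in> I"
        using a b x y ac bc by (simp add: I_l_closed I_r_closed)
      ultimately have "x' \<otimes> y' \<in> I +> (x \<otimes> y)"
        by (auto simp: a_r_coset_def')
      then show ?thesis
        using x y m_closed S.a_repr_independence' by metis
    qed
    have ne: "x \<in> I +> x" "y \<in> I +> y" using x y by (auto intro: S.a_rcos_self)
    have "rcoset_mult R I (I +> x) (I +> y) =
        (\<Union>x' \<in> I +> x. \<Union>y' \<in> I +> y. I +> (x \<otimes> y))"
      unfolding rcoset_mult_def by (intro SUP_cong refl eq)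
    also have "\<dots> = I +> (x \<otimes> y)" using ne by blast
    finally show ?thesis .
  qed
  interpret Q: abelian_group "R Quot I"
    by (intro comm_group_abelian_groupI)
      (simp add: FactRing_def S.a_factorgroup_is_comm_group[unfolded A_FactGroup_def'])
  have rep: "\<exists>x \<in> carrier R. A = I +> x" if "A \<in> carrier (R Quot I)" for A
    using that by (auto simp: FactRing_def A_RCOSETS_def')
  have cl: "I +> x \<in> carrier (R Quot I)" if "x \<in> carrier R" for x
    using that by (auto simp: FactRing_def A_RCOSETS_def')
  have m: "(I +> x) \<otimes>\<^bsub>R Quot I\<^esub> (I +> y) = I +> (x \<otimes> y)"
    if "x \<in> carrier R" "y \<in> carrier R" for x y
    using mult that by (simp add: FactRing_def)
  have p: "(I +> x) \<oplus>\<^bsub>R Quot I\<^esub> (I +> y) = I +> (x \<oplus> y)"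
    if "x \<in> carrier R" "y \<in> carrier R" for x y
    using that by (simp add: FactRing_def S.a_rcos_sum)
  show ?thesis
  proof unfold_locales
    fix A B assume "A \<in> carrier (R Quot I)" "B \<in> carrier (R Quot I)"
    then show "A \<otimes>\<^bsub>R Quot I\<^esub> B \<in> carrier (R Quot I)"
      by (metis cl m m_closed rep)
  next
    fix A B C
    assume "A \<in> carrier (R Quot I)" "B \<in> carrier (R Quot I)" "C \<in> carrier (R Quot I)"
    then obtain a b c where abc: "a \<in> carrier R" "b \<in> carrier R" "c \<in> carrier R"
      "A = I +> a" "B = I +> b" "C = I +> c" using rep by metis
    then show "A \<otimes>\<^bsub>R Quot I\<^esub> B \<otimes>\<^bsub>R Quot I\<^esub> C = A \<otimes>\<^bsub>R Quot I\<^esub> (B \<otimes>\<^bsub>R Quot I\<^esub> C)"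
      by (simp add: m m_closed m_assoc)
    from abc show "(A \<oplus>\<^bsub>R Quot I\<^esub> B) \<otimes>\<^bsub>R Quot I\<^esub> C =
        A \<otimes>\<^bsub>R Quot I\<^esub> C \<oplus>\<^bsub>R Quot I\<^esub> B \<otimes>\<^bsub>R Quot I\<^esub> C"
      by (simp add: m p m_closed l_distr)
    from abc show "C \<otimes>\<^bsub>R Quot I\<^esub> (A \<oplus>\<^bsub>R Quot I\<^esub> B) =
        C \<otimes>\<^bsub>R Quot I\<^esub> A \<oplus>\<^bsub>R Quot I\<^esub> C \<otimes>\<^bsub>R Quot I\<^esub> B"
      by (simp add: m p m_closed r_distr)
  qed
qed

text \<open>Transport of a module along an injection of its carrier into another type.\<close>

definition transport :: "('m \<Rightarrow> 'n) \<Rightarrow> ('r, 'm, 'b) module_scheme \<Rightarrow> ('r, 'n) module" where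
  "transport f M =
     (let g = the_inv_into (carrier M) f in
       \<lparr>carrier = f ` carrier M, mult = (\<lambda>x y. x), one = f \<zero>\<^bsub>M\<^esub>, zero = f \<zero>\<^bsub>M\<^esub>,
        add = (\<lambda>x y. f (g x \<oplus>\<^bsub>M\<^esub> g y)), smult = (\<lambda>a x. f (a \<odot>\<^bsub>M\<^esub> g x))\<rparr>)"

context rng_action
begin

lemma transport_simps:
  assumes "inj_on f (carrier M)"
  shows "carrier (transport f M) = f ` carrier M"
    and "\<zero>\<^bsub>transport f M\<^esub> = f \<zero>\<^bsub>M\<^esub>"
    and "x \<in> carrier M \<Longrightarrow> y \<in> carrier M \<Longrightarrow> f x \<oplus>\<^bsub>transport f M\<^esub> f y = f (x \<oplus>\<^bsub>M\<^esub> y)"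
    and "x \<in> carrier M \<Longrightarrow> a \<odot>\<^bsub>transport f M\<^esub> f x = f (a \<odot>\<^bsub>M\<^esub> x)"
  using assms by (simp_all add: transport_def Let_def the_inv_into_f_f)

lemma transport_action:
  assumes f: "inj_on f (carrier M)"
  shows "rng_action R (transport f M)"
proof -
  note t = transport_simps[OF f]
  have "abelian_group (transport f M)"
  proof (rule abelian_groupI)
    fix x assume "x \<in> carrier (transport f M)"
    then obtain m where m: "m \<in> carrier M" "x = f m" by (auto simp: t)
    have "f (\<ominus>\<^bsub>M\<^esub> m) \<oplus>\<^bsub>transport f M\<^esub> x = \<zero>\<^bsub>transport f M\<^esub>"
      using m by (simp add: t M.l_neg)
    then show "\<exists>y \<in> carrier (transport f M). y \<oplus>\<^bsub>transport f M\<^esub> x = \<zero>\<^bsub>transport f M\<^esub>"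
      using m by (auto simp: t)
  qed (auto simp: t M.a_ac)
  then show ?thesis
    by (intro rng_action.intro rng_action_axioms.intro rng_axioms)
      (auto simp: t smult_closed smult_l_distr smult_r_distr)
qed

lemma transport_simple:
  assumes f: "inj_on f (carrier M)" and s: "simple_action R M"
  shows "simple_action R (transport f M)"
proof -
  note t = transport_simps[OF f]
  interpret T: rng_action R "transport f M" by (rule transport_action[OF f])
  have inj: "f x = f y \<longleftrightarrow> x = y" if "x \<in> carrier M" "y \<in> carrier M" for x y
    using f that by (auto dest: inj_onD)
  have "\<exists>a \<in> carrier R. \<exists>x \<in> carrier (transport f M).
      a \<odot>\<^bsub>transport f M\<^esub> x \<noteq> \<zero>\<^bsub>transport f M\<^esub>"
    using s by (auto simp: simple_action_def t inj smult_closed)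
  moreover have "N = {\<zero>\<^bsub>transport f M\<^esub>} \<or> N = carrier (transport f M)"
    if N: "submodule N R (transport f M)" for N
  proof -
    interpret N: submodule N R "transport f M" by (rule N)
    define L where "L = {x \<in> carrier M. f x \<in> N}"
    have NL: "N = f ` L" using N.subset by (auto simp: L_def t)
    have "submodule L R M"
    proof (intro submodule.intro submodule_axioms.intro M.add.subgroupI)
      show "L \<subseteq> carrier M" by (auto simp: L_def)
      show "L \<noteq> {}" using N.one_closed by (auto simp: L_def t intro!: exI[of _ "\<zero>\<^bsub>M\<^esub>"])
    next
      fix x y assume "x \<in> L" "y \<in> L"
      then show "x \<oplus>\<^bsub>M\<^esub> y \<in> L" using N.m_closed[of "f x" "f y"] by (auto simp: L_def t)
    next
      fix a x assume "a \<in> carrier R" "x \<in> L"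
      then show "a \<odot>\<^bsub>M\<^esub> x \<in> L"
        using N.smult_closed[of a "f x"] by (auto simp: L_def t smult_closed)
    next
      fix x assume x: "x \<in> L"
      have "\<ominus>\<^bsub>transport f M\<^esub> f x = f (\<ominus>\<^bsub>M\<^esub> x)"
        using x by (intro T.M.minus_equality) (auto simp: L_def t M.l_neg)
      moreover have "\<ominus>\<^bsub>transport f M\<^esub> f x \<in> N"
        using x N.m_inv_closed[of "f x"] by (auto simp: L_def a_inv_def)
      ultimately show "\<ominus>\<^bsub>M\<^esub> x \<in> L" using x by (auto simp: L_def)
    qed
    then have "L = {\<zero>\<^bsub>M\<^esub>} \<or> L = carrier M" using s by (simp add: simple_action_def)
    then show ?thesis by (auto simp: NL t)
  qed
  ultimately show ?thesis by (simp add: simple_action_def)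
qed

lemma transport_faithful:
  assumes f: "inj_on f (carrier M)" and "faithful_action R M"
  shows "faithful_action R (transport f M)"
proof -
  have inj: "f x = f y \<longleftrightarrow> x = y" if "x \<in> carrier M" "y \<in> carrier M" for x y
    using f that by (auto dest: inj_onD)
  show ?thesis
    using assms by (auto simp: faithful_action_def transport_simps[OF f] inj smult_closed)
qed

text \<open>A simple module is cyclic, for either associativity law, and so injects into the ring.\<close>

lemma simple_embeds:
  assumes s: "simple_action R M"
    and assoc: "\<And>a b x. a \<in> carrier R \<Longrightarrow> b \<in> carrier R \<Longrightarrow> x \<in> carrier M \<Longrightarrow>
      \<exists>c \<in> carrier R. a \<odot>\<^bsub>M\<^esub> (b \<odot>\<^bsub>M\<^esub> x) = c \<odot>\<^bsub>M\<^esub> x"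
  shows "\<exists>f. inj_on f (carrier M) \<and> f ` carrier M \<subseteq> carrier R"
proof -
  obtain a0 x0 where a0: "a0 \<in> carrier R" and x0: "x0 \<in> carrier M"
    and nz: "a0 \<odot>\<^bsub>M\<^esub> x0 \<noteq> \<zero>\<^bsub>M\<^esub>"
    using s by (auto simp: simple_action_def)
  define N where "N = (\<lambda>a. a \<odot>\<^bsub>M\<^esub> x0) ` carrier R"
  have "submodule N R M"
  proof (intro submodule.intro submodule_axioms.intro M.add.subgroupI)
    show "N \<subseteq> carrier M" using x0 by (auto simp: N_def smult_closed)
    show "N \<noteq> {}" using a0 by (auto simp: N_def)
  next
    fix x y assume "x \<in> N" "y \<in> N"
    then obtain a b where ab: "a \<in> carrier R" "b \<in> carrier R" "x = a \<odot>\<^bsub>M\<^esub> x0" "y = b \<odot>\<^bsub>M\<^esub> x0"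
      by (auto simp: N_def)
    then have "x \<oplus>\<^bsub>M\<^esub> y = (a \<oplus>\<^bsub>R\<^esub> b) \<odot>\<^bsub>M\<^esub> x0" using x0 by (simp add: smult_l_distr)
    then show "x \<oplus>\<^bsub>M\<^esub> y \<in> N" using ab by (auto simp: N_def)
  next
    fix a x assume "a \<in> carrier R" "x \<in> N"
    then show "a \<odot>\<^bsub>M\<^esub> x \<in> N" using x0 assoc by (fastforce simp: N_def)
  next
    fix x assume "x \<in> N"
    then obtain a where a: "a \<in> carrier R" "x = a \<odot>\<^bsub>M\<^esub> x0" by (auto simp: N_def)
    have z: "\<zero>\<^bsub>R\<^esub> \<odot>\<^bsub>M\<^esub> x0 = \<zero>\<^bsub>M\<^esub>"
      using smult_l_distr[of "\<zero>\<^bsub>R\<^esub>" "\<zero>\<^bsub>R\<^esub>" x0] x0 smult_closed[of "\<zero>\<^bsub>R\<^esub>" x0]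
      by (metis M.add.r_cancel_one' R.zero_closed R.l_zero)
    have "\<ominus>\<^bsub>M\<^esub> x = (\<ominus>\<^bsub>R\<^esub> a) \<odot>\<^bsub>M\<^esub> x0"
      using a x0 z smult_l_distr[of "\<ominus>\<^bsub>R\<^esub> a" a x0]
      by (intro M.minus_equality) (auto simp: smult_closed R.l_neg)
    then show "\<ominus>\<^bsub>M\<^esub> x \<in> N" using a by (auto simp: N_def)
  qed
  moreover have "N \<noteq> {\<zero>\<^bsub>M\<^esub>}" using a0 nz by (auto simp: N_def)
  ultimately have "N = carrier M" using s by (auto simp: simple_action_def)
  then have ex: "\<exists>a. a \<in> carrier R \<and> a \<odot>\<^bsub>M\<^esub> x0 = m" if "m \<in> carrier M" for m
    using that unfolding N_def by (metis image_iff)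
  define f where "f m = (SOME a. a \<in> carrier R \<and> a \<odot>\<^bsub>M\<^esub> x0 = m)" for m
  have f: "f m \<in> carrier R \<and> f m \<odot>\<^bsub>M\<^esub> x0 = m" if "m \<in> carrier M" for m
    unfolding f_def by (rule someI_ex[OF ex[OF that]])
  then have "inj_on f (carrier M)" by (metis inj_onI)
  then show ?thesis using f by blast
qed

end

lemma left_primitiveI:
  fixes R :: "'r ring" and M :: "('r, 'm, 'b) module_scheme"
  assumes "rng_left_module R M" "simple_action R M" "faithful_action R M"
  shows "left_primitive R"
proof -
  interpret rng_left_module R M by fact
  obtain f where f: "inj_on f (carrier M)" "f ` carrier M \<subseteq> carrier R"
    using simple_embeds[OF assms(2)] smult_assoc_left R.m_closed by metis
  have "rng_left_module R (transport f M)"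
    by (intro rng_left_module.intro rng_left_module_axioms.intro transport_action f(1))
      (auto simp: transport_simps[OF f(1)] smult_assoc_left smult_closed)
  then show ?thesis
    using transport_simple[OF f(1) assms(2)] transport_faithful[OF f(1) assms(3)]
    by (auto simp: left_primitive_def)
qed

lemma right_primitiveI:
  fixes R :: "'r ring" and M :: "('r, 'm, 'b) module_scheme"
  assumes "rng_right_module R M" "simple_action R M" "faithful_action R M"
  shows "right_primitive R"
proof -
  interpret rng_right_module R M by fact
  obtain f where f: "inj_on f (carrier M)" "f ` carrier M \<subseteq> carrier R"
    using simple_embeds[OF assms(2)] smult_assoc_right R.m_closed by metis
  have "rng_right_module R (transport f M)"
    by (intro rng_right_module.intro rng_right_module_axioms.intro transport_action f(1))
      (auto simp: transport_simps[OF f(1)] smult_assoc_right smult_closed)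
  then show ?thesis
    using transport_simple[OF f(1) assms(2)] transport_faithful[OF f(1) assms(3)]
    by (auto simp: right_primitive_def)
qed

section \<open>Ultragraph Leavitt path algebras\<close>

text \<open>Words under concatenation form the free monoid, written additively as required by
  \<^typ>\<open>'a \<Rightarrow>\<^sub>0 'b\<close>, whose product is convolution. So \<open>'g word \<Rightarrow>\<^sub>0 'k\<close> is the free unital
  \<open>'k\<close>-algebra on \<open>'g\<close>.\<close>

datatype 'g word = Word (letters: "'g list")

instantiation word :: (type) monoid_add
begin

definition zero_word_def: "0 = Word []"

definition plus_word_def: "u + v = Word (letters u @ letters v)"

instance
  by standard (simp_all add: zero_word_def plus_word_def)

end

datatype ('v, 'e) generator = Proj "'v set" | Edge 'e | Ghost 'e

definition generators :: "('v, 'e) ultragraph \<Rightarrow> ('v, 'e) generator set" where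
  "generators G = Proj ` gen_vertices G \<union> Edge ` edges G \<union> Ghost ` edges G"

type_synonym ('v, 'e, 'k) free_elem = "('v, 'e) generator word \<Rightarrow>\<^sub>0 'k"

abbreviation gen :: "('v, 'e) generator \<Rightarrow> ('v, 'e, 'k::field) free_elem" where
  "gen g \<equiv> Poly_Mapping.single (Word [g]) 1"

text \<open>The free non-unital algebra on the generators: only non-empty words occur.
  The field \<^const>\<open>one\<close> lies outside the carrier and plays no role.\<close>

definition free_algebra ::
    "'k::field itself \<Rightarrow> ('v, 'e) ultragraph \<Rightarrow> ('v, 'e, 'k) free_elem ring" where
  "free_algebra K G =
     \<lparr>carrier = {x. \<forall>w \<in> Poly_Mapping.keys x. letters w \<noteq> [] \<and> set (letters w) \<subseteq> generators G},
      mult = (*), one = 1, zero = 0, add = (+)\<rparr>"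

definition relators :: "'k::field itself \<Rightarrow> ('v, 'e) ultragraph \<Rightarrow> ('v, 'e, 'k) free_elem set" where
  "relators K G =
     {gen (Proj {})}
   \<union> {gen (Proj A) * gen (Proj B) - gen (Proj (A \<inter> B)) | A B.
        A \<in> gen_vertices G \<and> B \<in> gen_vertices G}
   \<union> {gen (Proj (A \<union> B)) - (gen (Proj A) + gen (Proj B) - gen (Proj (A \<inter> B))) | A B.
        A \<in> gen_vertices G \<and> B \<in> gen_vertices G}
   \<union> {gen (Proj {source G e}) * gen (Edge e) - gen (Edge e) | e. e \<in> edges G}
   \<union> {gen (Edge e) * gen (Proj (erange G e)) - gen (Edge e) | e. e \<in> edges G}
   \<union> {gen (Proj (erange G e)) * gen (Ghost e) - gen (Ghost e) | e. e \<in> edges G}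
   \<union> {gen (Ghost e) * gen (Proj {source G e}) - gen (Ghost e) | e. e \<in> edges G}
   \<union> {gen (Ghost e) * gen (Edge f) - (if e = f then gen (Proj (erange G e)) else 0) | e f.
        e \<in> edges G \<and> f \<in> edges G}
   \<union> {gen (Proj {v}) - (\<Sum>e \<in> out_edges G v. gen (Edge e) * gen (Ghost e)) | v.
        v \<in> vertices G \<and> out_edges G v \<noteq> {} \<and> finite (out_edges G v)}"

text \<open>The algebra ideal generated by the relators. In a non-unital algebra a ring ideal need
  not be a subspace, so closure under scalars is demanded separately; \<open>single 0 c * x\<close> is the
  scalar multiple of \<open>x\<close> by \<open>c\<close>.\<close>

definition relation_ideal ::
    "'k::field itself \<Rightarrow> ('v, 'e) ultragraph \<Rightarrow> ('v, 'e, 'k) free_elem set" where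
  "relation_ideal K G =
     \<Inter> {J. rng_ideal J (free_algebra K G) \<and> (\<forall>c. \<forall>x \<in> J. Poly_Mapping.single 0 c * x \<in> J)
           \<and> relators K G \<subseteq> J}"

definition leavitt_path_algebra ::
    "'k::field itself \<Rightarrow> ('v, 'e) ultragraph \<Rightarrow> ('v, 'e, 'k) free_elem set ring" where
  "leavitt_path_algebra K G = free_algebra K G Quot relation_ideal K G"

definition lpa_gen ::
    "'k::field itself \<Rightarrow> ('v, 'e) ultragraph \<Rightarrow> ('v, 'e) generator \<Rightarrow> ('v, 'e, 'k) free_elem set" where
  "lpa_gen K G g = relation_ideal K G +>\<^bsub>free_algebra K G\<^esub> gen g"

text \<open>The element usually written \<open>p_w^H\<close>, computed in the quotient algebra.\<close>

definition breaking_elem ::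
    "'k::field itself \<Rightarrow> ('v, 'e) ultragraph \<Rightarrow> 'v set set \<Rightarrow> 'v \<Rightarrow> ('v, 'e, 'k) free_elem set" where
  "breaking_elem K G H w =
     lpa_gen K G (Proj {w}) \<ominus>\<^bsub>leavitt_path_algebra K G\<^esub>
       (\<Oplus>\<^bsub>leavitt_path_algebra K G\<^esub> e \<in> {e \<in> out_edges G w. erange G e \<notin> H}.
          lpa_gen K G (Edge e) \<otimes>\<^bsub>leavitt_path_algebra K G\<^esub> lpa_gen K G (Ghost e))"

definition graded_ideal ::
    "'k::field itself \<Rightarrow> ('v, 'e) ultragraph \<Rightarrow> 'v set set \<Rightarrow> 'v set \<Rightarrow> ('v, 'e, 'k) free_elem set set"
  where
  "graded_ideal K G H S =
     rng_genideal (leavitt_path_algebra K G)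
       ((\<lambda>A. lpa_gen K G (Proj A)) ` H \<union> breaking_elem K G H ` S)"

text \<open>The structures above are indeed rings and ideals.\<close>

lemma rng_ideal_Inter:
  assumes "rng R" and ne: "F \<noteq> {}" and F: "\<And>I. I \<in> F \<Longrightarrow> rng_ideal I R"
  shows "rng_ideal (\<Inter> F) R"
proof -
  interpret rng R by fact
  have "subgroup (\<Inter> F) (add_monoid R)"
    by (rule add.subgroups_Inter[OF _ ne])
      (use F in \<open>auto simp: rng_ideal_def additive_subgroup_def\<close>)
  then show ?thesis
    using F
    by (intro rng_ideal.intro rng_ideal_axioms.intro additive_subgroup.intro rng_axioms)
      (auto intro: rng_ideal.I_l_closed rng_ideal.I_r_closed)
qed

lemma free_algebra_simps [simp]:
  "x \<otimes>\<^bsub>free_algebra K G\<^esub> y = x * y" "x \<oplus>\<^bsub>free_algebra K G\<^esub> y = x + y" "\<zero>\<^bsub>free_algebra K G\<^esub> = 0"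
  by (simp_all add: free_algebra_def)

lemma free_algebra_closed:
  shows "0 \<in> carrier (free_algebra K G)"
    and "x \<in> carrier (free_algebra K G) \<Longrightarrow> - x \<in> carrier (free_algebra K G)"
    and "x \<in> carrier (free_algebra K G) \<Longrightarrow> Poly_Mapping.single 0 c * x \<in> carrier (free_algebra K G)"
    and "x \<in> carrier (free_algebra K G) \<Longrightarrow> y \<in> carrier (free_algebra K G) \<Longrightarrow>
      x + y \<in> carrier (free_algebra K G)"
    and "x \<in> carrier (free_algebra K G) \<Longrightarrow> y \<in> carrier (free_algebra K G) \<Longrightarrow>
      x * y \<in> carrier (free_algebra K G)"
  using Poly_Mapping.keys_add[of x y] keys_mult[of x y] keys_mult[of "Poly_Mapping.single 0 c" x]
  by (fastforce simp: free_algebra_def plus_word_def zero_word_def split: if_splits)+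

lemma free_algebra_diff_closed:
  assumes "x \<in> carrier (free_algebra K G)" "y \<in> carrier (free_algebra K G)"
  shows "x - y \<in> carrier (free_algebra K G)"
  using free_algebra_closed(4)[OF assms(1) free_algebra_closed(2)[OF assms(2)]] by simp

lemma rng_free_algebra: "rng (free_algebra K G)"
proof -
  have "abelian_group (free_algebra K G)"
  proof (rule abelian_groupI)
    fix x assume "x \<in> carrier (free_algebra K G)"
    then show "\<exists>y \<in> carrier (free_algebra K G). y \<oplus>\<^bsub>free_algebra K G\<^esub> x = \<zero>\<^bsub>free_algebra K G\<^esub>"
      by (intro bexI[of _ "- x"] free_algebra_closed) simp_all
  qed (simp_all add: free_algebra_closed add.assoc add.commute)
  then show ?thesis
    by (intro rng.intro rng_axioms.intro)
      (simp_all add: free_algebra_closed mult.assoc distrib_left distrib_right)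
qed

lemma gen_in_free_algebra: "g \<in> generators G \<Longrightarrow> gen g \<in> carrier (free_algebra K G)"
  by (simp add: free_algebra_def)

lemma relators_subset_carrier:
  assumes "ultragraph G"
  shows "relators K G \<subseteq> carrier (free_algebra K G)"
proof -
  interpret ultragraph G by fact
  note clo = free_algebra_closed free_algebra_diff_closed
  have sum: "sum h A \<in> carrier (free_algebra K G)"
    if "\<And>a. a \<in> A \<Longrightarrow> h a \<in> carrier (free_algebra K G)" for h :: "'e \<Rightarrow> _" and A
    using that by (induction A rule: infinite_finite_induct) (auto intro: clo)
  have P: "gen (Proj A) \<in> carrier (free_algebra K G)" if "A \<in> gen_vertices G" for A
    using that by (intro gen_in_free_algebra) (simp add: generators_def)
  have E: "gen (Edge e) \<in> carrier (free_algebra K G)"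
      "gen (Ghost e) \<in> carrier (free_algebra K G)" if "e \<in> edges G" for e
    using that by (intro gen_in_free_algebra; simp add: generators_def)+
  show ?thesis
    unfolding relators_def out_edges_def
    by (auto intro!: clo sum P E intro: gen_vertices.intros source_closed)
qed

lemma (in rng) rng_ideal_carrier: "rng_ideal (carrier R) R"
  by (intro rng_ideal.intro rng_ideal_axioms.intro additive_subgroup.intro rng_axioms
      add.subgroup_self m_closed)

lemma rng_ideal_relation_ideal:
  assumes "ultragraph G"
  shows "rng_ideal (relation_ideal K G) (free_algebra K G)"
  unfolding relation_ideal_def
  using rng.rng_ideal_carrier[OF rng_free_algebra] relators_subset_carrier[OF assms]
    free_algebra_closed(3)
  by (intro rng_ideal_Inter rng_free_algebra) blast+

lemma rng_leavitt_path_algebra: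
  assumes "ultragraph G"
  shows "rng (leavitt_path_algebra K G)"
  unfolding leavitt_path_algebra_def
  by (rule rng_ideal.quotient_is_rng[OF rng_ideal_relation_ideal[OF assms]])

lemma lpa_gen_closed:
  assumes "g \<in> generators G"
  shows "lpa_gen K G g \<in> carrier (leavitt_path_algebra K G)"
  using gen_in_free_algebra[OF assms, of K]
  by (auto simp: leavitt_path_algebra_def lpa_gen_def FactRing_def A_RCOSETS_def')

lemma (in rng) rng_ideal_genideal:
  assumes "Y \<subseteq> carrier R"
  shows "rng_ideal (rng_genideal R Y) R" and "Y \<subseteq> rng_genideal R Y"
proof -
  show "rng_ideal (rng_genideal R Y) R"
    unfolding rng_genideal_def using assms rng_ideal_carrier
    by (intro rng_ideal_Inter rng_axioms) blast+
  show "Y \<subseteq> rng_genideal R Y"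
    unfolding rng_genideal_def by blast
qed

lemma rng_ideal_graded_ideal:
  assumes "ultragraph G" and "admissible_pair G H S"
  shows "rng_ideal (graded_ideal K G H S) (leavitt_path_algebra K G)"
proof -
  interpret L: rng "leavitt_path_algebra K G" by (rule rng_leavitt_path_algebra[OF assms(1)])
  have "breaking_elem K G H w \<in> carrier (leavitt_path_algebra K G)" if "w \<in> S" for w
  proof -
    have "w \<in> vertices G"
      using that assms(2) by (auto simp: admissible_pair_def breaking_vertices_def)
    then show ?thesis
      unfolding breaking_elem_def
      by (intro L.minus_closed L.finsum_closed funcsetI L.m_closed lpa_gen_closed)
        (auto simp: generators_def out_edges_def intro: gen_vertices.intros)
  qed
  moreover have "H \<subseteq> gen_vertices G"
    using assms(2) by (simp add: admissible_pair_def hereditary_def)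
  ultimately show ?thesis
    unfolding graded_ideal_def
    by (intro L.rng_ideal_genideal) (auto simp: generators_def intro!: lpa_gen_closed)
qed

end

theory Submission
  imports Defs
begin

text \<open>Let \<open>Q\<close> be the quotient of the Leavitt path algebra by \<open>I\<^bsub>(H,S)\<^esub>\<close>. Every nonzero ideal of \<open>Q\<close> contains
  some \<open>p\<^sub>w\<^sup>H\<close> with \<open>w \<in> B\<^sub>H - S\<close> or an element \<open>k p\<^sub>D + y\<close> with \<open>D \<notin> H\<close>, where \<open>y\<close> is a combination of paths of
  positive length, and exits of loops allow one to remove \<open>y\<close>. A rng in which every nonzero ideal meets a
  fixed decreasing sequence of nonzero idempotents is primitive; in case (ii) the constant sequence
  \<open>p\<^sub>w\<^sup>H\<close> will do, and in case (i) the idempotents \<open>s\<^sub>\<alpha> p\<^sub>C s\<^sub>\<alpha>\<^sup>*\<close> are built along an enumeration of the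
  countable set of vertex sets outside \<open>H\<close>. Conversely, primeness gives the connectedness conditions, while a
  loop \<open>\<gamma>\<close> at \<open>v\<close> without exit makes the corner \<open>p\<^sub>v Q p\<^sub>v\<close> commutative, so that \<open>p\<^sub>v - s\<^sub>\<gamma>\<close> would be invertible in it.
  The nonvanishing facts needed throughout come from a representation of \<open>Q\<close> on functions. Right primitivity
  follows by exchanging \<open>s\<^sub>e\<close> and \<open>s\<^sub>e\<^sup>*\<close> in the opposite rng.\<close>

section \<open>Rings without unit\<close>

text \<open>\<open>Q\<close> has no unit, and multiplication by a scalar need not be multiplication
  by an element of \<open>Q\<close>. Hence paths are applied to an argument instead of being
  elements, and scalars travel inside \<open>q k A\<close>; a projection or a finite sum
  \<open>esum F\<close> of terms \<open>s_e s_e^*\<close> replaces the unit where one is needed. The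
  relations only prove that elements vanish, so every nonvanishing fact has to come from a model;
  its point set carries an additional integer coordinate for the degree, since without it a path and
  a projection could act alike. The two cases of the theorem reflect one dichotomy:
  \<open>p_w^H\<close> is annihilated by every \<open>s_e\<close> on its right and every
  \<open>t_e\<close> on its left, so multiplying by it removes all terms of positive degree without
  any exit, whereas in the absence of such a vertex only exits can remove them. For the same reason
  exits are derived only for \<open>S = B_H\<close>: then every vertex of a loop without exit
  satisfies \<open>p_v = s_e t_e\<close> for the one edge \<open>e\<close> that survives in
  \<open>Q\<close>, and this makes the corner commutative.\<close>

context rng
begin

lemma l_null [simp]: "x \<in> carrier R \<Longrightarrow> \<zero> \<otimes> x = \<zero>"
  using l_distr[of \<zero> \<zero> x] m_closed[of \<zero> x] by (metis add.r_cancel_one' zero_closed l_zero)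

lemma r_null [simp]: "x \<in> carrier R \<Longrightarrow> x \<otimes> \<zero> = \<zero>"
  using r_distr[of \<zero> \<zero> x] m_closed[of x \<zero>] by (metis add.r_cancel_one' zero_closed l_zero)

lemma l_minus: "x \<in> carrier R \<Longrightarrow> y \<in> carrier R \<Longrightarrow> (\<ominus> x) \<otimes> y = \<ominus> (x \<otimes> y)"
  by (intro minus_equality[symmetric]) (simp_all add: m_closed l_neg flip: l_distr)

lemma r_minus: "x \<in> carrier R \<Longrightarrow> y \<in> carrier R \<Longrightarrow> x \<otimes> (\<ominus> y) = \<ominus> (x \<otimes> y)"
  by (intro minus_equality[symmetric]) (simp_all add: m_closed l_neg flip: r_distr)

lemma l_diff: "x \<in> carrier R \<Longrightarrow> y \<in> carrier R \<Longrightarrow> z \<in> carrier R \<Longrightarrow>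
    (x \<ominus> y) \<otimes> z = x \<otimes> z \<ominus> y \<otimes> z"
  by (simp add: a_minus_def l_distr l_minus)

lemma r_diff: "x \<in> carrier R \<Longrightarrow> y \<in> carrier R \<Longrightarrow> z \<in> carrier R \<Longrightarrow>
    z \<otimes> (x \<ominus> y) = z \<otimes> x \<ominus> z \<otimes> y"
  by (simp add: a_minus_def r_distr r_minus)

lemma diff_eq_zero_iff: "x \<in> carrier R \<Longrightarrow> y \<in> carrier R \<Longrightarrow> x \<ominus> y = \<zero> \<longleftrightarrow> x = y"
  by (metis a_minus_def add.inv_closed add.inv_equality add.inv_inv r_neg)

lemma finsum_l_distr:
  assumes "finite F" "\<And>i. i \<in> F \<Longrightarrow> h i \<in> carrier R" "y \<in> carrier R"
  shows "(\<Oplus>i\<in>F. h i) \<otimes> y = (\<Oplus>i\<in>F. h i \<otimes> y)"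
  using assms by (induction F rule: finite_induct) (simp_all add: l_distr m_closed Pi_def finsum_closed)

lemma finsum_r_distr:
  assumes "finite F" "\<And>i. i \<in> F \<Longrightarrow> h i \<in> carrier R" "y \<in> carrier R"
  shows "y \<otimes> (\<Oplus>i\<in>F. h i) = (\<Oplus>i\<in>F. y \<otimes> h i)"
  using assms by (induction F rule: finite_induct) (simp_all add: r_distr m_closed Pi_def finsum_closed)

lemma finsum_zero: "(\<And>i. i \<in> F \<Longrightarrow> h i = \<zero>) \<Longrightarrow> (\<Oplus>i\<in>F. h i) = \<zero>"
  by (rule add.finprod_one_eqI)

lemma rng_idealI:
  assumes "J \<subseteq> carrier R" "\<zero> \<in> J" "\<And>x y. x \<in> J \<Longrightarrow> y \<in> J \<Longrightarrow> x \<oplus> y \<in> J"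
    and "\<And>x. x \<in> J \<Longrightarrow> \<ominus> x \<in> J"
    and "\<And>a x. a \<in> J \<Longrightarrow> x \<in> carrier R \<Longrightarrow> x \<otimes> a \<in> J"
    and "\<And>a x. a \<in> J \<Longrightarrow> x \<in> carrier R \<Longrightarrow> a \<otimes> x \<in> J"
  shows "rng_ideal J R"
  using assms
  by (intro rng_ideal.intro rng_ideal_axioms.intro additive_subgroup.intro rng_axioms add.subgroupI)
    (auto simp flip: a_inv_def)

lemma add_subgroupI:
  assumes "J \<subseteq> carrier R" "\<zero> \<in> J" "\<And>x y. x \<in> J \<Longrightarrow> y \<in> J \<Longrightarrow> x \<oplus> y \<in> J"
    and "\<And>x. x \<in> J \<Longrightarrow> \<ominus> x \<in> J"
  shows "subgroup J (add_monoid R)"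
  using assms by (intro add.subgroupI) (auto simp flip: a_inv_def)

end

section \<open>Opposite rings\<close>

definition rng_op :: "('a, 'b) ring_scheme \<Rightarrow> ('a, 'b) ring_scheme" where
  "rng_op R = R\<lparr>mult := \<lambda>x y. y \<otimes>\<^bsub>R\<^esub> x\<rparr>"

lemma rng_op_simps [simp]:
  "carrier (rng_op R) = carrier R" "x \<otimes>\<^bsub>rng_op R\<^esub> y = y \<otimes>\<^bsub>R\<^esub> x"
  "x \<oplus>\<^bsub>rng_op R\<^esub> y = x \<oplus>\<^bsub>R\<^esub> y" "\<zero>\<^bsub>rng_op R\<^esub> = \<zero>\<^bsub>R\<^esub>"
  "finsum (rng_op R) = finsum R" "a_inv (rng_op R) = a_inv R" "a_minus (rng_op R) = a_minus R"
  by (simp_all add: rng_op_def finsum_def a_inv_def a_minus_def fun_eq_iff)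

lemma add_monoid_rng_op [simp]: "add_monoid (rng_op R) = add_monoid R"
  by (simp add: rng_op_def)

lemma rng_rng_op:
  assumes "rng R" shows "rng (rng_op R)"
proof -
  interpret rng R by fact
  have "abelian_group (rng_op R)"
    by (rule comm_group_abelian_groupI, unfold add_monoid_rng_op, rule a_comm_group)
  then show ?thesis
    by (intro rng.intro rng_axioms.intro) (auto simp: m_closed m_assoc l_distr r_distr)
qed

lemma submodule_rng_op [simp]: "submodule N (rng_op R) M \<longleftrightarrow> submodule N R M"
  by (simp add: submodule_def submodule_axioms_def)

text \<open>A right module stores its action as \<open>a \<odot> x\<close>, so passing to the
  opposite rng changes only the associativity law; submodules, simplicity and faithfulness never
  mention the product of the ring.\<close>

lemma right_primitive_iff_rng_op:
  assumes "rng R" shows "right_primitive R \<longleftrightarrow> left_primitive (rng_op R)"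
proof -
  have *: "rng_right_module R M \<longleftrightarrow> rng_left_module (rng_op R) M" for M :: "('a, 'a) module"
    using assms rng_rng_op[OF assms]
    by (auto simp: rng_right_module_def rng_left_module_def rng_action_def rng_action_axioms_def
      rng_left_module_axioms_def rng_right_module_axioms_def)
  show ?thesis
    unfolding left_primitive_def right_primitive_def simple_action_def faithful_action_def
      submodule_rng_op rng_op_simps * ..
qed

text \<open>The left annihilators of the idempotents form an increasing chain, and a maximal left ideal above
  their union yields the module.\<close>

lemma left_primitive_criterion:
  fixes R :: "'r ring" (structure) and e :: "nat \<Rightarrow> 'r"
  assumes "rng R"
    and closed: "\<And>n. e n \<in> carrier R" and nz: "\<And>n. e n \<noteq> \<zero>"
    and idem: "\<And>n. e n \<otimes> e n = e n"
    and lower: "\<And>n. e n \<otimes> e (Suc n) = e (Suc n)" and lower': "\<And>n. e (Suc n) \<otimes> e n = e (Suc n)"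
    and ideals: "\<And>J. rng_ideal J R \<Longrightarrow> J \<noteq> {\<zero>} \<Longrightarrow> \<exists>n. e n \<in> J"
  shows "left_primitive R"
proof -
  interpret rng R by fact
  have le: "e i \<otimes> e j = e j" "e j \<otimes> e i = e j" if "i \<le> j" for i j
    using that
  proof (induction j rule: dec_induct)
    case (step j)
    have "e i \<otimes> e (Suc j) = (e i \<otimes> e j) \<otimes> e (Suc j)" using closed lower by (simp add: m_assoc)
    then show "e i \<otimes> e (Suc j) = e (Suc j)" using step lower by simp
    have "e (Suc j) \<otimes> e i = e (Suc j) \<otimes> (e j \<otimes> e i)" using closed lower' by (simp flip: m_assoc)
    then show "e (Suc j) \<otimes> e i = e (Suc j)" using step lower' by simp
  qed (use idem in auto)
  define lid where "lid N \<longleftrightarrow> subgroup N (add_monoid R) \<and> (\<forall>a\<in>carrier R. \<forall>x\<in>N. a \<otimes> x \<in> N)" for N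
  define N0 where "N0 = {x \<in> carrier R. \<exists>n. x \<otimes> e n = \<zero>}"
  have up: "x \<otimes> e j = \<zero>" if "x \<otimes> e i = \<zero>" "i \<le> j" "x \<in> carrier R" for x i j
  proof -
    have "(x \<otimes> e i) \<otimes> e j = x \<otimes> e j"
      using m_assoc[OF that(3) closed closed] le(1)[OF that(2)] by simp
    then show ?thesis using that closed by simp
  qed
  have lidN0: "lid N0"
    unfolding lid_def
  proof (intro conjI ballI add_subgroupI)
    show "N0 \<subseteq> carrier R" by (auto simp: N0_def)
    show "\<zero> \<in> N0" using closed by (auto simp: N0_def)
  next
    fix x assume "x \<in> N0"
    then obtain n where "x \<in> carrier R" "x \<otimes> e n = \<zero>" by (auto simp: N0_def)
    then have "(\<ominus> x) \<otimes> e n = \<zero>" using closed by (simp add: l_minus)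
    then show "\<ominus> x \<in> N0" using \<open>x \<in> carrier R\<close> by (auto simp: N0_def)
  next
    fix x y assume "x \<in> N0" "y \<in> N0"
    then obtain m n where *: "x \<in> carrier R" "x \<otimes> e m = \<zero>" "y \<in> carrier R" "y \<otimes> e n = \<zero>"
      by (auto simp: N0_def)
    then have "(x \<oplus> y) \<otimes> e (max m n) = \<zero>"
      using closed up[of x m "max m n"] up[of y n "max m n"] by (simp add: l_distr)
    then show "x \<oplus> y \<in> N0" using * by (auto simp: N0_def)
  next
    fix a x assume "a \<in> carrier R" "x \<in> N0"
    then obtain n where "x \<in> carrier R" "x \<otimes> e n = \<zero>" by (auto simp: N0_def)
    then have "(a \<otimes> x) \<otimes> e n = \<zero>" using closed \<open>a \<in> carrier R\<close> by (simp add: m_assoc)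
    then show "a \<otimes> x \<in> N0" using \<open>a \<in> carrier R\<close> \<open>x \<in> carrier R\<close> by (auto simp: N0_def m_closed)
  qed
  \<comment> \<open>Without a unit, properness is expressed by \<open>e 0 \<notin> N\<close>: a left
    ideal above \<open>N0\<close> that contains \<open>e 0\<close> is everything, by the identity
    behind \<open>right_e0\<close>.\<close>
  define \<A> where "\<A> = {N. lid N \<and> N0 \<subseteq> N \<and> e 0 \<notin> N}"
  have "e 0 \<notin> N0" using nz le(1) by (auto simp: N0_def)
  then have "\<A> \<noteq> {}" using lidN0 by (auto simp: \<A>_def)
  moreover have "\<Union>\<C> \<in> \<A>" if "\<C> \<noteq> {}" "subset.chain \<A> \<C>" for \<C>
  proof -
    have C: "N \<in> \<A>" if "N \<in> \<C>" for N using \<open>subset.chain \<A> \<C>\<close> that by (auto simp: subset_chain_def)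
    have tot: "N \<subseteq> N' \<or> N' \<subseteq> N" if "N \<in> \<C>" "N' \<in> \<C>" for N N'
      using \<open>subset.chain \<A> \<C>\<close> that by (auto simp: subset_chain_def)
    have sub: "subgroup N (add_monoid R)" if "N \<in> \<C>" for N
      using C[OF that] by (auto simp: \<A>_def lid_def)
    have "subgroup (\<Union>\<C>) (add_monoid R)"
    proof (rule add_subgroupI)
      show "\<Union>\<C> \<subseteq> carrier R" using subgroup.subset[OF sub] by auto
      show "\<zero> \<in> \<Union>\<C>" using subgroup.one_closed[OF sub] that(1) by fastforce
      show "\<ominus> x \<in> \<Union>\<C>" if "x \<in> \<Union>\<C>" for x
        using that subgroup.m_inv_closed[OF sub] by (auto simp: a_inv_def)
      show "x \<oplus> y \<in> \<Union>\<C>" if xy: "x \<in> \<Union>\<C>" "y \<in> \<Union>\<C>" for x y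
      proof -
        obtain N where "N \<in> \<C>" "x \<in> N" "y \<in> N" using xy tot by blast
        then show ?thesis using subgroup.m_closed[OF sub[OF \<open>N \<in> \<C>\<close>], of x y] by auto
      qed
    qed
    then show ?thesis using C that(1) by (fastforce simp: \<A>_def lid_def)
  qed
  ultimately obtain N where N: "N \<in> \<A>" and max: "\<And>X. X \<in> \<A> \<Longrightarrow> N \<subseteq> X \<Longrightarrow> X = N"
    using subset_Zorn_nonempty[of \<A>] by blast
  have lidN: "lid N" and N0N: "N0 \<subseteq> N" and e0: "e 0 \<notin> N" using N by (auto simp: \<A>_def)
  interpret N: additive_subgroup N R using lidN by (auto simp: lid_def additive_subgroup_def)
  have lmult: "a \<otimes> x \<in> N" if "a \<in> carrier R" "x \<in> N" for a x using lidN that by (auto simp: lid_def)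
  have Nminus: "\<ominus> x \<in> N" if "x \<in> N" for x using that by (rule N.a_inv_closed)
  have split: "x \<ominus> z = (x \<ominus> y) \<oplus> (y \<ominus> z)"
    if "x \<in> carrier R" "y \<in> carrier R" "z \<in> carrier R" for x y z
    using that by (simp add: a_minus_def a_ac r_neg2)
  define c where "c x = {y \<in> carrier R. y \<ominus> x \<in> N}" for x
  have ceq: "c x = c y \<longleftrightarrow> x \<ominus> y \<in> N" if xy: "x \<in> carrier R" "y \<in> carrier R" for x y
  proof
    assume "c x = c y"
    moreover have "x \<in> c x" using xy N.zero_closed by (simp add: c_def a_minus_def r_neg)
    ultimately show "x \<ominus> y \<in> N" by (simp add: c_def)
  next
    assume n: "x \<ominus> y \<in> N"
    have n': "y \<ominus> x \<in> N" using Nminus[OF n] xy by (simp add: a_minus_def minus_add a_comm)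
    show "c x = c y"
      unfolding c_def using split xy n n' N.a_closed by (intro Collect_cong) metis
  qed
  \<comment> \<open>Representatives turn the operations into functions on cosets;
    \<open>addM\<close> and \<open>smultM\<close> show that the choice does not matter.\<close>
  define r where "r X = (SOME x. x \<in> carrier R \<and> c x = X)" for X
  have r: "r (c x) \<in> carrier R" "r (c x) \<ominus> x \<in> N" if "x \<in> carrier R" for x
  proof -
    have "r (c x) \<in> carrier R \<and> c (r (c x)) = c x"
      unfolding r_def by (rule someI_ex) (use that in blast)
    then show "r (c x) \<in> carrier R" "r (c x) \<ominus> x \<in> N" using ceq that by auto
  qed
  define M :: "('r, 'r set) module" where
    "M = \<lparr>carrier = c ` carrier R, mult = (\<lambda>x y. x), one = c \<zero>, zero = c \<zero>,
      add = (\<lambda>X Y. c (r X \<oplus> r Y)), smult = (\<lambda>a X. c (a \<otimes> r X))\<rparr>"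
  have carM: "carrier M = c ` carrier R" and zeroM: "\<zero>\<^bsub>M\<^esub> = c \<zero>" by (simp_all add: M_def)
  have addM: "c x \<oplus>\<^bsub>M\<^esub> c y = c (x \<oplus> y)" if xy: "x \<in> carrier R" "y \<in> carrier R" for x y
  proof -
    have "(r (c x) \<oplus> r (c y)) \<ominus> (x \<oplus> y) = (r (c x) \<ominus> x) \<oplus> (r (c y) \<ominus> y)"
      using xy r[of x] r[of y] by (simp add: a_minus_def minus_add a_ac)
    then show ?thesis using xy r[of x] r[of y] by (simp add: M_def ceq)
  qed
  have smultM: "a \<odot>\<^bsub>M\<^esub> c x = c (a \<otimes> x)" if "a \<in> carrier R" "x \<in> carrier R" for a x
    using that r[of x] lmult[of a "r (c x) \<ominus> x"] by (simp add: M_def ceq m_closed r_diff)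
  have "abelian_group M"
  proof (rule abelian_groupI)
    fix X assume "X \<in> carrier M"
    then obtain x where "x \<in> carrier R" "X = c x" by (auto simp: carM)
    then show "\<exists>Y\<in>carrier M. Y \<oplus>\<^bsub>M\<^esub> X = \<zero>\<^bsub>M\<^esub>"
      by (intro bexI[of _ "c (\<ominus> x)"]) (auto simp: carM zeroM addM l_neg)
  qed (auto simp: carM zeroM addM a_ac)
  then have mod: "rng_left_module R M"
    by (intro rng_left_module.intro rng_action.intro rng_left_module_axioms.intro
        rng_action_axioms.intro rng_axioms)
      (auto simp: carM addM smultM m_closed l_distr r_distr m_assoc)
  then interpret M: rng_left_module R M .
  have c0: "c x = \<zero>\<^bsub>M\<^esub> \<longleftrightarrow> x \<in> N" if "x \<in> carrier R" for x
    using that ceq[of x \<zero>] minus_equality[of \<zero> \<zero>] by (simp add: zeroM a_minus_def)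
  have Nsub: "N \<subseteq> carrier R" by (rule N.a_subset)
  \<comment> \<open>\<open>e 0\<close> is a right unit modulo \<open>N0\<close>, because it kills
    the difference from the right. This replaces the unit in the argument that a maximal left ideal
    has a simple quotient.\<close>
  have right_e0: "x \<ominus> x \<otimes> e 0 \<in> N" if "x \<in> carrier R" for x
  proof -
    have "(x \<ominus> x \<otimes> e 0) \<otimes> e 0 = \<zero>"
      using that closed idem by (simp add: a_minus_def l_distr l_minus m_closed m_assoc r_neg)
    then have "x \<ominus> x \<otimes> e 0 \<in> N0" using that closed by (auto simp: N0_def m_closed)
    then show ?thesis using N0N by blast
  qed
  have "simple_action R M"
    unfolding simple_action_def
  proof (intro conjI allI impI)
    show "\<exists>a\<in>carrier R. \<exists>x\<in>carrier M. a \<odot>\<^bsub>M\<^esub> x \<noteq> \<zero>\<^bsub>M\<^esub>"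
      using closed[of 0] e0 by (intro bexI[of _ "e 0"] bexI[of _ "c (e 0)"]) (simp_all add: smultM c0 idem carM)
  next
    fix L assume L: "submodule L R M"
    interpret L: submodule L R M by (rule L)
    define N' where "N' = {x \<in> carrier R. c x \<in> L}"
    have LN': "L = c ` N'" using L.subset by (auto simp: N'_def carM)
    have zL: "\<zero>\<^bsub>M\<^esub> \<in> L" using L.one_closed by simp
    have "N \<subseteq> N'"
    proof
      fix x assume "x \<in> N"
      then have "x \<in> carrier R" "c x = \<zero>\<^bsub>M\<^esub>" using c0 Nsub by blast+
      then show "x \<in> N'" using zL by (simp add: N'_def)
    qed
    have "lid N'"
      unfolding lid_def
    proof (intro conjI ballI add_subgroupI)
      show "\<zero> \<in> N'" using \<open>N \<subseteq> N'\<close> N.zero_closed by blast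
      show "a \<otimes> x \<in> N'" if "a \<in> carrier R" "x \<in> N'" for a x
        using that L.smult_closed[of a "c x"] by (simp add: N'_def smultM m_closed)
      show "x \<oplus> y \<in> N'" if "x \<in> N'" "y \<in> N'" for x y
        using that L.m_closed[of "c x" "c y"] by (simp add: N'_def addM)
      show "\<ominus> x \<in> N'" if "x \<in> N'" for x
      proof -
        have x: "x \<in> carrier R" "c x \<in> L" using that by (auto simp: N'_def)
        have "\<ominus>\<^bsub>M\<^esub> c x = c (\<ominus> x)"
          using x by (intro M.M.minus_equality) (auto simp: carM addM zeroM l_neg)
        moreover have "\<ominus>\<^bsub>M\<^esub> c x \<in> L" using L.m_inv_closed[OF x(2)] by (simp add: a_inv_def)
        ultimately show ?thesis using x by (simp add: N'_def)
      qed
    qed (auto simp: N'_def)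
    show "L = {\<zero>\<^bsub>M\<^esub>} \<or> L = carrier M"
    proof (cases "e 0 \<in> N'")
      case True
      have "c x \<in> L" if x: "x \<in> carrier R" for x
      proof -
        have "c x = c (x \<otimes> e 0)" using x closed right_e0 by (simp add: ceq m_closed)
        moreover have "x \<odot>\<^bsub>M\<^esub> c (e 0) \<in> L" using True x L.smult_closed by (simp add: N'_def)
        ultimately show ?thesis using x closed by (simp add: smultM)
      qed
      then show ?thesis using L.subset by (auto simp: carM)
    next
      case False
      then have "N' \<in> \<A>" using \<open>lid N'\<close> \<open>N \<subseteq> N'\<close> N0N by (auto simp: \<A>_def)
      then have "N' = N" using max \<open>N \<subseteq> N'\<close> by blast
      then have "L \<subseteq> {\<zero>\<^bsub>M\<^esub>}" using LN' c0 Nsub by auto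
      then show ?thesis using zL by auto
    qed
  qed
  moreover have "faithful_action R M"
    unfolding faithful_action_def
  proof (intro ballI impI)
    fix a assume a: "a \<in> carrier R" and kill: "\<forall>x\<in>carrier M. a \<odot>\<^bsub>M\<^esub> x = \<zero>\<^bsub>M\<^esub>"
    \<comment> \<open>\<open>J\<close> is the annihilator of the module. If it contained some
      \<open>e n\<close>, then \<open>e n = e n \<otimes> e 0\<close> would lie in \<open>N\<close>,
      and so would \<open>e 0 \<ominus> e n\<close>, which \<open>e n\<close> kills; together they
      put \<open>e 0\<close> into \<open>N\<close>.\<close>
    define J where "J = {a \<in> carrier R. \<forall>x\<in>carrier R. a \<otimes> x \<in> N}"
    have "a \<in> J" using a kill by (auto simp: J_def carM smultM c0 m_closed)
    have J: "rng_ideal J R"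
      by (rule rng_idealI)
        (auto simp: J_def l_distr l_minus m_closed m_assoc N.a_closed Nminus N.zero_closed lmult)
    have "J = {\<zero>}"
    proof (rule ccontr)
      assume "J \<noteq> {\<zero>}"
      then obtain n where "e n \<in> J" using ideals J by blast
      then have "e n \<otimes> e 0 \<in> N" using closed by (auto simp: J_def)
      then have n: "e n \<in> N" using le(2)[of 0 n] by simp
      have "(e 0 \<ominus> e n) \<otimes> e n = \<zero>" using closed idem le(1)[of 0 n] by (simp add: a_minus_def l_distr l_minus r_neg)
      then have "e 0 \<ominus> e n \<in> N" using closed N0N by (auto simp: N0_def)
      then have "(e 0 \<ominus> e n) \<oplus> e n \<in> N" using n N.a_closed by blast
      then show False using e0 closed by (simp add: a_minus_def a_assoc l_neg)
    qed
    then show "a = \<zero>" using \<open>a \<in> J\<close> by auto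
  qed
  ultimately show ?thesis using mod left_primitiveI by blast
qed

section \<open>Simple faithful modules\<close>

locale simple_faithful_module = rng_left_module +
  assumes simple: "simple_action R M" and faithful: "faithful_action R M"
begin

lemma smult_l_null [simp]: "x \<in> carrier M \<Longrightarrow> \<zero>\<^bsub>R\<^esub> \<odot>\<^bsub>M\<^esub> x = \<zero>\<^bsub>M\<^esub>"
  using smult_l_distr[of "\<zero>\<^bsub>R\<^esub>" "\<zero>\<^bsub>R\<^esub>" x] smult_closed[of "\<zero>\<^bsub>R\<^esub>" x]
  by (metis M.add.r_cancel_one' R.zero_closed R.l_zero)

lemma smult_r_null [simp]: "a \<in> carrier R \<Longrightarrow> a \<odot>\<^bsub>M\<^esub> \<zero>\<^bsub>M\<^esub> = \<zero>\<^bsub>M\<^esub>"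
  using smult_r_distr[of a "\<zero>\<^bsub>M\<^esub>" "\<zero>\<^bsub>M\<^esub>"] smult_closed[of a "\<zero>\<^bsub>M\<^esub>"]
  by (metis M.add.r_cancel_one' M.zero_closed M.l_zero)

lemma smult_l_minus: "a \<in> carrier R \<Longrightarrow> x \<in> carrier M \<Longrightarrow> (\<ominus>\<^bsub>R\<^esub> a) \<odot>\<^bsub>M\<^esub> x = \<ominus>\<^bsub>M\<^esub> (a \<odot>\<^bsub>M\<^esub> x)"
  using smult_l_distr[of "\<ominus>\<^bsub>R\<^esub> a" a x]
  by (intro M.minus_equality[symmetric]) (auto simp: smult_closed R.l_neg)

lemma smult_r_minus: "a \<in> carrier R \<Longrightarrow> x \<in> carrier M \<Longrightarrow> a \<odot>\<^bsub>M\<^esub> (\<ominus>\<^bsub>M\<^esub> x) = \<ominus>\<^bsub>M\<^esub> (a \<odot>\<^bsub>M\<^esub> x)"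
  using smult_r_distr[of a "\<ominus>\<^bsub>M\<^esub> x" x]
  by (intro M.minus_equality[symmetric]) (auto simp: smult_closed M.l_neg)

text \<open>\<open>R m\<close> is a submodule, but without a unit it might be zero. The elements
  killed by all of \<open>R\<close> form a submodule too, and not the whole module since the action
  is not zero; hence they are trivial and \<open>R m\<close> is everything.\<close>

lemma generate:
  assumes m: "m \<in> carrier M" "m \<noteq> \<zero>\<^bsub>M\<^esub>"
    and x: "x \<in> carrier M"
  shows "\<exists>r\<in>carrier R. r \<odot>\<^bsub>M\<^esub> m = x"
proof -
  have sub: "submodule N R M"
    if "N \<subseteq> carrier M" "\<zero>\<^bsub>M\<^esub> \<in> N" "\<And>x y. x \<in> N \<Longrightarrow> y \<in> N \<Longrightarrow> x \<oplus>\<^bsub>M\<^esub> y \<in> N"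
      "\<And>x. x \<in> N \<Longrightarrow> \<ominus>\<^bsub>M\<^esub> x \<in> N" "\<And>a x. a \<in> carrier R \<Longrightarrow> x \<in> N \<Longrightarrow> a \<odot>\<^bsub>M\<^esub> x \<in> N" for N
    using that by (intro submodule.intro submodule_axioms.intro M.add.subgroupI) (auto simp flip: a_inv_def)
  define Z where "Z = {x \<in> carrier M. \<forall>a\<in>carrier R. a \<odot>\<^bsub>M\<^esub> x = \<zero>\<^bsub>M\<^esub>}"
  have "submodule Z R M"
    by (rule sub) (auto simp: Z_def smult_r_distr smult_r_minus smult_closed simp flip: smult_assoc_left)
  then have "Z = {\<zero>\<^bsub>M\<^esub>}"
    using simple unfolding simple_action_def Z_def by blast
  then have ne: "(\<lambda>a. a \<odot>\<^bsub>M\<^esub> m) ` carrier R \<noteq> {\<zero>\<^bsub>M\<^esub>}"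
    using m unfolding Z_def by blast
  have "submodule ((\<lambda>a. a \<odot>\<^bsub>M\<^esub> m) ` carrier R) R M"
  proof (rule sub)
    show "\<zero>\<^bsub>M\<^esub> \<in> (\<lambda>a. a \<odot>\<^bsub>M\<^esub> m) ` carrier R" using m by (intro image_eqI[of _ _ "\<zero>\<^bsub>R\<^esub>"]) auto
  qed (use m in \<open>auto simp: smult_closed R.m_closed simp flip: smult_l_distr smult_l_minus smult_assoc_left\<close>)
  then have "(\<lambda>a. a \<odot>\<^bsub>M\<^esub> m) ` carrier R = carrier M"
    using ne simple unfolding simple_action_def by blast
  then show ?thesis using x by (metis (no_types, lifting) image_iff)
qed

end

lemma left_primitive_nonzero:
  assumes "left_primitive R" shows "carrier R \<noteq> {\<zero>\<^bsub>R\<^esub>}"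
proof
  assume R: "carrier R = {\<zero>\<^bsub>R\<^esub>}"
  obtain M :: "('a, 'a) module" where "rng_left_module R M" "simple_action R M" "faithful_action R M"
    using assms by (auto simp: left_primitive_def)
  then interpret simple_faithful_module R M
    by (intro simple_faithful_module.intro simple_faithful_module_axioms.intro)
  show False using simple R by (auto simp: simple_action_def)
qed

text \<open>Move \<open>b m \<noteq> 0\<close> by some \<open>r\<close> to a vector that
  \<open>a\<close> does not kill. All necessary conditions on connections are drawn from this form
  of primeness.\<close>

lemma left_primitive_prime:
  fixes R :: "'r ring" (structure)
  assumes "left_primitive R" and a: "a \<in> carrier R" "a \<noteq> \<zero>" and b: "b \<in> carrier R" "b \<noteq> \<zero>"
  shows "\<exists>r\<in>carrier R. a \<otimes> r \<otimes> b \<noteq> \<zero>"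
proof -
  obtain M :: "('r, 'r) module" where "rng_left_module R M" "simple_action R M" "faithful_action R M"
    using assms(1) by (auto simp: left_primitive_def)
  then interpret simple_faithful_module R M
    by (intro simple_faithful_module.intro simple_faithful_module_axioms.intro)
  obtain m where m: "m \<in> carrier M" "b \<odot>\<^bsub>M\<^esub> m \<noteq> \<zero>\<^bsub>M\<^esub>" using faithful b by (auto simp: faithful_action_def)
  obtain m' where m': "m' \<in> carrier M" "a \<odot>\<^bsub>M\<^esub> m' \<noteq> \<zero>\<^bsub>M\<^esub>" using faithful a by (auto simp: faithful_action_def)
  obtain r where r: "r \<in> carrier R" "r \<odot>\<^bsub>M\<^esub> (b \<odot>\<^bsub>M\<^esub> m) = m'"
    using generate[OF _ m(2) m'(1)] m b smult_closed by metis
  have "(a \<otimes> r \<otimes> b) \<odot>\<^bsub>M\<^esub> m = a \<odot>\<^bsub>M\<^esub> m'"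
    using a b r m by (simp add: smult_assoc_left m_closed smult_closed)
  then show ?thesis using r m' m by (metis smult_l_null)
qed

text \<open>A commutative corner acts on the corresponding part of the module through a field.\<close>

lemma left_primitive_commutative_corner:
  fixes R :: "'r ring" (structure)
  assumes "left_primitive R" and p: "p \<in> carrier R" "p \<otimes> p = p"
    and comm: "\<And>x y. x \<in> carrier R \<Longrightarrow> y \<in> carrier R \<Longrightarrow>
      p \<otimes> x \<otimes> p = x \<Longrightarrow> p \<otimes> y \<otimes> p = y \<Longrightarrow> x \<otimes> y = y \<otimes> x"
    and a: "a \<in> carrier R" "a \<noteq> \<zero>" "p \<otimes> a \<otimes> p = a"
  shows "\<exists>y\<in>carrier R. y \<otimes> a = p \<and> a \<otimes> y = p"
proof -
  obtain M :: "('r, 'r) module" where "rng_left_module R M" "simple_action R M" "faithful_action R M"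
    using assms(1) by (auto simp: left_primitive_def)
  then interpret simple_faithful_module R M
    by (intro simple_faithful_module.intro simple_faithful_module_axioms.intro)
  note cl = R.m_closed smult_closed
  have pp: "p \<otimes> (p \<otimes> x) = p \<otimes> x" if "x \<in> carrier R" for x
    using R.m_assoc[of p p x] p that by simp
  have "p \<otimes> a \<otimes> p \<otimes> p = p \<otimes> a \<otimes> p" "p \<otimes> (p \<otimes> a \<otimes> p) = p \<otimes> a \<otimes> p"
    using a(1) p by (simp_all add: R.m_assoc cl pp)
  then have ap: "a \<otimes> p = a" "p \<otimes> a = a" unfolding a(3) .
  obtain m where m: "m \<in> carrier M" "a \<odot>\<^bsub>M\<^esub> m \<noteq> \<zero>\<^bsub>M\<^esub>" using faithful a by (auto simp: faithful_action_def)
  define m0 where "m0 = p \<odot>\<^bsub>M\<^esub> m"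
  have m0: "m0 \<in> carrier M" "p \<odot>\<^bsub>M\<^esub> m0 = m0" using p m by (simp_all add: m0_def cl flip: smult_assoc_left)
  have am0: "a \<odot>\<^bsub>M\<^esub> m0 \<noteq> \<zero>\<^bsub>M\<^esub>" using m a p ap by (simp add: m0_def flip: smult_assoc_left)
  obtain r where r: "r \<in> carrier R" "r \<odot>\<^bsub>M\<^esub> (a \<odot>\<^bsub>M\<^esub> m0) = m0"
    using generate[OF _ am0 m0(1)] m0 a smult_closed by metis
  \<comment> \<open>Compressing \<open>r\<close> to the corner keeps its effect, as both
    \<open>a m0\<close> and \<open>m0\<close> are fixed by \<open>p\<close>.\<close>
  define y where "y = p \<otimes> r \<otimes> p"
  have y: "y \<in> carrier R" "p \<otimes> y \<otimes> p = y" using p r by (simp_all add: y_def cl R.m_assoc pp)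
  have "(y \<otimes> a) \<odot>\<^bsub>M\<^esub> m0 = p \<odot>\<^bsub>M\<^esub> (r \<odot>\<^bsub>M\<^esub> (p \<odot>\<^bsub>M\<^esub> (a \<odot>\<^bsub>M\<^esub> m0)))"
    using p r a m0 by (simp add: y_def smult_assoc_left cl)
  also have "p \<odot>\<^bsub>M\<^esub> (a \<odot>\<^bsub>M\<^esub> m0) = a \<odot>\<^bsub>M\<^esub> m0" using p a m0 ap by (simp flip: smult_assoc_left)
  finally have ya: "(y \<otimes> a) \<odot>\<^bsub>M\<^esub> m0 = m0" using r m0 by simp
  define d where "d = y \<otimes> a \<ominus> p"
  have d: "d \<in> carrier R" "p \<otimes> d \<otimes> p = d"
  proof -
    show "d \<in> carrier R" using y a p by (simp add: d_def cl)
    have "p \<otimes> (y \<otimes> a) = y \<otimes> a"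
      using p r a by (simp add: y_def R.m_assoc cl pp)
    then show "p \<otimes> d \<otimes> p = d"
      using y a p ap by (simp add: d_def R.l_diff R.r_diff cl R.m_assoc)
  qed
  have dm0: "d \<odot>\<^bsub>M\<^esub> m0 = \<zero>\<^bsub>M\<^esub>"
    using ya m0 y a p
    by (simp add: d_def a_minus_def smult_l_distr smult_l_minus cl M.r_neg)
  \<comment> \<open>Every \<open>z\<close> is \<open>t m0\<close>, and
    \<open>d t m0 = d t' m0 = t' d m0 = 0\<close> with \<open>t'\<close> the compression of
    \<open>t\<close> to the corner. So \<open>d\<close> kills the whole module and not only
    \<open>m0\<close>.\<close>
  have "d \<odot>\<^bsub>M\<^esub> z = \<zero>\<^bsub>M\<^esub>" if z: "z \<in> carrier M" for z
  proof -
    have "m0 \<noteq> \<zero>\<^bsub>M\<^esub>" using am0 a by auto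
    then obtain t where t: "t \<in> carrier R" "z = t \<odot>\<^bsub>M\<^esub> m0"
      using generate[OF m0(1) _ z] by metis
    define t' where "t' = p \<otimes> t \<otimes> p"
    have t': "t' \<in> carrier R" "p \<otimes> t' \<otimes> p = t'"
      using p t by (simp_all add: t'_def cl R.m_assoc pp)
    have "p \<otimes> d \<otimes> p \<otimes> p = p \<otimes> d \<otimes> p" using d(1) p by (simp add: R.m_assoc cl)
    then have "d \<otimes> p = d" unfolding d(2) .
    then have "d \<odot>\<^bsub>M\<^esub> z = (d \<otimes> p) \<odot>\<^bsub>M\<^esub> (t \<odot>\<^bsub>M\<^esub> (p \<odot>\<^bsub>M\<^esub> m0))"
      using t m0 by simp
    also have "\<dots> = (d \<otimes> t') \<odot>\<^bsub>M\<^esub> m0"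
      using d p t m0 by (simp add: smult_assoc_left cl t'_def)
    also have "\<dots> = (t' \<otimes> d) \<odot>\<^bsub>M\<^esub> m0" using comm d t' by metis
    also have "\<dots> = \<zero>\<^bsub>M\<^esub>" using d t' m0 dm0 by (simp add: smult_assoc_left)
    finally show ?thesis .
  qed
  then have "d = \<zero>" using faithful d by (simp add: faithful_action_def)
  then have "y \<otimes> a = p" using y a p by (simp add: d_def R.diff_eq_zero_iff cl)
  moreover have "a \<otimes> y = y \<otimes> a" using comm a y by metis
  ultimately show ?thesis using y by metis
qed

section \<open>Paths and spans\<close>

text \<open>The product \<open>s_\<alpha> x\<close>, with \<open>x\<close> as a parameter because
  the empty path has no element of its own in a rng without unit.\<close>

primrec lpath :: "('q, 'b) ring_scheme \<Rightarrow> ('e \<Rightarrow> 'q) \<Rightarrow> 'e list \<Rightarrow> 'q \<Rightarrow> 'q" where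
  "lpath R s [] x = x"
| "lpath R s (e # \<alpha>) x = s e \<otimes>\<^bsub>R\<^esub> lpath R s \<alpha> x"

text \<open>The product \<open>x s_\<alpha>^*\<close>: ghosts of later edges stand nearer to
  \<open>x\<close>.\<close>

primrec rpath :: "('q, 'b) ring_scheme \<Rightarrow> ('e \<Rightarrow> 'q) \<Rightarrow> 'e list \<Rightarrow> 'q \<Rightarrow> 'q" where
  "rpath R t [] x = x"
| "rpath R t (e # \<alpha>) x = rpath R t \<alpha> x \<otimes>\<^bsub>R\<^esub> t e"

text \<open>The product \<open>s_\<alpha>^* x\<close>, which strips \<open>\<alpha>\<close> from the
  left; the first edge acts first, so the recursion changes \<open>x\<close>.\<close>

primrec lghost :: "('q, 'b) ring_scheme \<Rightarrow> ('e \<Rightarrow> 'q) \<Rightarrow> 'e list \<Rightarrow> 'q \<Rightarrow> 'q" where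
  "lghost R t [] x = x"
| "lghost R t (e # \<alpha>) x = lghost R t \<alpha> (t e \<otimes>\<^bsub>R\<^esub> x)"

lemma path_rng_op [simp]:
  "lpath (rng_op R) f \<alpha> x = rpath R f \<alpha> x" "rpath (rng_op R) f \<alpha> x = lpath R f \<alpha> x"
  by (induction \<alpha>) simp_all

text \<open>The set \<open>R\<close> with \<open>p_A s_\<alpha> = s_\<alpha> p_R\<close>; for
  nonempty \<open>\<alpha>\<close> it is empty unless \<open>\<alpha>\<close> is a path starting in
  \<open>A\<close>. Unlike \<open>path_range\<close> it also makes sense for the empty path, which
  merges the two cases of \<open>connects\<close>.\<close>

primrec reach :: "('v, 'e) ultragraph \<Rightarrow> 'v set \<Rightarrow> 'e list \<Rightarrow> 'v set" where
  "reach G A [] = A"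
| "reach G A (e # \<alpha>) = (if source G e \<in> A then reach G (erange G e) \<alpha> else {})"

lemma reach_empty [simp]: "reach G {} \<alpha> = {}"
  by (cases \<alpha>) auto

lemma reach_mono: "A \<subseteq> B \<Longrightarrow> reach G A \<alpha> \<subseteq> reach G B \<alpha>"
  by (cases \<alpha>) auto

lemma reach_append: "reach G A (\<alpha> @ \<beta>) = reach G (reach G A \<alpha>) \<beta>"
  by (induction \<alpha> arbitrary: A) auto

lemma reach_gen:
  "A \<in> gen_vertices G \<Longrightarrow> set \<alpha> \<subseteq> edges G \<Longrightarrow> reach G A \<alpha> \<in> gen_vertices G"
  by (induction \<alpha> arbitrary: A) (auto intro: gen_vertices.intros)

lemma reach_path:
  assumes "set \<alpha> \<subseteq> edges G" "\<alpha> \<noteq> []" "reach G A \<alpha> \<noteq> {}"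
  shows "is_path G \<alpha>" "path_source G \<alpha> \<in> A" "path_range G \<alpha> = reach G A \<alpha>"
proof -
  have "is_path G \<alpha> \<and> path_source G \<alpha> \<in> A \<and> path_range G \<alpha> = reach G A \<alpha>"
    using assms
  proof (induction \<alpha> arbitrary: A)
    case (Cons e \<alpha>)
    then have src: "source G e \<in> A" and ne: "reach G (erange G e) \<alpha> \<noteq> {}"
      by (auto split: if_splits)
    show ?case
    proof (cases \<alpha>)
      case Nil
      then show ?thesis using src Cons.prems by (simp add: is_path_def path_source_def path_range_def)
    next
      case (Cons f \<beta>)
      with Cons.IH[of "erange G e"] Cons.prems ne
      have "is_path G \<alpha> \<and> path_source G \<alpha> \<in> erange G e \<and> path_range G \<alpha> = reach G (erange G e) \<alpha>"
        by simp
      then show ?thesis using src Cons.prems Cons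
        by (simp add: is_path_def path_source_def path_range_def)
    qed
  qed simp
  then show "is_path G \<alpha>" "path_source G \<alpha> \<in> A" "path_range G \<alpha> = reach G A \<alpha>" by auto
qed

lemma path_reach:
  assumes "is_path G \<alpha>" "path_source G \<alpha> \<in> A"
  shows "set \<alpha> \<subseteq> edges G" "\<alpha> \<noteq> []" "reach G A \<alpha> = path_range G \<alpha>"
proof -
  have "reach G A \<alpha> = path_range G \<alpha>" 
    using assms
  proof (induction \<alpha> arbitrary: A)
    case (Cons e \<alpha>)
    then show ?case
      by (cases \<alpha>) (auto simp: is_path_def path_source_def path_range_def split: if_splits)
  qed (simp add: is_path_def)
  then show "set \<alpha> \<subseteq> edges G" "\<alpha> \<noteq> []" "reach G A \<alpha> = path_range G \<alpha>"
    using assms by (auto simp: is_path_def)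
qed

lemma connects_iff_reach:
  assumes "B \<noteq> {}"
  shows "connects G A B \<longleftrightarrow> (\<exists>\<alpha>. set \<alpha> \<subseteq> edges G \<and> B \<subseteq> reach G A \<alpha>)"
proof
  assume "connects G A B"
  then show "\<exists>\<alpha>. set \<alpha> \<subseteq> edges G \<and> B \<subseteq> reach G A \<alpha>"
    unfolding connects_def using path_reach by (metis empty_set empty_subsetI reach.simps(1))
next
  assume "\<exists>\<alpha>. set \<alpha> \<subseteq> edges G \<and> B \<subseteq> reach G A \<alpha>"
  then obtain \<alpha> where \<alpha>: "set \<alpha> \<subseteq> edges G" "B \<subseteq> reach G A \<alpha>" by blast
  with assms have "reach G A \<alpha> \<noteq> {}" by blast
  show "connects G A B"
  proof (cases "\<alpha> = []")
    case False
    with reach_path[of \<alpha> G A] \<alpha> \<open>reach G A \<alpha> \<noteq> {}\<close> show ?thesis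
      unfolding connects_def by metis
  qed (use \<alpha> in \<open>simp add: connects_def\<close>)
qed

text \<open>The index bounds the number of summands, which is what \<open>projection_mem\<close>
  minimises. No scalars occur, because the members of the sets used below carry an arbitrary
  coefficient \<open>k\<close>.\<close>

primrec nspan :: "('q, 'b) ring_scheme \<Rightarrow> 'q set \<Rightarrow> nat \<Rightarrow> 'q set" where
  "nspan R T 0 = {\<zero>\<^bsub>R\<^esub>}"
| "nspan R T (Suc n) = {a \<oplus>\<^bsub>R\<^esub> x | a x. a \<in> insert \<zero>\<^bsub>R\<^esub> T \<and> x \<in> nspan R T n}"

definition aspan :: "('q, 'b) ring_scheme \<Rightarrow> 'q set \<Rightarrow> 'q set" where
  "aspan R T = (\<Union>n. nspan R T n)"

context rng
begin

lemma nspan_closed: "T \<subseteq> carrier R \<Longrightarrow> x \<in> nspan R T n \<Longrightarrow> x \<in> carrier R"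
  by (induction n arbitrary: x) auto

lemma nspan_zero: "\<zero> \<in> nspan R T n"
proof (induction n)
  case (Suc n)
  then show ?case using l_zero[OF zero_closed] by force
qed simp

lemma nspan_add:
  assumes "T \<subseteq> carrier R" "x \<in> nspan R T m" "y \<in> nspan R T n"
  shows "x \<oplus> y \<in> nspan R T (m + n)"
  using assms(2)
proof (induction m arbitrary: x)
  case 0
  then show ?case using assms nspan_closed by auto
next
  case (Suc m)
  then obtain a z where az: "x = a \<oplus> z" "a \<in> insert \<zero> T" "z \<in> nspan R T m" by auto
  have "a \<in> carrier R" "z \<in> carrier R" "y \<in> carrier R"
    using az assms nspan_closed by auto
  then have "x \<oplus> y = a \<oplus> (z \<oplus> y)" using az by (simp add: a_assoc)
  then show ?case using Suc.IH az by auto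
qed

lemma nspan_base: "a \<in> T \<Longrightarrow> a \<in> carrier R \<Longrightarrow> a \<in> nspan R T (Suc 0)"
  by (simp, rule exI[of _ a], simp)

lemma nspan_map:
  assumes "T \<subseteq> carrier R" "x \<in> nspan R T n"
    and "F \<zero> = \<zero>" "\<And>a x. a \<in> carrier R \<Longrightarrow> x \<in> carrier R \<Longrightarrow> F (a \<oplus> x) = F a \<oplus> F x"
    and "\<And>a. a \<in> T \<Longrightarrow> F a \<in> insert \<zero> T'"
  shows "F x \<in> nspan R T' n"
  using assms(2)
proof (induction n arbitrary: x)
  case 0
  then show ?case using assms by auto
next
  case (Suc n)
  then obtain a z where az: "x = a \<oplus> z" "a \<in> insert \<zero> T" "z \<in> nspan R T n" by auto
  then have "a \<in> carrier R" "z \<in> carrier R" using assms(1) nspan_closed by auto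
  then have "F x = F a \<oplus> F z" using az assms(4) by simp
  moreover have "F a \<in> insert \<zero> T'" using az assms(3,5) by auto
  ultimately show ?case using Suc.IH az by auto
qed

lemma aspan_closed: "T \<subseteq> carrier R \<Longrightarrow> x \<in> aspan R T \<Longrightarrow> x \<in> carrier R"
  unfolding aspan_def using nspan_closed by blast

lemma aspan_zero: "\<zero> \<in> aspan R T"
  unfolding aspan_def using nspan_zero by blast

lemma aspan_add: "T \<subseteq> carrier R \<Longrightarrow> x \<in> aspan R T \<Longrightarrow> y \<in> aspan R T \<Longrightarrow> x \<oplus> y \<in> aspan R T"
  unfolding aspan_def UN_iff by (meson UNIV_I nspan_add)

lemma aspan_base: "T \<subseteq> carrier R \<Longrightarrow> a \<in> T \<Longrightarrow> a \<in> aspan R T"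
  unfolding aspan_def UN_iff by (meson UNIV_I nspan_base subsetD)

lemma aspan_induct [consumes 2, case_names zero add]:
  assumes "x \<in> aspan R T" "T \<subseteq> carrier R" and "P \<zero>"
    and "\<And>a x. a \<in> T \<Longrightarrow> x \<in> aspan R T \<Longrightarrow> x \<in> carrier R \<Longrightarrow> P x \<Longrightarrow> P (a \<oplus> x)"
  shows "P x"
proof -
  have "P x" if "x \<in> nspan R T n" for n
    using that
  proof (induction n arbitrary: x)
    case (Suc n)
    then obtain a z where az: "x = a \<oplus> z" "a \<in> insert \<zero> T" "z \<in> nspan R T n" by auto
    moreover have "z \<in> carrier R" using az assms(2) nspan_closed by auto
    ultimately show ?case using Suc.IH assms(4)[of a z] by (auto simp: aspan_def)
  qed (use assms in auto)
  then show ?thesis using assms(1) by (auto simp: aspan_def)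
qed

lemma aspan_map:
  assumes "x \<in> aspan R T" "T \<subseteq> carrier R" "T' \<subseteq> carrier R"
    and "F \<zero> = \<zero>" "\<And>a x. a \<in> carrier R \<Longrightarrow> x \<in> carrier R \<Longrightarrow> F (a \<oplus> x) = F a \<oplus> F x"
    and "\<And>a. a \<in> T \<Longrightarrow> F a \<in> aspan R T'"
  shows "F x \<in> aspan R T'"
  using assms(1,2)
proof (induction rule: aspan_induct)
  case (add a x)
  then have "F (a \<oplus> x) = F a \<oplus> F x" using assms(2,5) by auto
  then show ?case using aspan_add[OF assms(3) assms(6)[OF add(1)] add.IH] by simp
next
  case zero
  show ?case unfolding assms(4) by (rule aspan_zero)
qed

lemma aspan_mono: "T \<subseteq> T' \<Longrightarrow> T' \<subseteq> carrier R \<Longrightarrow> x \<in> aspan R T \<Longrightarrow> x \<in> aspan R T'"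
  by (rule aspan_map[where F = "\<lambda>x. x" and T = T]) (auto intro: aspan_base)

lemma aspan_Un:
  assumes "x \<in> aspan R (T \<union> T')" "T \<subseteq> carrier R" "T' \<subseteq> carrier R"
  shows "\<exists>y\<in>aspan R T. \<exists>z\<in>aspan R T'. x = y \<oplus> z"
proof -
  have "T \<union> T' \<subseteq> carrier R" using assms by auto
  with assms(1) show ?thesis
  proof (induction rule: aspan_induct)
    case zero
    show ?case using aspan_zero[of T] aspan_zero[of T'] l_zero[OF zero_closed] by metis
  next
    case (add a x)
    then obtain y z where yz: "y \<in> aspan R T" "z \<in> aspan R T'" "x = y \<oplus> z" by auto
    have c: "a \<in> carrier R" "y \<in> carrier R" "z \<in> carrier R"
      using add yz assms aspan_closed by auto
    from add(1) show ?case
    proof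
      assume "a \<in> T"
      then have "a \<oplus> y \<in> aspan R T" using aspan_add aspan_base assms yz by auto
      moreover have "a \<oplus> x = (a \<oplus> y) \<oplus> z" using c yz by (simp add: a_assoc)
      ultimately show ?thesis using yz by blast
    next
      assume "a \<in> T'"
      then have "a \<oplus> z \<in> aspan R T'" using aspan_add aspan_base assms yz by auto
      moreover have "a \<oplus> x = y \<oplus> (a \<oplus> z)" using c yz by (simp add: a_ac)
      ultimately show ?thesis using yz by blast
    qed
  qed
qed

end

section \<open>Quotients of Leavitt path algebras\<close>

text \<open>Here \<open>q k A\<close> stands for the scalar multiple \<open>k p\<^sub>A\<close>, so that scalars need no separate action, and \<open>t e\<close> for the
  ghost edge. All assumptions are invariant under passing to the opposite rng and exchanging \<open>s\<close> and \<open>t\<close>. The last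
  three are what has to be known about the size of \<open>Q\<close>.\<close>

locale leavitt_quotient = ultragraph G + rng Q
  for G :: "('v, 'e) ultragraph" and Q :: "'q ring" (structure) +
  fixes H :: "'v set set" and S :: "'v set"
    and q :: "'k::field \<Rightarrow> 'v set \<Rightarrow> 'q" and s t :: "'e \<Rightarrow> 'q"
  assumes admissible: "admissible_pair G H S"
    and q_closed [simp]: "A \<in> gen_vertices G \<Longrightarrow> q k A \<in> carrier Q"
    and s_closed [simp]: "e \<in> edges G \<Longrightarrow> s e \<in> carrier Q"
    and t_closed [simp]: "e \<in> edges G \<Longrightarrow> t e \<in> carrier Q"
    and q_add: "A \<in> gen_vertices G \<Longrightarrow> q k A \<oplus> q l A = q (k + l) A"
    and q_mult: "A \<in> gen_vertices G \<Longrightarrow> B \<in> gen_vertices G \<Longrightarrow> q k A \<otimes> q l B = q (k * l) (A \<inter> B)"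
    and q_union: "A \<in> gen_vertices G \<Longrightarrow> B \<in> gen_vertices G \<Longrightarrow>
      q k (A \<union> B) \<oplus> q k (A \<inter> B) = q k A \<oplus> q k B"
    and q_one_null: "A \<in> H \<Longrightarrow> q 1 A = \<zero>"
    and q_source_s: "e \<in> edges G \<Longrightarrow> q k {source G e} \<otimes> s e = s e \<otimes> q k (erange G e)"
    and s_range: "e \<in> edges G \<Longrightarrow> s e \<otimes> q 1 (erange G e) = s e"
    and t_q_source: "e \<in> edges G \<Longrightarrow> t e \<otimes> q k {source G e} = q k (erange G e) \<otimes> t e"
    and range_t: "e \<in> edges G \<Longrightarrow> q 1 (erange G e) \<otimes> t e = t e"
    and t_s: "e \<in> edges G \<Longrightarrow> f \<in> edges G \<Longrightarrow> t e \<otimes> s f = (if e = f then q 1 (erange G e) else \<zero>)"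
    and ck: "v \<in> vertices G \<Longrightarrow> out_edges G v \<noteq> {} \<Longrightarrow> finite (out_edges G v) \<Longrightarrow>
      q 1 {v} = (\<Oplus>e\<in>out_edges G v. s e \<otimes> t e)"
    and ck_S: "w \<in> S \<Longrightarrow> q 1 {w} = (\<Oplus>e\<in>{e \<in> out_edges G w. erange G e \<notin> H}. s e \<otimes> t e)"
    and generated: "x \<in> carrier Q \<Longrightarrow> (\<And>k A. A \<in> gen_vertices G \<Longrightarrow> P (q k A)) \<Longrightarrow>
      (\<And>e. e \<in> edges G \<Longrightarrow> P (s e)) \<Longrightarrow> (\<And>e. e \<in> edges G \<Longrightarrow> P (t e)) \<Longrightarrow>
      (\<And>x y. x \<in> carrier Q \<Longrightarrow> y \<in> carrier Q \<Longrightarrow> P x \<Longrightarrow> P y \<Longrightarrow> P (x \<oplus> y)) \<Longrightarrow>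
      (\<And>x y. x \<in> carrier Q \<Longrightarrow> y \<in> carrier Q \<Longrightarrow> P x \<Longrightarrow> P y \<Longrightarrow> P (x \<otimes> y)) \<Longrightarrow> P x"
    and trace: "D \<in> gen_vertices G - H \<Longrightarrow> \<exists>\<tau> :: 'q \<Rightarrow> 'k.
      (\<forall>x\<in>carrier Q. \<forall>y\<in>carrier Q. \<tau> (x \<oplus> y) = \<tau> x + \<tau> y) \<and> (\<forall>k. \<tau> (q k D) = k) \<and>
      (\<forall>\<alpha> k A. \<alpha> \<noteq> [] \<longrightarrow> set \<alpha> \<subseteq> edges G \<longrightarrow> A \<in> gen_vertices G \<longrightarrow>
        \<tau> (lpath Q s \<alpha> (q k A)) = 0 \<and> \<tau> (rpath Q t \<alpha> (q k A)) = 0)"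
    and breaking_nonzero: "w \<in> breaking_vertices G H - S \<Longrightarrow>
      q 1 {w} \<ominus> (\<Oplus>e\<in>{e \<in> out_edges G w. erange G e \<notin> H}. s e \<otimes> t e) \<noteq> \<zero>"
    and cycle_not_invertible: "n > 0 \<Longrightarrow> (\<And>i. h i \<in> edges G) \<Longrightarrow>
      (\<And>i. q 1 {source G (h i)} = s (h i) \<otimes> t (h i)) \<Longrightarrow>
      (\<And>i. q 1 (erange G (h i)) = q 1 {source G (h (Suc i))}) \<Longrightarrow>
      source G (h n) = source G (h 0) \<Longrightarrow> {source G (h 0)} \<notin> H \<Longrightarrow>
      c = lpath Q s (map h [0..<n]) (q 1 {source G (h 0)}) \<or>
      c = rpath Q t (map h [0..<n]) (q 1 {source G (h 0)}) \<Longrightarrow> y \<in> carrier Q \<Longrightarrow>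
      y \<otimes> (q 1 {source G (h 0)} \<ominus> c) = q 1 {source G (h 0)} \<Longrightarrow>
      (q 1 {source G (h 0)} \<ominus> c) \<otimes> y = q 1 {source G (h 0)} \<Longrightarrow> False"
begin

text \<open>Reversing products interchanges \<open>lpath\<close> and \<open>rpath\<close>. For this
  reason \<open>trace\<close> speaks of both kinds of paths, and \<open>cycle_not_invertible\<close>
  allows \<open>c\<close> to be of either kind and asks for both one-sided equations.\<close>

lemma op: "leavitt_quotient G (rng_op Q) H S q t s"
proof (intro leavitt_quotient.intro leavitt_quotient_axioms.intro ultragraph_axioms
    rng_rng_op rng_axioms admissible, goal_cases)
  case (15 x P)
  then show ?case using generated[of x P] by simp
next
  case (16 D)
  then show ?case using trace[of D] by (simp only: rng_op_simps path_rng_op) metis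
next
  case (18 n h c y)
  then show ?case
    using cycle_not_invertible[of n h c y] by (simp only: rng_op_simps path_rng_op) metis
qed (use q_source_s s_range t_q_source range_t ck ck_S breaking_nonzero in
  \<open>auto simp: q_add q_mult q_union q_one_null t_s mult.commute Int_commute\<close>)

text \<open>The edges at \<open>v\<close> that survive in \<open>Q\<close>: if the range of
  \<open>e\<close> lies in \<open>H\<close>, then \<open>s e\<close> and \<open>t e\<close>
  vanish.\<close>

definition inner_edges :: "'v \<Rightarrow> 'e set" where
  "inner_edges v = {e \<in> out_edges G v. erange G e \<notin> H}"

text \<open>The image of \<open>p_w^H\<close> in \<open>Q\<close>.\<close>

definition breaking :: "'v \<Rightarrow> 'q" where
  "breaking w = q 1 {w} \<ominus> (\<Oplus>e\<in>inner_edges w. s e \<otimes> t e)"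

abbreviation sl where "sl \<equiv> lpath Q s"
abbreviation tr where "tr \<equiv> rpath Q t"
abbreviation tl where "tl \<equiv> lghost Q t"

section \<open>Calculus of projections, paths and ghost paths\<close>

lemma hered: "hereditary G H" and S_breaking: "S \<subseteq> breaking_vertices G H"
  using admissible by (auto simp: admissible_pair_def)

lemma H_gen: "H \<subseteq> gen_vertices G" and H_empty [simp]: "{} \<in> H"
  and H_source: "e \<in> edges G \<Longrightarrow> {source G e} \<in> H \<Longrightarrow> erange G e \<in> H"
  and H_union: "A \<in> H \<Longrightarrow> B \<in> H \<Longrightarrow> A \<union> B \<in> H"
  and H_subset: "A \<in> H \<Longrightarrow> B \<in> gen_vertices G \<Longrightarrow> B \<subseteq> A \<Longrightarrow> B \<in> H"
  using hered by (auto simp: hereditary_def)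

lemmas gens [simp, intro] = gen_vertices.intros

lemma source_gen [simp]: "e \<in> edges G \<Longrightarrow> {source G e} \<in> gen_vertices G"
  using source_closed by auto

lemma gen_finite: "finite V \<Longrightarrow> V \<subseteq> vertices G \<Longrightarrow> V \<in> gen_vertices G"
proof (induction V rule: finite_induct)
  case (insert v V)
  then have "{v} \<union> V \<in> gen_vertices G" by (intro gen_vertices.union) auto
  then show ?case by simp
qed simp

lemma q_null: "A \<in> H \<Longrightarrow> q k A = \<zero>"
  using q_mult[of A A k 1] q_one_null[of A] H_gen by auto

lemma q_empty [simp]: "q k {} = \<zero>"
  by (rule q_null) simp

lemma q_zero [simp]: "A \<in> gen_vertices G \<Longrightarrow> q 0 A = \<zero>"
  using q_add[of A 0 0] by (metis add_0 add.r_cancel_one' q_closed)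

lemma q_disjoint: "A \<in> gen_vertices G \<Longrightarrow> B \<in> gen_vertices G \<Longrightarrow> A \<inter> B = {} \<Longrightarrow>
    q k (A \<union> B) = q k A \<oplus> q k B"
  using q_union[of A B k] by simp

lemma q_split: "A \<in> gen_vertices G \<Longrightarrow> B \<in> gen_vertices G \<Longrightarrow> q k A = q k (A \<inter> B) \<oplus> q k (A - B)"
proof -
  assume AB: "A \<in> gen_vertices G" "B \<in> gen_vertices G"
  have "A \<inter> B \<union> (A - B) = A" "A \<inter> B \<inter> (A - B) = {}" by auto
  then show ?thesis using AB q_disjoint[of "A \<inter> B" "A - B" k] by simp
qed

lemma s_source: "e \<in> edges G \<Longrightarrow> q 1 {source G e} \<otimes> s e = s e"
  using q_source_s[of e 1] s_range[of e] by simp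

lemma t_source: "e \<in> edges G \<Longrightarrow> t e \<otimes> q 1 {source G e} = t e"
  using t_q_source[of e 1] range_t[of e] by simp

lemma q_s: 
  assumes "A \<in> gen_vertices G" "e \<in> edges G"
  shows "q k A \<otimes> s e = (if source G e \<in> A then s e \<otimes> q k (erange G e) else \<zero>)"
proof -
  have "q k A \<otimes> s e = q k A \<otimes> (q 1 {source G e} \<otimes> s e)" using assms by (simp add: s_source)
  also have "\<dots> = q k (A \<inter> {source G e}) \<otimes> s e" using assms by (simp add: q_mult flip: m_assoc)
  also have "A \<inter> {source G e} = (if source G e \<in> A then {source G e} else {})" by auto
  finally show ?thesis using assms by (simp add: q_source_s)
qed

lemma t_q: 
  assumes "A \<in> gen_vertices G" "e \<in> edges G"
  shows "t e \<otimes> q k A = (if source G e \<in> A then q k (erange G e) \<otimes> t e else \<zero>)"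
proof -
  have "t e \<otimes> q k A = (t e \<otimes> q 1 {source G e}) \<otimes> q k A" using assms by (simp add: t_source)
  also have "\<dots> = t e \<otimes> q k ({source G e} \<inter> A)" using assms by (simp add: q_mult m_assoc)
  also have "{source G e} \<inter> A = (if source G e \<in> A then {source G e} else {})" by auto
  finally show ?thesis using assms by (simp add: t_q_source)
qed

lemma s_null: "e \<in> edges G \<Longrightarrow> erange G e \<in> H \<Longrightarrow> s e = \<zero>"
  using s_range[of e] by (simp add: q_null)

lemma t_null: "e \<in> edges G \<Longrightarrow> erange G e \<in> H \<Longrightarrow> t e = \<zero>"
  using range_t[of e] by (simp add: q_null)

lemma lpath_closed [simp]: "set \<alpha> \<subseteq> edges G \<Longrightarrow> x \<in> carrier Q \<Longrightarrow> sl \<alpha> x \<in> carrier Q"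
  by (induction \<alpha>) (simp_all add: m_closed)

lemma rpath_closed [simp]: "set \<alpha> \<subseteq> edges G \<Longrightarrow> x \<in> carrier Q \<Longrightarrow> tr \<alpha> x \<in> carrier Q"
  by (induction \<alpha>) (simp_all add: m_closed)

lemma lghost_closed [simp]: "set \<alpha> \<subseteq> edges G \<Longrightarrow> x \<in> carrier Q \<Longrightarrow> tl \<alpha> x \<in> carrier Q"
  by (induction \<alpha> arbitrary: x) (simp_all add: m_closed)

lemma lpath_zero [simp]: "set \<alpha> \<subseteq> edges G \<Longrightarrow> sl \<alpha> \<zero> = \<zero>"
  by (induction \<alpha>) simp_all

lemma rpath_zero [simp]: "set \<alpha> \<subseteq> edges G \<Longrightarrow> tr \<alpha> \<zero> = \<zero>"
  by (induction \<alpha>) simp_all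

lemma lghost_zero [simp]: "set \<alpha> \<subseteq> edges G \<Longrightarrow> tl \<alpha> \<zero> = \<zero>"
  by (induction \<alpha>) simp_all

lemma lpath_add: "set \<alpha> \<subseteq> edges G \<Longrightarrow> x \<in> carrier Q \<Longrightarrow> y \<in> carrier Q \<Longrightarrow> sl \<alpha> (x \<oplus> y) = sl \<alpha> x \<oplus> sl \<alpha> y"
  by (induction \<alpha>) (simp_all add: r_distr)

lemma lghost_add: "set \<alpha> \<subseteq> edges G \<Longrightarrow> x \<in> carrier Q \<Longrightarrow> y \<in> carrier Q \<Longrightarrow> tl \<alpha> (x \<oplus> y) = tl \<alpha> x \<oplus> tl \<alpha> y"
  by (induction \<alpha> arbitrary: x y) (simp_all add: r_distr m_closed)

lemma lpath_append: "sl (\<alpha> @ \<beta>) x = sl \<alpha> (sl \<beta> x)"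
  by (induction \<alpha>) simp_all

lemma rpath_append: "tr (\<alpha> @ \<beta>) x = tr \<alpha> (tr \<beta> x)"
  by (induction \<alpha>) simp_all

lemma lpath_mult: "set \<alpha> \<subseteq> edges G \<Longrightarrow> x \<in> carrier Q \<Longrightarrow> y \<in> carrier Q \<Longrightarrow> sl \<alpha> x \<otimes> y = sl \<alpha> (x \<otimes> y)"
  by (induction \<alpha>) (simp_all add: m_assoc)

lemma rpath_mult: "set \<alpha> \<subseteq> edges G \<Longrightarrow> x \<in> carrier Q \<Longrightarrow> y \<in> carrier Q \<Longrightarrow> x \<otimes> tr \<alpha> y = tr \<alpha> (x \<otimes> y)"
  by (induction \<alpha>) (simp_all flip: m_assoc)

lemma lghost_mult: "set \<alpha> \<subseteq> edges G \<Longrightarrow> x \<in> carrier Q \<Longrightarrow> y \<in> carrier Q \<Longrightarrow> tl \<alpha> x \<otimes> y = tl \<alpha> (x \<otimes> y)"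
  by (induction \<alpha> arbitrary: x) (simp_all add: m_assoc m_closed)

lemma rpath_adjoint: "set \<alpha> \<subseteq> edges G \<Longrightarrow> x \<in> carrier Q \<Longrightarrow> y \<in> carrier Q \<Longrightarrow> tr \<alpha> x \<otimes> y = x \<otimes> tl \<alpha> y"
proof (induction \<alpha> arbitrary: y)
  case (Cons e \<alpha>)
  from Cons.prems have "tr (e # \<alpha>) x \<otimes> y = tr \<alpha> x \<otimes> (t e \<otimes> y)" by (simp only: rpath.simps m_assoc rpath_closed t_closed list.set insert_subset)
  then show ?case using Cons.IH[of "t e \<otimes> y"] Cons.prems by (simp add: m_closed)
qed simp

lemma lpath_rpath: "set \<alpha> \<subseteq> edges G \<Longrightarrow> set \<beta> \<subseteq> edges G \<Longrightarrow> x \<in> carrier Q \<Longrightarrow> tr \<beta> (sl \<alpha> x) = sl \<alpha> (tr \<beta> x)"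
  by (induction \<beta>) (simp_all add: lpath_mult)

lemma q_lpath:
  assumes "A \<in> gen_vertices G" "set \<alpha> \<subseteq> edges G" "x \<in> carrier Q"
  shows "q k A \<otimes> sl \<alpha> x = sl \<alpha> (q k (reach G A \<alpha>) \<otimes> x)"
  using assms
proof (induction \<alpha> arbitrary: A)
  case (Cons e \<alpha>)
  have "q k A \<otimes> sl (e # \<alpha>) x = (q k A \<otimes> s e) \<otimes> sl \<alpha> x" using Cons.prems by (simp add: m_assoc)
  also have "\<dots> = sl (e # \<alpha>) (q k (reach G A (e # \<alpha>)) \<otimes> x)"
    using Cons by (simp add: q_s m_assoc)
  finally show ?case .
qed simp

text \<open>The first edge absorbs its range projection, and \<open>q_lpath\<close> pushes that to
  the end of the path. \<open>reach G UNIV \<alpha>\<close> serves as the range of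
  \<open>\<alpha>\<close>; for the empty list it is \<open>UNIV\<close>, which need not lie in
  \<open>gen_vertices G\<close>, hence the case distinctions on \<open>\<alpha>\<close>.\<close>

lemma lpath_range:
  assumes "C \<in> gen_vertices G" "set \<alpha> \<subseteq> edges G" "x \<in> carrier Q"
  shows "sl \<alpha> (q k C \<otimes> x) = sl \<alpha> (q k (C \<inter> reach G UNIV \<alpha>) \<otimes> x)"
proof (cases \<alpha>)
  case (Cons e \<beta>)
  have e: "e \<in> edges G" "set \<beta> \<subseteq> edges G" using assms Cons by auto
  have *: "sl \<alpha> y = sl \<alpha> (q 1 (reach G (erange G e) \<beta>) \<otimes> y)" if "y \<in> carrier Q" for y
  proof -
    have "sl \<alpha> y = (s e \<otimes> q 1 (erange G e)) \<otimes> sl \<beta> y" using that e s_range[OF e(1)] Cons by simp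
    also have "\<dots> = s e \<otimes> (q 1 (erange G e) \<otimes> sl \<beta> y)" using that e by (simp add: m_assoc)
    finally show ?thesis using that e Cons by (simp add: q_lpath)
  qed
  have "q 1 (reach G (erange G e) \<beta>) \<otimes> (q k C \<otimes> x) = q k (C \<inter> reach G (erange G e) \<beta>) \<otimes> x"
    using assms e by (simp add: q_mult reach_gen Int_commute flip: m_assoc)
  then show ?thesis using *[of "q k C \<otimes> x"] assms Cons by (simp add: m_closed)
qed simp

text \<open>The relation \<open>s_\<alpha>^* s_\<alpha> = p_{r(\<alpha>)}\<close>, obtained one edge
  at a time.\<close>

lemma lghost_lpath:
  assumes "C \<in> gen_vertices G" "set \<alpha> \<subseteq> edges G" "x \<in> carrier Q"
  shows "tl \<alpha> (sl \<alpha> (q k C \<otimes> x)) = q k (C \<inter> reach G UNIV \<alpha>) \<otimes> x"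
  using assms
proof (induction \<alpha> arbitrary: C)
  case (Cons e \<alpha>)
  have C': "C \<inter> reach G (erange G e) \<alpha> \<in> gen_vertices G" using Cons.prems by (simp add: reach_gen)
  have "t e \<otimes> sl (e # \<alpha>) (q k C \<otimes> x) = (t e \<otimes> s e) \<otimes> sl \<alpha> (q k C \<otimes> x)"
    using Cons.prems by (simp add: m_assoc m_closed)
  also have "\<dots> = sl \<alpha> (q 1 (reach G (erange G e) \<alpha>) \<otimes> (q k C \<otimes> x))"
    using Cons.prems by (simp add: t_s q_lpath m_closed)
  also have "q 1 (reach G (erange G e) \<alpha>) \<otimes> (q k C \<otimes> x) = q k (C \<inter> reach G (erange G e) \<alpha>) \<otimes> x"
    using Cons.prems by (simp add: q_mult reach_gen Int_commute flip: m_assoc)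
  finally have "tl (e # \<alpha>) (sl (e # \<alpha>) (q k C \<otimes> x)) = tl \<alpha> (sl \<alpha> (q k (C \<inter> reach G (erange G e) \<alpha>) \<otimes> x))"
    by simp
  also have "\<dots> = q k (C \<inter> reach G (erange G e) \<alpha> \<inter> reach G UNIV \<alpha>) \<otimes> x"
    using Cons.IH[OF C'] Cons.prems by simp
  also have "C \<inter> reach G (erange G e) \<alpha> \<inter> reach G UNIV \<alpha> = C \<inter> reach G UNIV (e # \<alpha>)"
    using reach_mono[of "erange G e" UNIV G \<alpha>] by auto
  finally show ?case .
qed simp

lemma lghost_lpath_prefix:
  assumes "C \<in> gen_vertices G" "set (\<alpha> @ \<beta>) \<subseteq> edges G" "x \<in> carrier Q"
  shows "tl \<alpha> (sl (\<alpha> @ \<beta>) (q k C \<otimes> x)) = sl \<beta> (q k (C \<inter> reach G UNIV (\<alpha> @ \<beta>)) \<otimes> x)"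
proof (cases "\<alpha> = []")
  case True
  then show ?thesis using assms lpath_range by simp
next
  case False
  then obtain e \<gamma> where \<alpha>: "\<alpha> = e # \<gamma>" by (cases \<alpha>) auto
  have R: "reach G UNIV \<alpha> \<in> gen_vertices G" using assms \<alpha> by (simp add: reach_gen)
  have R': "reach G (reach G UNIV \<alpha>) \<beta> \<in> gen_vertices G" using assms R by (simp add: reach_gen)
  define y where "y = q k C \<otimes> x"
  have y: "y \<in> carrier Q" using assms by (simp add: y_def m_closed)
  have "sl \<alpha> (sl \<beta> y) = (s e \<otimes> q 1 (erange G e)) \<otimes> sl \<gamma> (sl \<beta> y)"
    using assms \<alpha> y s_range[of e] by simp
  also have "\<dots> = sl \<alpha> (q 1 (reach G UNIV \<alpha>) \<otimes> sl \<beta> y)"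
    using assms \<alpha> y by (simp add: m_assoc q_lpath)
  finally have "tl \<alpha> (sl (\<alpha> @ \<beta>) y) = q 1 (reach G UNIV \<alpha>) \<otimes> sl \<beta> y"
    using assms y R lghost_lpath[of "reach G UNIV \<alpha>" \<alpha> "sl \<beta> y" 1] by (simp add: lpath_append)
  also have "\<dots> = sl \<beta> (q 1 (reach G UNIV (\<alpha> @ \<beta>)) \<otimes> y)"
    using R y assms by (simp add: q_lpath reach_append)
  also have "q 1 (reach G UNIV (\<alpha> @ \<beta>)) \<otimes> y = q k (C \<inter> reach G UNIV (\<alpha> @ \<beta>)) \<otimes> x"
    using assms R R' by (simp add: y_def q_mult Int_commute reach_append flip: m_assoc)
  finally show ?thesis by (simp add: y_def)
qed

text \<open>At the first edge where \<open>\<beta>\<close> departs from \<open>\<alpha>\<close> a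
  product \<open>t e \<otimes> s f\<close> with \<open>e \<noteq> f\<close> appears.\<close>

lemma lghost_lpath_mismatch:
  assumes "set \<alpha> \<subseteq> edges G" "set \<beta> \<subseteq> edges G" "x \<in> carrier Q"
    and "length \<alpha> \<le> length \<beta>" "take (length \<alpha>) \<beta> \<noteq> \<alpha>"
  shows "tl \<alpha> (sl \<beta> x) = \<zero>"
  using assms
proof (induction \<alpha> arbitrary: \<beta> x)
  case (Cons e \<alpha>)
  then obtain f \<gamma> where \<beta>: "\<beta> = f # \<gamma>" by (cases \<beta>) auto
  have "t e \<otimes> sl \<beta> x = (t e \<otimes> s f) \<otimes> sl \<gamma> x" using Cons.prems \<beta> by (simp add: m_assoc)
  then have *: "t e \<otimes> sl \<beta> x = (if e = f then sl \<gamma> (q 1 (reach G (erange G e) \<gamma>) \<otimes> x) else \<zero>)"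
    using Cons.prems \<beta> by (simp add: t_s q_lpath)
  show ?case
    using Cons.IH[of \<gamma> "q 1 (reach G (erange G e) \<gamma>) \<otimes> x"] Cons.prems \<beta> *
    by (auto simp: m_closed reach_gen simp del: lpath.simps)
qed simp

text \<open>Terms \<open>k s_\<alpha> p_A\<close> without ghosts: \<open>trm {0}\<close> spans the
  degree zero part of the ghost-free elements and \<open>trm {1..}\<close> their positive
  part.\<close>

definition trm :: "nat set \<Rightarrow> 'q set" where
  "trm I = {sl \<alpha> (q k A) | \<alpha> k A. set \<alpha> \<subseteq> edges G \<and> length \<alpha> \<in> I \<and> A \<in> gen_vertices G}"

text \<open>Monomials \<open>k s_\<alpha> p_A s_\<beta>^*\<close>. Only the length of the ghost part
  \<open>\<beta>\<close> is recorded, because the reduction is an induction on it.\<close>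

definition mon :: "nat set \<Rightarrow> 'q set" where
  "mon I = {tr \<beta> (sl \<alpha> (q k A)) | \<alpha> \<beta> k A.
     set \<alpha> \<subseteq> edges G \<and> set \<beta> \<subseteq> edges G \<and> length \<beta> \<in> I \<and> A \<in> gen_vertices G}"

lemma trmI: "set \<alpha> \<subseteq> edges G \<Longrightarrow> length \<alpha> \<in> I \<Longrightarrow> A \<in> gen_vertices G \<Longrightarrow> sl \<alpha> (q k A) \<in> trm I"
  by (auto simp: trm_def)

lemma monI: "set \<alpha> \<subseteq> edges G \<Longrightarrow> set \<beta> \<subseteq> edges G \<Longrightarrow> length \<beta> \<in> I \<Longrightarrow> A \<in> gen_vertices G \<Longrightarrow>
    tr \<beta> (sl \<alpha> (q k A)) \<in> mon I"
  by (auto simp: mon_def)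

lemma trm_closed: "trm I \<subseteq> carrier Q" and mon_closed: "mon I \<subseteq> carrier Q"
  by (auto simp: trm_def mon_def)

lemma mon_zero: "0 \<in> I \<Longrightarrow> \<zero> \<in> mon I"
  using monI[of "[]" "[]" I "{}" 0] by simp

lemma trm_Un: "trm (I \<union> J) = trm I \<union> trm J" and mon_Un: "mon (I \<union> J) = mon I \<union> mon J"
  by (auto simp: trm_def mon_def)

text \<open>Left multiplication by a generator maps a monomial to a monomial, possibly a zero one,
  so the span of the monomials absorbs the generators from the left.\<close>

lemma carrier_span:
  assumes "x \<in> carrier Q"
  shows "x \<in> aspan Q (mon UNIV)"
proof -
  let ?M = "aspan Q (mon UNIV)"
  have MM: "F x \<in> ?M" if "x \<in> ?M" "F \<zero> = \<zero>"
      "\<And>a x. a \<in> carrier Q \<Longrightarrow> x \<in> carrier Q \<Longrightarrow> F (a \<oplus> x) = F a \<oplus> F x" 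
      "\<And>a. a \<in> mon UNIV \<Longrightarrow> F a \<in> mon UNIV" for F x
    using aspan_map[OF that(1) mon_closed mon_closed that(2,3)] that(4) aspan_base[OF mon_closed] by blast
  have q_M: "q k A \<otimes> x \<in> ?M" if "x \<in> ?M" "A \<in> gen_vertices G" for k A x
  proof (rule MM[OF that(1)])
    fix a assume "a \<in> mon UNIV"
    then obtain \<alpha> \<beta> l B where a: "a = tr \<beta> (sl \<alpha> (q l B))" "set \<alpha> \<subseteq> edges G" "set \<beta> \<subseteq> edges G" "B \<in> gen_vertices G"
      by (auto simp: mon_def)
    have "q k A \<otimes> a = tr \<beta> (sl \<alpha> (q (k * l) (reach G A \<alpha> \<inter> B)))"
      using a that(2) by (simp add: rpath_mult q_lpath q_mult reach_gen)
    then show "q k A \<otimes> a \<in> mon UNIV" using a that(2) by (auto intro!: monI reach_gen)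
  qed (use that in \<open>auto simp: r_distr\<close>)
  have s_M: "s e \<otimes> x \<in> ?M" if "x \<in> ?M" "e \<in> edges G" for e x
  proof (rule MM[OF that(1)])
    fix a assume "a \<in> mon UNIV"
    then obtain \<alpha> \<beta> l B where a: "a = tr \<beta> (sl \<alpha> (q l B))" "set \<alpha> \<subseteq> edges G" "set \<beta> \<subseteq> edges G" "B \<in> gen_vertices G"
      by (auto simp: mon_def)
    then have "s e \<otimes> a = tr \<beta> (sl (e # \<alpha>) (q l B))" using that(2) by (simp add: rpath_mult)
    then show "s e \<otimes> a \<in> mon UNIV" using a that(2) monI[of "e # \<alpha>" \<beta> UNIV B l] by simp
  qed (use that in \<open>auto simp: r_distr\<close>)
  have t_M: "t e \<otimes> x \<in> ?M" if "x \<in> ?M" "e \<in> edges G" for e x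
  proof (rule MM[OF that(1)])
    fix a assume "a \<in> mon UNIV"
    then obtain \<alpha> \<beta> l B where a: "a = tr \<beta> (sl \<alpha> (q l B))" "set \<alpha> \<subseteq> edges G" "set \<beta> \<subseteq> edges G" "B \<in> gen_vertices G"
      by (auto simp: mon_def)
    show "t e \<otimes> a \<in> mon UNIV"
    proof (cases \<alpha>)
      case Nil
      have "t e \<otimes> a = tr \<beta> (if source G e \<in> B then tr [e] (sl [] (q l (erange G e))) else sl [] (q l {}))"
        using a that(2) Nil by (simp add: rpath_mult t_q)
      then show ?thesis
        using a that(2) monI[of "[]" "\<beta> @ [e]" UNIV "erange G e" l] monI[of "[]" \<beta> UNIV "{}" l]
        by (auto simp: rpath_append split: if_splits)
    next
      case (Cons f \<gamma>)
      have "t e \<otimes> a = tr \<beta> ((t e \<otimes> s f) \<otimes> sl \<gamma> (q l B))"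
        using a that(2) Cons by (simp add: rpath_mult m_assoc m_closed)
      also have "\<dots> = tr \<beta> (sl \<gamma> (q l (if e = f then reach G (erange G e) \<gamma> \<inter> B else {})))"
        using a that(2) Cons by (simp add: t_s q_lpath q_mult reach_gen)
      finally show ?thesis
        using a that(2) Cons by (auto intro!: monI reach_gen mon_zero)
    qed
  qed (use that in \<open>auto simp: r_distr\<close>)
  \<comment> \<open>The second conjunct carries the induction through products: left multiplication
    by \<open>x\<close> preserves the span.\<close>
  have "x \<in> ?M \<and> (\<forall>y\<in>?M. x \<otimes> y \<in> ?M)"
    using assms
  proof (rule generated)
    fix k A assume "A \<in> gen_vertices G"
    then show "q k A \<in> ?M \<and> (\<forall>y\<in>?M. q k A \<otimes> y \<in> ?M)"
      using q_M aspan_base[OF mon_closed monI[of "[]" "[]" UNIV A k]] by simp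
  next
    fix e assume e: "e \<in> edges G"
    then show "s e \<in> ?M \<and> (\<forall>y\<in>?M. s e \<otimes> y \<in> ?M)"
      using s_M aspan_base[OF mon_closed monI[of "[e]" "[]" UNIV "erange G e" 1]] by (simp add: s_range)
    show "t e \<in> ?M \<and> (\<forall>y\<in>?M. t e \<otimes> y \<in> ?M)"
      using e t_M aspan_base[OF mon_closed monI[of "[]" "[e]" UNIV "erange G e" 1]] by (simp add: range_t)
  next
    fix x y assume "x \<in> carrier Q" "y \<in> carrier Q"
      "x \<in> ?M \<and> (\<forall>y\<in>?M. x \<otimes> y \<in> ?M)" "y \<in> ?M \<and> (\<forall>z\<in>?M. y \<otimes> z \<in> ?M)"
    then show "x \<oplus> y \<in> ?M \<and> (\<forall>z\<in>?M. (x \<oplus> y) \<otimes> z \<in> ?M)" "x \<otimes> y \<in> ?M \<and> (\<forall>z\<in>?M. (x \<otimes> y) \<otimes> z \<in> ?M)"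
      using aspan_closed[OF mon_closed]
      by (auto simp: l_distr m_assoc intro!: aspan_add[OF mon_closed])
  qed
  then show ?thesis ..
qed

lemma trm_Suc_iff: "a \<in> trm {1..} \<longleftrightarrow>
    (\<exists>e \<alpha> k A. a = s e \<otimes> sl \<alpha> (q k A) \<and> e \<in> edges G \<and> set \<alpha> \<subseteq> edges G \<and> A \<in> gen_vertices G)"
proof
  assume "a \<in> trm {1..}"
  then obtain \<alpha> k A where *: "a = sl \<alpha> (q k A)" "set \<alpha> \<subseteq> edges G" "1 \<le> length \<alpha>" "A \<in> gen_vertices G"
    by (auto simp: trm_def)
  then obtain e \<beta> where "\<alpha> = e # \<beta>" by (cases \<alpha>) auto
  then show "\<exists>e \<alpha> k A. a = s e \<otimes> sl \<alpha> (q k A) \<and> e \<in> edges G \<and> set \<alpha> \<subseteq> edges G \<and> A \<in> gen_vertices G"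
    using * by auto
next
  assume "\<exists>e \<alpha> k A. a = s e \<otimes> sl \<alpha> (q k A) \<and> e \<in> edges G \<and> set \<alpha> \<subseteq> edges G \<and> A \<in> gen_vertices G"
  then obtain e \<alpha> k A where "a = sl (e # \<alpha>) (q k A)" "e \<in> edges G" "set \<alpha> \<subseteq> edges G" "A \<in> gen_vertices G"
    by auto
  then show "a \<in> trm {1..}" using trmI[of "e # \<alpha>" "{1..}" A k] by simp
qed

lemma trm_zero_iff: "a \<in> trm {0} \<longleftrightarrow> (\<exists>k A. a = q k A \<and> A \<in> gen_vertices G)"
  by (auto simp: trm_def)

text \<open>The functional from \<open>trace\<close> reads off \<open>k\<close> and vanishes on
  every term of positive degree.\<close>

lemma head_nonzero:
  assumes "D \<in> gen_vertices G - H" "k \<noteq> 0" "y \<in> aspan Q (trm {1..})"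
  shows "q k D \<oplus> y \<noteq> \<zero>"
proof
  assume zero: "q k D \<oplus> y = \<zero>"
  obtain \<tau> :: "'q \<Rightarrow> 'k" where \<tau>_add: "\<And>x y. x \<in> carrier Q \<Longrightarrow> y \<in> carrier Q \<Longrightarrow> \<tau> (x \<oplus> y) = \<tau> x + \<tau> y"
    and D: "\<And>k. \<tau> (q k D) = k"
    and pos: "\<And>\<alpha> k A. \<alpha> \<noteq> [] \<Longrightarrow> set \<alpha> \<subseteq> edges G \<Longrightarrow> A \<in> gen_vertices G \<Longrightarrow> \<tau> (sl \<alpha> (q k A)) = 0"
    using trace[OF assms(1)] by blast
  have \<tau>0: "\<tau> \<zero> = 0" using \<tau>_add[of \<zero> \<zero>] by (metis add_cancel_right_right l_zero zero_closed)
  have "\<tau> y = 0"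
    using assms(3) trm_closed
  proof (induction rule: aspan_induct)
    case (add a x)
    then obtain e \<alpha> k A where "a = sl (e # \<alpha>) (q k A)" "e \<in> edges G" "set \<alpha> \<subseteq> edges G" "A \<in> gen_vertices G"
      unfolding trm_Suc_iff lpath.simps by blast
    then have "\<tau> a = 0" using pos[of "e # \<alpha>" A k] by simp
    moreover have "a \<in> carrier Q" using add(1) trm_closed by blast
    ultimately show ?case using add \<tau>_add by simp
  qed (rule \<tau>0)
  then have "\<tau> (q k D \<oplus> y) = k"
    using \<tau>_add[of "q k D" y] D assms aspan_closed[OF trm_closed assms(3)] by simp
  then show False using zero \<tau>0 assms(2) by simp
qed

lemma q_nonzero: "A \<in> gen_vertices G - H \<Longrightarrow> k \<noteq> 0 \<Longrightarrow> q k A \<noteq> \<zero>"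
  using head_nonzero[OF _ _ aspan_zero, of A k] by simp

text \<open>For finite \<open>F\<close> an idempotent that is a left unit for elements whose terms
  start with edges in \<open>F\<close>, and a right unit for those whose terms end with ghosts of
  such edges.\<close>

definition esum :: "'e set \<Rightarrow> 'q" where
  "esum F = (\<Oplus>e\<in>F. s e \<otimes> t e)"

lemma esum_closed [simp]: "F \<subseteq> edges G \<Longrightarrow> esum F \<in> carrier Q"
  unfolding esum_def by (intro finsum_closed) (auto intro!: m_closed)

lemma esum_mult:
  "finite F \<Longrightarrow> F \<subseteq> edges G \<Longrightarrow> x \<in> carrier Q \<Longrightarrow> esum F \<otimes> x = (\<Oplus>e\<in>F. s e \<otimes> (t e \<otimes> x))"
  unfolding esum_def
  by (subst finsum_l_distr) (auto intro!: add.finprod_cong' simp: m_closed m_assoc subset_iff)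

lemma mult_esum:
  "finite F \<Longrightarrow> F \<subseteq> edges G \<Longrightarrow> x \<in> carrier Q \<Longrightarrow> x \<otimes> esum F = (\<Oplus>e\<in>F. (x \<otimes> s e) \<otimes> t e)"
  unfolding esum_def
  by (subst finsum_r_distr) (auto intro!: add.finprod_cong' simp: m_closed m_assoc subset_iff)

lemma esum_mult_zero:
  "finite F \<Longrightarrow> F \<subseteq> edges G \<Longrightarrow> x \<in> carrier Q \<Longrightarrow> (\<And>e. e \<in> F \<Longrightarrow> t e \<otimes> x = \<zero>) \<Longrightarrow> esum F \<otimes> x = \<zero>"
  using esum_mult[of F x] finsum_zero[of F "\<lambda>e. s e \<otimes> (t e \<otimes> x)"] by (auto simp: subset_iff)

lemma mult_esum_zero:
  "finite F \<Longrightarrow> F \<subseteq> edges G \<Longrightarrow> x \<in> carrier Q \<Longrightarrow> (\<And>e. e \<in> F \<Longrightarrow> x \<otimes> s e = \<zero>) \<Longrightarrow> x \<otimes> esum F = \<zero>"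
  using mult_esum[of F x] finsum_zero[of F "\<lambda>e. (x \<otimes> s e) \<otimes> t e"] by (auto simp: subset_iff)

lemma esum_insert:
  "finite F \<Longrightarrow> insert e F \<subseteq> edges G \<Longrightarrow> e \<notin> F \<Longrightarrow> esum (insert e F) = s e \<otimes> t e \<oplus> esum F"
  unfolding esum_def by (subst finsum_insert) (auto simp: m_closed subset_iff)

lemma t_esum:
  assumes "finite F" "F \<subseteq> edges G" "e \<in> edges G"
  shows "t e \<otimes> esum F = (if e \<in> F then t e else \<zero>)"
  using assms
proof (induction F rule: finite_induct)
  case (insert f F)
  then have "t e \<otimes> esum (insert f F) = (t e \<otimes> s f) \<otimes> t f \<oplus> t e \<otimes> esum F"
    by (simp add: esum_insert r_distr m_closed m_assoc)
  then show ?case using insert by (auto simp: t_s range_t)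
qed (simp add: esum_def)

lemma esum_s:
  assumes "finite F" "F \<subseteq> edges G" "e \<in> edges G"
  shows "esum F \<otimes> s e = (if e \<in> F then s e else \<zero>)"
  using assms
proof (induction F rule: finite_induct)
  case (insert f F)
  then have "esum (insert f F) \<otimes> s e = s f \<otimes> (t f \<otimes> s e) \<oplus> esum F \<otimes> s e"
    by (simp add: esum_insert l_distr m_closed m_assoc)
  then show ?case using insert by (auto simp: t_s s_range)
qed (simp add: esum_def)

section \<open>The idempotents of breaking vertices\<close>

lemma inner_edges_edges: "inner_edges v \<subseteq> edges G"
  by (auto simp: inner_edges_def out_edges_def)

lemma breaking_finite: "w \<in> breaking_vertices G H \<Longrightarrow> finite (inner_edges w)"
  and breaking_vertex: "w \<in> breaking_vertices G H \<Longrightarrow> w \<in> vertices G"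
  by (auto simp: breaking_vertices_def inner_edges_def)

lemma breaking_eq: "breaking w = q 1 {w} \<ominus> esum (inner_edges w)"
  by (simp add: breaking_def esum_def)

lemma breaking_closed [simp]: "w \<in> breaking_vertices G H \<Longrightarrow> breaking w \<in> carrier Q"
  using inner_edges_edges breaking_vertex by (simp add: breaking_eq)

text \<open>Ghosts of edges leaving \<open>w\<close> towards a range outside \<open>H\<close> are
  cancelled by the subtracted sum; those of the infinitely many other edges at \<open>w\<close> are
  zero in \<open>Q\<close>.\<close>

lemma t_breaking [simp]:
  assumes w: "w \<in> breaking_vertices G H" and e: "e \<in> edges G"
  shows "t e \<otimes> breaking w = \<zero>"
proof -
  have "t e \<otimes> q 1 {w} = (if source G e = w then t e else \<zero>)"
    using e w breaking_vertex by (simp add: t_q range_t)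
  moreover have "e \<in> inner_edges w \<longleftrightarrow> source G e = w \<and> erange G e \<notin> H"
    using e by (auto simp: inner_edges_def out_edges_def)
  ultimately have "t e \<otimes> q 1 {w} = t e \<otimes> esum (inner_edges w)"
    using t_esum[OF breaking_finite[OF w] inner_edges_edges e] e t_null by auto
  then show ?thesis
    using e w breaking_vertex[OF w] inner_edges_edges by (simp add: breaking_eq r_diff m_closed diff_eq_zero_iff)
qed

lemma breaking_s [simp]:
  assumes w: "w \<in> breaking_vertices G H" and e: "e \<in> edges G"
  shows "breaking w \<otimes> s e = \<zero>"
proof -
  have "q 1 {w} \<otimes> s e = (if source G e = w then s e else \<zero>)"
    using e w breaking_vertex by (simp add: q_s s_range)
  moreover have "e \<in> inner_edges w \<longleftrightarrow> source G e = w \<and> erange G e \<notin> H"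
    using e by (auto simp: inner_edges_def out_edges_def)
  ultimately have "q 1 {w} \<otimes> s e = esum (inner_edges w) \<otimes> s e"
    using esum_s[OF breaking_finite[OF w] inner_edges_edges e] e s_null by auto
  then show ?thesis
    using e w breaking_vertex[OF w] inner_edges_edges by (simp add: breaking_eq l_diff m_closed diff_eq_zero_iff)
qed

lemma q_breaking [simp]:
  assumes w: "w \<in> breaking_vertices G H"
  shows "q 1 {w} \<otimes> breaking w = breaking w" "breaking w \<otimes> q 1 {w} = breaking w"
proof -
  note wv = breaking_vertex[OF w] and fin = breaking_finite[OF w] and ie = inner_edges_edges[of w]
  have src: "source G e = w \<and> e \<in> edges G" if "e \<in> inner_edges w" for e
    using that by (auto simp: inner_edges_def out_edges_def)
  have "q 1 {w} \<otimes> esum (inner_edges w) = (\<Oplus>e\<in>inner_edges w. (q 1 {w} \<otimes> s e) \<otimes> t e)"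
    using wv fin ie by (simp add: mult_esum)
  also have "\<dots> = esum (inner_edges w)"
    unfolding esum_def
  proof (intro add.finprod_cong')
    fix e assume "e \<in> inner_edges w"
    then show "(q 1 {w} \<otimes> s e) \<otimes> t e = s e \<otimes> t e" using src[of e] s_source[of e] by simp
  qed (use src in \<open>auto simp: m_closed\<close>)
  finally show "q 1 {w} \<otimes> breaking w = breaking w"
    using wv ie by (simp add: breaking_eq r_diff q_mult)
  have "esum (inner_edges w) \<otimes> q 1 {w} = (\<Oplus>e\<in>inner_edges w. s e \<otimes> (t e \<otimes> q 1 {w}))"
    using wv fin ie by (simp add: esum_mult)
  also have "\<dots> = esum (inner_edges w)"
    unfolding esum_def
  proof (intro add.finprod_cong')
    fix e assume "e \<in> inner_edges w"
    then show "s e \<otimes> (t e \<otimes> q 1 {w}) = s e \<otimes> t e" using src[of e] t_source[of e] by simp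
  qed (use src in \<open>auto simp: m_closed\<close>)
  finally show "breaking w \<otimes> q 1 {w} = breaking w"
    using wv ie by (simp add: breaking_eq l_diff q_mult)
qed

lemma breaking_idem [simp]:
  assumes w: "w \<in> breaking_vertices G H"
  shows "breaking w \<otimes> breaking w = breaking w"
proof -
  have "breaking w \<otimes> breaking w = breaking w \<otimes> q 1 {w} \<ominus> breaking w \<otimes> esum (inner_edges w)"
    using w breaking_vertex[OF w] inner_edges_edges
    by (subst (2) breaking_eq) (simp add: r_diff)
  also have "breaking w \<otimes> esum (inner_edges w) = \<zero>"
    using w breaking_finite inner_edges_edges[of w] breaking_s[OF w] by (intro mult_esum_zero) auto
  finally show ?thesis using w by (simp add: a_minus_def minus_equality[of \<zero> \<zero>])
qed

lemma breaking_q: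
  assumes "w \<in> breaking_vertices G H" "A \<in> gen_vertices G"
  shows "breaking w \<otimes> q k A = (if w \<in> A then breaking w \<otimes> q k {w} else \<zero>)"
proof -
  have "breaking w \<otimes> q k A = (breaking w \<otimes> q 1 {w}) \<otimes> q k A" using assms by simp
  also have "\<dots> = breaking w \<otimes> q k ({w} \<inter> A)"
    using assms breaking_vertex[OF assms(1)] by (simp only: m_assoc breaking_closed q_closed gens(2) q_mult mult_1)
  also have "{w} \<inter> A = (if w \<in> A then {w} else {})" by auto
  finally show ?thesis using assms by simp
qed

lemma breaking_lpath:
  assumes "w \<in> breaking_vertices G H" "set \<alpha> \<subseteq> edges G" "\<alpha> \<noteq> []" "x \<in> carrier Q"
  shows "breaking w \<otimes> sl \<alpha> x = \<zero>"
proof -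
  obtain e \<beta> where \<alpha>: "\<alpha> = e # \<beta>" using assms by (cases \<alpha>) auto
  then have "breaking w \<otimes> sl \<alpha> x = (breaking w \<otimes> s e) \<otimes> sl \<beta> x" 
    using assms by (simp only: m_assoc lpath.simps breaking_closed s_closed lpath_closed set_simps insert_subset)
  then show ?thesis using assms \<alpha> by simp
qed

lemma breaking_pos:
  assumes "w \<in> breaking_vertices G H" "y \<in> aspan Q (trm {1..})"
  shows "breaking w \<otimes> y = \<zero>"
  using assms(2) trm_closed
proof (induction rule: aspan_induct)
  case (add a x)
  then obtain e \<alpha> k A where "a = sl (e # \<alpha>) (q k A)" "e \<in> edges G" "set \<alpha> \<subseteq> edges G" "A \<in> gen_vertices G"
    unfolding trm_Suc_iff lpath.simps by blast
  then have "breaking w \<otimes> a = \<zero>" "a \<in> carrier Q" using assms(1) breaking_lpath[of w "e # \<alpha>"] by (auto simp: m_closed)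
  then show ?case using add assms(1) by (simp add: r_distr)
qed (use assms in simp)

text \<open>Collect the finitely many edges with which the terms of \<open>y\<close> begin.\<close>

lemma pos_local_unit:
  assumes "y \<in> aspan Q (trm {1..})"
  shows "\<exists>F. finite F \<and> F \<subseteq> edges G \<and> esum F \<otimes> y = y"
  using assms trm_closed
proof (induction rule: aspan_induct)
  case zero
  then show ?case by (intro exI[of _ "{}"]) (simp add: esum_def)
next
  case (add a x)
  then obtain F where F: "finite F" "F \<subseteq> edges G" "esum F \<otimes> x = x" by blast
  obtain e \<alpha> k A where a: "a = s e \<otimes> sl \<alpha> (q k A)" "e \<in> edges G" "set \<alpha> \<subseteq> edges G" "A \<in> gen_vertices G"
    using add(1) unfolding trm_Suc_iff by blast
  let ?F = "insert e F"
  have F': "finite ?F" "?F \<subseteq> edges G" using F a by auto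
  have "esum ?F \<otimes> a = (esum ?F \<otimes> s e) \<otimes> sl \<alpha> (q k A)"
    using F' a by (simp only: m_assoc esum_closed s_closed lpath_closed q_closed)
  also have "\<dots> = a" using esum_s[OF F' a(2)] a by simp
  finally have 1: "esum ?F \<otimes> a = a" .
  have "esum ?F \<otimes> esum F = (\<Oplus>f\<in>F. (esum ?F \<otimes> s f) \<otimes> t f)"
    using F F' by (simp add: mult_esum)
  also have "\<dots> = esum F"
    unfolding esum_def[of F] using F F' esum_s[OF F']
    by (intro add.finprod_cong') (auto simp: m_closed subset_iff)
  finally have "esum ?F \<otimes> (esum F \<otimes> x) = esum F \<otimes> x"
    using F(2) F'(2) add(3) m_assoc[of "esum ?F" "esum F" x] by simp
  then have 2: "esum ?F \<otimes> x = x" using F by simp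
  have "a \<in> carrier Q" using a by (simp add: m_closed)
  then have "esum ?F \<otimes> (a \<oplus> x) = a \<oplus> x" using 1 2 F' add by (simp add: r_distr)
  then show ?case using F' by blast
qed

text \<open>Ghosts detect nonzero elements of positive degree, since
  \<open>y = esum F \<otimes> y\<close> rebuilds \<open>y \<otimes> c\<close> from the products
  \<open>t e \<otimes> (y \<otimes> c)\<close>.\<close>

lemma pos_zeroI:
  assumes "y \<in> aspan Q (trm {1..})" "c \<in> carrier Q" "\<And>e. e \<in> edges G \<Longrightarrow> t e \<otimes> (y \<otimes> c) = \<zero>"
  shows "y \<otimes> c = \<zero>"
proof -
  obtain F where F: "finite F" "F \<subseteq> edges G" "esum F \<otimes> y = y" using pos_local_unit[OF assms(1)] by blast
  have y: "y \<in> carrier Q" using aspan_closed[OF trm_closed assms(1)] .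
  have "esum F \<otimes> (y \<otimes> c) = \<zero>" using F y assms by (intro esum_mult_zero) (auto intro: m_closed)
  then show ?thesis using F y assms by (simp flip: m_assoc)
qed

text \<open>As long as \<open>c\<close> annihilates the degree zero part, the positive part
  survives, and some ghost edge keeps it nonzero while shortening every path by one. The bound
  \<open>n\<close> drops, so this stops at an element whose degree zero part survives. The factor
  \<open>c\<close> will be a projection or some \<open>p_w^H\<close>.\<close>

lemma reduce_left:
  assumes "y \<in> aspan Q (trm {..n})" "c \<in> carrier Q" "y \<otimes> c \<noteq> \<zero>"
  shows "\<exists>z\<in>aspan Q (trm {0}). \<exists>r\<in>aspan Q (trm {1..}). \<exists>\<alpha>. set \<alpha> \<subseteq> edges G \<and> z \<otimes> c \<noteq> \<zero> \<and>
    (z \<oplus> r) \<otimes> c = tl \<alpha> (y \<otimes> c)"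
  using assms
proof (induction n arbitrary: y)
  case 0
  have "y \<in> carrier Q" using aspan_closed[OF trm_closed 0(1)] .
  then show ?case using 0 aspan_zero[of "trm {1..}"] by (intro bexI[of _ y] bexI[of _ \<zero>] exI[of _ "[]"]) auto
next
  case (Suc n)
  have "{..Suc n} = {0} \<union> {1..Suc n}" by auto
  then obtain z r where zr: "z \<in> aspan Q (trm {0})" "r \<in> aspan Q (trm {1..Suc n})" "y = z \<oplus> r"
    using aspan_Un[OF _ trm_closed trm_closed] Suc.prems(1) by (metis trm_Un)
  have c: "z \<in> carrier Q" "r \<in> carrier Q" using zr aspan_closed[OF trm_closed] by auto
  have "trm {1..Suc n} \<subseteq> trm {1..}" by (auto simp: trm_def)
  then have r: "r \<in> aspan Q (trm {1..})" using aspan_mono zr trm_closed by blast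
  show ?case
  proof (cases "z \<otimes> c = \<zero>")
    case False
    then show ?thesis using zr r by (intro bexI[of _ z] bexI[of _ r] exI[of _ "[]"]) auto
  next
    case True
    then have yc: "y \<otimes> c = r \<otimes> c" using zr c assms(2) by (simp add: l_distr m_closed)
    then obtain e where e: "e \<in> edges G" "t e \<otimes> (r \<otimes> c) \<noteq> \<zero>"
      using pos_zeroI[OF r assms(2)] Suc.prems by auto
    have "t e \<otimes> r \<in> aspan Q (trm {..n})"
      using zr(2) trm_closed
    proof (rule aspan_map[where F = "\<lambda>x. t e \<otimes> x"])
      fix a assume "a \<in> trm {1..Suc n}"
      then obtain \<alpha> k A where "a = sl \<alpha> (q k A)" "set \<alpha> \<subseteq> edges G" "1 \<le> length \<alpha>" "length \<alpha> \<le> Suc n" "A \<in> gen_vertices G"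
        by (auto simp: trm_def)
      moreover then obtain f \<beta> where "\<alpha> = f # \<beta>" by (cases \<alpha>) auto
      ultimately have a: "a = s f \<otimes> sl \<beta> (q k A)" "f \<in> edges G" "set \<beta> \<subseteq> edges G" "length \<beta> \<le> n" "A \<in> gen_vertices G"
        by auto
      have "t e \<otimes> a = (t e \<otimes> s f) \<otimes> sl \<beta> (q k A)"
        using a e by (simp only: m_assoc t_closed s_closed lpath_closed q_closed)
      then have "t e \<otimes> a = (if e = f then sl \<beta> (q k (reach G (erange G e) \<beta> \<inter> A)) else \<zero>)"
        using a e by (simp add: t_s q_lpath q_mult reach_gen)
      then show "t e \<otimes> a \<in> aspan Q (trm {..n})"
        using a e aspan_base[OF trm_closed trmI[of \<beta> "{..n}" "reach G (erange G e) \<beta> \<inter> A" k]]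
        by (auto simp: reach_gen aspan_zero)
    qed (use e in \<open>auto simp: r_distr trm_closed\<close>)
    moreover have "(t e \<otimes> r) \<otimes> c \<noteq> \<zero>" using e c assms(2) by (simp add: m_assoc)
    ultimately obtain z' r' \<alpha> where "z' \<in> aspan Q (trm {0})" "r' \<in> aspan Q (trm {1..})" "set \<alpha> \<subseteq> edges G"
        "z' \<otimes> c \<noteq> \<zero>" "(z' \<oplus> r') \<otimes> c = tl \<alpha> ((t e \<otimes> r) \<otimes> c)"
      using Suc.IH[of "t e \<otimes> r"] assms(2) by blast
    moreover then have "(z' \<oplus> r') \<otimes> c = tl (e # \<alpha>) (y \<otimes> c)" using e c assms(2) yc by (simp add: m_assoc)
    ultimately show ?thesis using e by (intro bexI[of _ z'] bexI[of _ r'] exI[of _ "e # \<alpha>"]) auto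
  qed
qed

text \<open>An element of degree zero is a sum of finitely many multiples of projections, hence a
  kind of step function; cutting \<open>B\<close> along the sets involved leaves pieces on which it
  is a scalar.\<close>

lemma degree_zero_local:
  assumes "z \<in> aspan Q (trm {0})" "B \<in> gen_vertices G" "z \<otimes> q 1 B \<noteq> \<zero>"
  shows "\<exists>D\<in>gen_vertices G - H. \<exists>k. D \<subseteq> B \<and> k \<noteq> 0 \<and> z \<otimes> q 1 D = q k D"
proof -
  \<comment> \<open>Contrapositive form: if \<open>c\<close> is the only scalar by which
    \<open>z\<close> acts on subsets of \<open>B\<close> outside \<open>H\<close>, then
    \<open>z\<close> acts by \<open>c\<close> on all of \<open>B\<close>. A new summand
    \<open>q k A\<close> splits \<open>B\<close> along \<open>A\<close> and lowers \<open>c\<close>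
    by \<open>k\<close> inside \<open>A\<close>. The lemma is the case \<open>c = 0\<close>.\<close>
  have "z \<otimes> q 1 B = q c B"
    if "B \<in> gen_vertices G" "\<And>D k. D \<in> gen_vertices G - H \<Longrightarrow> D \<subseteq> B \<Longrightarrow> z \<otimes> q 1 D = q k D \<Longrightarrow> k = c" for B c
    using assms(1) trm_closed that
  proof (induction arbitrary: B c rule: aspan_induct)
    case zero
    show ?case
    proof (cases "B \<in> H")
      case False
      then have "0 = c" using zero by (intro zero(2)[of B 0]) auto
      then show ?thesis using zero by auto
    qed (simp add: q_null zero)
  next
    case (add a x)
    then obtain k A where a: "a = q k A" "A \<in> gen_vertices G" by (auto simp: trm_zero_iff)
    have ax: "(a \<oplus> x) \<otimes> q 1 D = q k (A \<inter> D) \<oplus> x \<otimes> q 1 D" if "D \<in> gen_vertices G" for D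
      using that a add by (simp add: l_distr q_mult)
    have 1: "x \<otimes> q 1 (B \<inter> A) = q (c - k) (B \<inter> A)"
    proof (rule add.IH)
      fix D l assume D: "D \<in> gen_vertices G - H" "D \<subseteq> B \<inter> A" "x \<otimes> q 1 D = q l D"
      then have "A \<inter> D = D" by auto
      then have "(a \<oplus> x) \<otimes> q 1 D = q (k + l) D" using D ax q_add by auto
      then show "l = c - k" using add.prems(2)[of D "k + l"] D by (auto simp: algebra_simps)
    qed (use add a in auto)
    have 2: "x \<otimes> q 1 (B - A) = q c (B - A)"
    proof (rule add.IH)
      fix D l assume D: "D \<in> gen_vertices G - H" "D \<subseteq> B - A" "x \<otimes> q 1 D = q l D"
      then have "A \<inter> D = {}" by auto
      then have "(a \<oplus> x) \<otimes> q 1 D = q l D" using D ax by auto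
      then show "l = c" using add.prems(2)[of D l] D by auto
    qed (use add a in auto)
    have "x \<otimes> q 1 B = x \<otimes> q 1 (B \<inter> A) \<oplus> x \<otimes> q 1 (B - A)"
      using q_split[of B A 1] add a by (simp add: r_distr)
    then have "(a \<oplus> x) \<otimes> q 1 B = q k (B \<inter> A) \<oplus> (q (c - k) (B \<inter> A) \<oplus> q c (B - A))"
      using ax[of B] 1 2 add.prems by (simp add: Int_commute)
    also have "\<dots> = (q k (B \<inter> A) \<oplus> q (c - k) (B \<inter> A)) \<oplus> q c (B - A)"
      using add.prems a by (simp add: a_assoc)
    also have "\<dots> = q c B" using add.prems a q_split[of B A c] by (simp add: q_add)
    finally show ?case .
  qed
  from this[OF assms(2), of 0] show ?thesis using assms(2,3) by (auto 4 4)
qed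

lemma degree_zero_singleton:
  assumes "z \<in> aspan Q (trm {0})" "v \<in> vertices G"
  shows "\<exists>k. z \<otimes> q 1 {v} = q k {v}"
  using assms(1) trm_closed
proof (induction rule: aspan_induct)
  case zero
  show ?case using assms(2) by (intro exI[of _ 0]) simp
next
  case (add a x)
  then obtain k A where a: "a = q k A" "A \<in> gen_vertices G" by (auto simp: trm_zero_iff)
  obtain l where l: "x \<otimes> q 1 {v} = q l {v}" using add by blast
  have "A \<inter> {v} = (if v \<in> A then {v} else {})" by auto
  then have "(a \<oplus> x) \<otimes> q 1 {v} = q (if v \<in> A then k + l else l) {v}"
    using a l add assms(2) by (simp add: l_distr q_mult q_add)
  then show ?case ..
qed

end

section \<open>The reduction theorem\<close>

lemma (in rng) aspan_UN:
  assumes "x \<in> aspan R (\<Union>n::nat. T n)" "\<And>n. T n \<subseteq> carrier R" "mono T"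
  shows "\<exists>n. x \<in> aspan R (T n)"
proof -
  have "(\<Union>n. T n) \<subseteq> carrier R" using assms(2) by auto
  with assms(1) show ?thesis
  proof (induction rule: aspan_induct)
    case zero
    show ?case using aspan_zero by blast
  next
    case (add a x)
    then obtain m n where mn: "a \<in> T m" "x \<in> aspan R (T n)" by auto
    have T: "T m \<subseteq> T (max m n)" "T n \<subseteq> T (max m n)" by (simp_all add: monoD[OF assms(3)])
    have "a \<in> T (max m n)" "x \<in> aspan R (T (max m n))"
      using mn T aspan_mono[OF T(2) assms(2)] by auto
    then have "a \<oplus> x \<in> aspan R (T (max m n))"
      using aspan_add[OF assms(2) aspan_base[OF assms(2)]] by blast
    then show ?case ..
  qed
qed

context leavitt_quotient
begin

lemma trm_mono: "I \<subseteq> J \<Longrightarrow> trm I \<subseteq> trm J" and mon_mono: "I \<subseteq> J \<Longrightarrow> mon I \<subseteq> mon J"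
  unfolding trm_def mon_def by blast+

lemma trm_bounded:
  assumes "x \<in> aspan Q (trm UNIV)" shows "\<exists>n. x \<in> aspan Q (trm {..n})"
proof -
  have "trm UNIV = (\<Union>n. trm {..n})"
  proof
    show "trm UNIV \<subseteq> (\<Union>n. trm {..n})"
    proof
      fix a assume "a \<in> trm UNIV"
      then obtain \<alpha> k A where "a = sl \<alpha> (q k A)" "set \<alpha> \<subseteq> edges G" "A \<in> gen_vertices G"
        by (auto simp: trm_def)
      then have "a \<in> trm {..length \<alpha>}" by (auto intro: trmI)
      then show "a \<in> (\<Union>n. trm {..n})" by blast
    qed
  qed (use trm_mono in blast)
  moreover have "mono (\<lambda>n. trm {..n})" by (rule monoI, rule trm_mono) auto
  ultimately show ?thesis using assms aspan_UN[of x "\<lambda>n. trm {..n}"] trm_closed by simp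
qed

lemma mon_bounded:
  assumes "x \<in> aspan Q (mon UNIV)" shows "\<exists>n. x \<in> aspan Q (mon {..n})"
proof -
  have "mon UNIV = (\<Union>n. mon {..n})"
  proof
    show "mon UNIV \<subseteq> (\<Union>n. mon {..n})"
    proof
      fix a assume "a \<in> mon UNIV"
      then obtain \<alpha> \<beta> k A where "a = tr \<beta> (sl \<alpha> (q k A))" "set \<alpha> \<subseteq> edges G" "set \<beta> \<subseteq> edges G"
          "A \<in> gen_vertices G"
        by (auto simp: mon_def)
      then have "a \<in> mon {..length \<beta>}" by (auto intro: monI)
      then show "a \<in> (\<Union>n. mon {..n})" by blast
    qed
  qed (use mon_mono in blast)
  moreover have "mono (\<lambda>n. mon {..n})" by (rule monoI, rule mon_mono) auto
  ultimately show ?thesis using assms aspan_UN[of x "\<lambda>n. mon {..n}"] mon_closed by simp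
qed

lemma mon_zero_eq: "mon {0} = trm UNIV"
  by (force simp: mon_def trm_def)

lemma q_rpath:
  assumes "A \<in> gen_vertices G" "set \<alpha> \<subseteq> edges G" "x \<in> carrier Q"
  shows "tr \<alpha> x \<otimes> q k A = tr \<alpha> (x \<otimes> q k (reach G A \<alpha>))"
  using leavitt_quotient.q_lpath[OF op, of A \<alpha> x k] assms by simp

text \<open>A larger projection fixes whatever a smaller one fixes, so two elements share a unit,
  namely that of the union.\<close>

lemma right_unit:
  assumes "x \<in> carrier Q"
  shows "\<exists>B\<in>gen_vertices G. x \<otimes> q 1 B = x"
  using assms
proof (rule generated)
  fix k A assume "A \<in> gen_vertices G"
  then show "\<exists>B\<in>gen_vertices G. q k A \<otimes> q 1 B = q k A" by (intro bexI[of _ A]) (auto simp: q_mult)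
next
  fix e assume "e \<in> edges G"
  then show "\<exists>B\<in>gen_vertices G. s e \<otimes> q 1 B = s e" "\<exists>B\<in>gen_vertices G. t e \<otimes> q 1 B = t e"
    using s_range t_source source_gen by blast+
next
  fix x y assume xy: "x \<in> carrier Q" "y \<in> carrier Q"
    "\<exists>B\<in>gen_vertices G. x \<otimes> q 1 B = x" "\<exists>B\<in>gen_vertices G. y \<otimes> q 1 B = y"
  then obtain B C where BC: "B \<in> gen_vertices G" "x \<otimes> q 1 B = x" "C \<in> gen_vertices G" "y \<otimes> q 1 C = y" by blast
  have "x \<otimes> q 1 (B \<union> C) = x \<otimes> (q 1 B \<otimes> q 1 (B \<union> C))" using BC xy by (simp flip: m_assoc)
  moreover have "y \<otimes> q 1 (B \<union> C) = y \<otimes> (q 1 C \<otimes> q 1 (B \<union> C))" using BC xy by (simp flip: m_assoc)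
  moreover have "B \<inter> (B \<union> C) = B" "C \<inter> (B \<union> C) = C" by auto
  ultimately have "(x \<oplus> y) \<otimes> q 1 (B \<union> C) = x \<oplus> y" using BC xy by (simp add: l_distr q_mult)
  then show "\<exists>B\<in>gen_vertices G. (x \<oplus> y) \<otimes> q 1 B = x \<oplus> y" using BC by blast
  show "\<exists>B\<in>gen_vertices G. (x \<otimes> y) \<otimes> q 1 B = x \<otimes> y" using BC xy by (intro bexI[of _ C]) (simp_all add: m_assoc)
qed

lemma pos_mult_q:
  assumes "y \<in> aspan Q (trm I)" "A \<in> gen_vertices G"
  shows "y \<otimes> q k A \<in> aspan Q (trm I)"
  using assms(1) trm_closed trm_closed
proof (rule aspan_map[where F = "\<lambda>x. x \<otimes> q k A"])
  fix a assume "a \<in> trm I"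
  then obtain \<alpha> l B where a: "a = sl \<alpha> (q l B)" "set \<alpha> \<subseteq> edges G" "length \<alpha> \<in> I" "B \<in> gen_vertices G"
    by (auto simp: trm_def)
  then have "a \<otimes> q k A = sl \<alpha> (q (l * k) (B \<inter> A))" using assms(2) by (simp add: lpath_mult q_mult)
  then show "a \<otimes> q k A \<in> aspan Q (trm I)"
    using a assms(2) by (auto intro!: aspan_base[OF trm_closed] trmI)
qed (use assms in \<open>auto simp: l_distr\<close>)

text \<open>By \<open>reduce_left\<close>, a nonzero \<open>y p_v\<close> yields
  \<open>k p_v\<close> plus positive terms with \<open>k \<noteq> 0\<close>. Conjugation by
  \<open>f\<close> turns this into \<open>k p_{r(f)}\<close> plus positive terms, which is nonzero
  as the range of \<open>f\<close> is outside \<open>H\<close>, although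
  \<open>y s_f = 0\<close>.\<close>

lemma inner_edge_injective:
  assumes y: "y \<in> aspan Q (trm UNIV)" and f: "f \<in> edges G" "erange G f \<notin> H" "y \<otimes> s f = \<zero>"
  shows "y \<otimes> q 1 {source G f} = \<zero>"
proof (rule ccontr)
  let ?v = "source G f"
  assume nz: "y \<otimes> q 1 {?v} \<noteq> \<zero>"
  have yc: "y \<in> carrier Q" using aspan_closed[OF trm_closed y] .
  have v: "?v \<in> vertices G" using f source_closed by simp
  obtain n where "y \<in> aspan Q (trm {..n})" using trm_bounded[OF y] by blast
  then obtain z r \<alpha> where zr: "z \<in> aspan Q (trm {0})" "r \<in> aspan Q (trm {1..})" "set \<alpha> \<subseteq> edges G"
      "z \<otimes> q 1 {?v} \<noteq> \<zero>" and eq: "(z \<oplus> r) \<otimes> q 1 {?v} = tl \<alpha> (y \<otimes> q 1 {?v})"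
    using reduce_left[of y n "q 1 {?v}"] nz f by auto
  have c: "z \<in> carrier Q" "r \<in> carrier Q" using zr aspan_closed[OF trm_closed] by auto
  obtain k where k: "z \<otimes> q 1 {?v} = q k {?v}" using degree_zero_singleton[OF zr(1) v] by blast
  then have "k \<noteq> 0" using zr(4) v by auto
  have vs: "q 1 {?v} \<otimes> s f = s f" using s_source f by simp
  have "(z \<oplus> r) \<otimes> s f = (z \<oplus> r) \<otimes> q 1 {?v} \<otimes> s f" using c f vs by (simp add: m_assoc)
  also have "\<dots> = tl \<alpha> (y \<otimes> q 1 {?v} \<otimes> s f)" using zr eq yc f by (simp add: lghost_mult m_closed)
  also have "y \<otimes> q 1 {?v} \<otimes> s f = \<zero>" using yc f vs by (simp add: m_assoc)
  finally have "(z \<oplus> r) \<otimes> s f = \<zero>" using zr by simp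
  moreover have "z \<otimes> s f = q k {?v} \<otimes> s f" using k c f vs by (metis m_assoc q_closed s_closed source_gen)
  ultimately have "s f \<otimes> q k (erange G f) \<oplus> r \<otimes> s f = \<zero>" using c f by (simp add: l_distr q_source_s)
  then have "t f \<otimes> (s f \<otimes> q k (erange G f) \<oplus> r \<otimes> s f) = \<zero>" using f by simp
  moreover have "t f \<otimes> (s f \<otimes> q k (erange G f)) = q k (erange G f)"
    using f by (simp add: t_s q_mult flip: m_assoc)
  ultimately have 1: "q k (erange G f) \<oplus> t f \<otimes> (r \<otimes> s f) = \<zero>" using c f by (simp add: r_distr m_closed)
  \<comment> \<open>Conjugation moves the first edge to the end: \<open>f \<gamma>\<close> becomes
    \<open>\<gamma> f\<close>, and paths not beginning with \<open>f\<close> vanish, so lengths stay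
    positive.\<close>
  have "t f \<otimes> (r \<otimes> s f) \<in> aspan Q (trm {1..})"
    using zr(2) trm_closed trm_closed
  proof (rule aspan_map[where F = "\<lambda>r. t f \<otimes> (r \<otimes> s f)"])
    fix a assume "a \<in> trm {1..}"
    then obtain e \<gamma> k A where a: "a = s e \<otimes> sl \<gamma> (q k A)" "e \<in> edges G" "set \<gamma> \<subseteq> edges G" "A \<in> gen_vertices G"
      unfolding trm_Suc_iff by blast
    have "t f \<otimes> (a \<otimes> s f) = (t f \<otimes> s e) \<otimes> sl \<gamma> (q k A \<otimes> s f)"
      using a f by (simp add: m_assoc lpath_mult m_closed)
    also have "\<dots> = (if f = e then sl \<gamma> (q k (reach G (erange G f) \<gamma> \<inter> A) \<otimes> s f) else \<zero>)"
      using a f by (simp add: t_s q_lpath q_mult reach_gen m_closed flip: m_assoc)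
    also have "q k (reach G (erange G f) \<gamma> \<inter> A) \<otimes> s f =
        (if ?v \<in> reach G (erange G f) \<gamma> \<inter> A then sl [f] (q k (erange G f)) else \<zero>)"
      using a f by (simp add: q_s reach_gen)
    finally show "t f \<otimes> (a \<otimes> s f) \<in> aspan Q (trm {1..})"
      using a f aspan_base[OF trm_closed trmI[of "\<gamma> @ [f]" "{1..}" "erange G f" k]]
      by (auto simp: aspan_zero lpath_append split: if_splits)
  qed (use f in \<open>auto simp: l_distr r_distr m_closed\<close>)
  then show False using head_nonzero[of "erange G f" k] \<open>k \<noteq> 0\<close> f 1 by auto
qed

text \<open>The edge \<open>f\<close> meets the ghost of the first edge of \<open>\<beta>\<close>,
  so the ghost part loses a letter or the term vanishes; without ghosts only \<open>\<alpha>\<close>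
  grows.\<close>

lemma mon_mult_s:
  assumes "x \<in> aspan Q (mon {..Suc n})" "f \<in> edges G"
  shows "x \<otimes> s f \<in> aspan Q (mon {..n})"
  using assms(1) mon_closed mon_closed
proof (rule aspan_map[where F = "\<lambda>x. x \<otimes> s f"])
  fix a assume "a \<in> mon {..Suc n}"
  then obtain \<alpha> \<beta> k A where a: "a = tr \<beta> (sl \<alpha> (q k A))" "set \<alpha> \<subseteq> edges G" "set \<beta> \<subseteq> edges G"
      "length \<beta> \<le> Suc n" "A \<in> gen_vertices G"
    by (auto simp: mon_def)
  have "a \<otimes> s f \<in> mon {..n}"
  proof (cases \<beta>)
    case Nil
    then have "a \<otimes> s f = (if source G f \<in> A then tr [] (sl (\<alpha> @ [f]) (q k (erange G f))) else \<zero>)"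
      using a assms(2) by (simp add: lpath_mult q_s lpath_append)
    then show ?thesis using a assms(2) monI[of "\<alpha> @ [f]" "[]" "{..n}" "erange G f" k]
      by (auto simp: mon_zero)
  next
    case (Cons e \<gamma>)
    have "a \<otimes> s f = tr \<gamma> (sl \<alpha> (q k A)) \<otimes> (t e \<otimes> s f)" using a Cons assms(2) by (simp add: m_assoc)
    also have "\<dots> = (if e = f then tr \<gamma> (sl \<alpha> (q k (A \<inter> reach G (erange G e) \<gamma>))) else \<zero>)"
      using a Cons assms(2) by (simp add: t_s q_rpath lpath_mult q_mult reach_gen)
    finally show ?thesis using a Cons assms(2) by (auto intro!: monI mon_zero reach_gen)
  qed
  then show "a \<otimes> s f \<in> aspan Q (mon {..n})" using aspan_base mon_closed by blast
qed (use assms in \<open>auto simp: l_distr\<close>)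

text \<open>Mirror image of \<open>pos_local_unit\<close>: each term ends in \<open>t e\<close> for
  the first edge \<open>e\<close> of its \<open>\<beta>\<close>.\<close>

lemma ghost_local_unit:
  assumes "y \<in> aspan Q (mon {1..})"
  shows "\<exists>F. finite F \<and> F \<subseteq> edges G \<and> y \<otimes> esum F = y"
  using assms mon_closed
proof (induction rule: aspan_induct)
  case zero
  then show ?case by (intro exI[of _ "{}"]) (simp add: esum_def)
next
  case (add a x)
  then obtain F where F: "finite F" "F \<subseteq> edges G" "x \<otimes> esum F = x" by blast
  obtain \<alpha> \<beta> k A where "a = tr \<beta> (sl \<alpha> (q k A))" "set \<alpha> \<subseteq> edges G" "set \<beta> \<subseteq> edges G" "1 \<le> length \<beta>" "A \<in> gen_vertices G"
    using add(1) by (auto simp: mon_def)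
  moreover then obtain e \<gamma> where "\<beta> = e # \<gamma>" by (cases \<beta>) auto
  ultimately have a: "a = tr \<gamma> (sl \<alpha> (q k A)) \<otimes> t e" "tr \<gamma> (sl \<alpha> (q k A)) \<in> carrier Q" "e \<in> edges G"
    by auto
  let ?F = "insert e F"
  have F': "finite ?F" "?F \<subseteq> edges G" using F a by auto
  have 1: "a \<otimes> esum ?F = a" using a F' t_esum[OF F' a(3)] by (simp add: m_assoc)
  have "esum F \<otimes> esum ?F = (\<Oplus>f\<in>F. s f \<otimes> (t f \<otimes> esum ?F))"
    using F F' by (simp add: esum_mult)
  also have "\<dots> = esum F"
    unfolding esum_def[of F] using F F' t_esum[OF F']
    by (intro add.finprod_cong') (auto simp: m_closed subset_iff)
  finally have "(x \<otimes> esum F) \<otimes> esum ?F = x \<otimes> esum F"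
    using F(2) F'(2) add(3) m_assoc[of x "esum F" "esum ?F"] by simp
  then have 2: "x \<otimes> esum ?F = x" using F by simp
  have "a \<in> carrier Q" using a by (simp add: m_closed)
  then have "(a \<oplus> x) \<otimes> esum ?F = a \<oplus> x" using 1 2 F' add by (simp add: l_distr)
  then show ?case using F' by blast
qed

lemma q_finite_nonzero:
  assumes "finite V" "V \<subseteq> vertices G" "x \<in> carrier Q" "x \<otimes> q 1 V \<noteq> \<zero>"
  shows "\<exists>v\<in>V. x \<otimes> q 1 {v} \<noteq> \<zero>"
  using assms(1,2,4)
proof (induction V rule: finite_induct)
  case empty
  then show ?case using assms(3) by simp
next
  case (insert v V)
  then have "V \<in> gen_vertices G" "{v} \<in> gen_vertices G" using gen_finite by auto
  then have "x \<otimes> q 1 ({v} \<union> V) = x \<otimes> q 1 {v} \<oplus> x \<otimes> q 1 V"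
    using q_disjoint[of "{v}" V 1] insert(2) assms(3) by (simp add: r_distr)
  then show ?case using insert assms(3) \<open>V \<in> gen_vertices G\<close> by (cases "x \<otimes> q 1 {v} = \<zero>") (auto simp: m_closed)
qed

text \<open>Either \<open>v \<in> S\<close>, where \<open>p_v^H\<close> is zero in \<open>Q\<close>,
  or only finitely many edges leave \<open>v\<close>, and those with range in \<open>H\<close> drop
  out of the Cuntz-Krieger relation.\<close>

lemma vertex_expansion:
  assumes "v \<in> vertices G" "{v} \<notin> H" "finite (inner_edges v)" "inner_edges v \<noteq> {}"
    "v \<notin> breaking_vertices G H - S"
  shows "q 1 {v} = esum (inner_edges v)"
proof (cases "v \<in> breaking_vertices G H")
  case True
  then have "v \<in> S" using assms by simp
  then show ?thesis using ck_S by (simp add: esum_def inner_edges_def)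
next
  case False
  then have fin: "finite (out_edges G v)" using assms by (auto simp: breaking_vertices_def inner_edges_def)
  have ne: "out_edges G v \<noteq> {}" using assms(4) by (auto simp: inner_edges_def)
  have "(\<Oplus>e\<in>out_edges G v. s e \<otimes> t e) = (\<Oplus>e\<in>inner_edges v. s e \<otimes> t e)"
    using fin s_null by (intro add.finprod_mono_neutral_cong_right) (auto simp: inner_edges_def out_edges_def m_closed)
  then show ?thesis using ck[OF assms(1) ne fin] by (simp add: esum_def)
qed

lemma breaking_commute:
  assumes w: "w \<in> breaking_vertices G H"
  shows "q k {w} \<otimes> breaking w = breaking w \<otimes> q k {w}"
proof -
  note wv = breaking_vertex[OF w] and fin = breaking_finite[OF w] and ie = inner_edges_edges[of w]
  have "q k {w} \<otimes> esum (inner_edges w) = (\<Oplus>e\<in>inner_edges w. (q k {w} \<otimes> s e) \<otimes> t e)"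
    using wv fin ie by (simp add: mult_esum)
  also have "\<dots> = (\<Oplus>e\<in>inner_edges w. s e \<otimes> (t e \<otimes> q k {w}))"
  proof (intro add.finprod_cong')
    fix e assume "e \<in> inner_edges w"
    then have "e \<in> edges G" "source G e = w" by (auto simp: inner_edges_def out_edges_def)
    then show "(q k {w} \<otimes> s e) \<otimes> t e = s e \<otimes> (t e \<otimes> q k {w})"
      using wv by (simp add: q_s t_q m_assoc)
  qed (use wv ie in \<open>auto simp: m_closed\<close>)
  also have "\<dots> = esum (inner_edges w) \<otimes> q k {w}"
    using wv fin ie by (simp add: esum_mult)
  finally show ?thesis using wv ie by (simp add: breaking_eq l_diff r_diff q_mult)
qed

text \<open>The scalar is undone by multiplying with \<open>q (1 / k) {w}\<close>, since an ideal of
  \<open>Q\<close> is only known to absorb elements of \<open>Q\<close>.\<close>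

lemma breaking_scale_mem:
  assumes J: "rng_ideal J Q" and w: "w \<in> breaking_vertices G H" and "k \<noteq> 0"
    and mem: "breaking w \<otimes> (q k {w} \<otimes> breaking w) \<in> J"
  shows "breaking w \<in> J"
proof -
  note wv = breaking_vertex[OF w] and bc = breaking_closed[OF w]
  have "q (1 / k) {w} \<otimes> (breaking w \<otimes> (q k {w} \<otimes> breaking w)) =
      q (1 / k) {w} \<otimes> (q k {w} \<otimes> (breaking w \<otimes> breaking w))"
    using breaking_commute[OF w, of k] bc wv by (metis gens(2) m_assoc q_closed)
  also have "\<dots> = (q (1 / k) {w} \<otimes> q k {w}) \<otimes> breaking w"
    using bc wv w by (simp add: m_assoc)
  also have "\<dots> = breaking w" using wv w \<open>k \<noteq> 0\<close> by (simp add: q_mult)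
  finally show ?thesis using rng_ideal.I_l_closed[OF J mem, of "q (1 / k) {w}"] wv by simp
qed

text \<open>Multiplying by an edge from the right shortens the ghosts. The obstacle is a nonzero
  \<open>x\<close> killed by all edges; it has the form
  \<open>y \<ominus> y \<otimes> esum F\<close> with \<open>y\<close> free of ghosts, so a factor
  \<open>a\<close> that the ghosts of \<open>F\<close> annihilate turns \<open>x \<otimes> a\<close>
  into \<open>y \<otimes> a\<close>. Such a factor is found unless the surviving edges at the vertex
  in question force \<open>x\<close> to vanish there.\<close>

lemma ghost_reduce:
  assumes J: "rng_ideal J Q"
    and "x \<in> aspan Q (mon {..n})" "x \<in> J" "x \<noteq> \<zero>"
  shows "(\<exists>w\<in>breaking_vertices G H - S. breaking w \<in> J) \<or> (\<exists>y\<in>aspan Q (trm UNIV). y \<in> J \<and> y \<noteq> \<zero>)"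
  using assms(2-4)
proof (induction n arbitrary: x)
  case 0
  have "{..0::nat} = {0}" by auto
  then show ?case using 0 mon_zero_eq by auto
next
  case (Suc n)
  interpret J: rng_ideal J Q by (rule J)
  show ?case
  proof (cases "\<exists>f\<in>edges G. x \<otimes> s f \<noteq> \<zero>")
    case True
    then obtain f where f: "f \<in> edges G" "x \<otimes> s f \<noteq> \<zero>" by blast
    then show ?thesis
      using Suc.IH[of "x \<otimes> s f"] mon_mult_s[OF Suc.prems(1)] J.I_r_closed[OF Suc.prems(2)] by auto
  next
    case False
    then have xs: "x \<otimes> s f = \<zero>" if "f \<in> edges G" for f using that by blast
    have "{..Suc n} = {0} \<union> {1..Suc n}" by auto
    then obtain y g where yg: "y \<in> aspan Q (mon {0})" "g \<in> aspan Q (mon {1..Suc n})" "x = y \<oplus> g"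
      using aspan_Un[OF _ mon_closed mon_closed] Suc.prems(1) by (metis mon_Un)
    have y: "y \<in> aspan Q (trm UNIV)" using yg mon_zero_eq by simp
    have c: "y \<in> carrier Q" "g \<in> carrier Q" using yg aspan_closed[OF mon_closed] by auto
    have xc: "x \<in> carrier Q" using yg c by simp
    have "mon {1..Suc n} \<subseteq> mon {1..}" by (auto simp: mon_def)
    then have "g \<in> aspan Q (mon {1..})" using aspan_mono yg mon_closed by blast
    then obtain F where F: "finite F" "F \<subseteq> edges G" "g \<otimes> esum F = g" using ghost_local_unit by blast
    \<comment> \<open>As \<open>g \<otimes> esum F = g\<close>, the ghost part is determined by
      \<open>y\<close>: it is the negative of \<open>y \<otimes> esum F\<close>.\<close>
    have "x \<otimes> esum F = \<zero>" using xs F xc by (intro mult_esum_zero) auto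
    then have "y \<otimes> esum F \<oplus> g = \<zero>" using yg c F by (simp add: l_distr)
    then have "\<ominus> (y \<otimes> esum F) = g" using c F
      by (intro minus_equality) (simp_all add: m_closed a_comm)
    then have x_eq: "x = y \<ominus> y \<otimes> esum F" using yg by (simp add: a_minus_def)
    have xm: "x \<otimes> a = y \<otimes> a \<ominus> y \<otimes> (esum F \<otimes> a)" if "a \<in> carrier Q" for a
      using that c F by (simp add: x_eq l_diff m_closed m_assoc)
    have xm0: "x \<otimes> a = y \<otimes> a" if "a \<in> carrier Q" "\<And>e. e \<in> F \<Longrightarrow> t e \<otimes> a = \<zero>" for a
      using xm[OF that(1)] esum_mult_zero[OF F(1,2) that] c that
      by (simp add: a_minus_def minus_equality[of \<zero> \<zero>] m_closed)
    obtain B where B: "B \<in> gen_vertices G" "x \<otimes> q 1 B = x" using right_unit[OF xc] by blast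
    \<comment> \<open>Only finitely many vertices emit edges of \<open>F\<close>; away from them
      \<open>x\<close> and \<open>y\<close> agree.\<close>
    define V where "V = source G ` F"
    have V: "finite V" "V \<subseteq> vertices G" using F source_closed by (auto simp: V_def)
    then have Vg: "V \<in> gen_vertices G" by (rule gen_finite)
    show ?thesis
    proof (cases "x \<otimes> q 1 (B - V) = \<zero>")
      case False
      have "x \<otimes> q 1 (B - V) = y \<otimes> q 1 (B - V)"
        using F B Vg by (intro xm0) (auto simp: t_q V_def)
      then show ?thesis using False y B Vg J.I_r_closed[OF Suc.prems(2), of "q 1 (B - V)"]
        by (intro disjI2 bexI[of _ "y \<otimes> q 1 (B - V)"] pos_mult_q) auto
    next
      case True
      have "x \<otimes> q 1 B = x \<otimes> q 1 (B \<inter> V) \<oplus> x \<otimes> q 1 (B - V)"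
        using q_split[OF B(1) Vg, of 1] xc B Vg by (simp add: r_distr)
      then have "x \<otimes> q 1 (B \<inter> V) \<noteq> \<zero>" using True B xc Vg Suc.prems(3) by auto
      then obtain v where v: "v \<in> V" "x \<otimes> q 1 {v} \<noteq> \<zero>"
        using q_finite_nonzero[of "B \<inter> V" x] V xc by auto
      have vv: "v \<in> vertices G" using v V by auto
      have vH: "{v} \<notin> H" using v q_null[of "{v}" 1] xc by auto
      show ?thesis
      proof (cases "v \<in> breaking_vertices G H - S")
        case w: True
        \<comment> \<open>At a gap vertex \<open>x\<close> kills the subtracted edges, so
          \<open>p_v\<close> may be replaced by \<open>p_v^H\<close>, which the ghosts of
          \<open>F\<close> annihilate.\<close>
        have "x \<otimes> breaking v = x \<otimes> q 1 {v} \<ominus> x \<otimes> esum (inner_edges v)"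
          using w vv xc inner_edges_edges by (simp add: breaking_eq r_diff)
        also have "x \<otimes> esum (inner_edges v) = \<zero>"
          using w breaking_finite inner_edges_edges[of v] xs xc by (intro mult_esum_zero) auto
        finally have "x \<otimes> breaking v = x \<otimes> q 1 {v}"
          using xc vv by (simp add: a_minus_def minus_equality[of \<zero> \<zero>] m_closed)
        then have nz: "x \<otimes> breaking v \<noteq> \<zero>" using v by simp
        have "x \<otimes> breaking v = y \<otimes> breaking v" using w F by (intro xm0) auto
        then have "y \<otimes> breaking v \<noteq> \<zero>" and yJ: "y \<otimes> breaking v \<in> J"
          using nz w J.I_r_closed[OF Suc.prems(2), of "breaking v"] by auto
        moreover obtain m where "y \<in> aspan Q (trm {..m})" using trm_bounded[OF y] by blast
        ultimately obtain z r \<alpha> where zr: "z \<in> aspan Q (trm {0})" "r \<in> aspan Q (trm {1..})" "set \<alpha> \<subseteq> edges G"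
            "z \<otimes> breaking v \<noteq> \<zero>" and eq: "(z \<oplus> r) \<otimes> breaking v = tl \<alpha> (y \<otimes> breaking v)"
          using reduce_left[of y m "breaking v"] w by auto
        have zc: "z \<in> carrier Q" "r \<in> carrier Q" using zr aspan_closed[OF trm_closed] by auto
        have tlJ: "tl \<alpha> a \<in> J" if "a \<in> J" for a
          using zr(3) that J.I_l_closed by (induction \<alpha> arbitrary: a) auto
        obtain k where k: "z \<otimes> q 1 {v} = q k {v}" using degree_zero_singleton[OF zr(1) vv] by blast
        have bc: "breaking v \<in> carrier Q" and bv: "v \<in> breaking_vertices G H" using w by auto
        have zb: "z \<otimes> breaking v = q k {v} \<otimes> breaking v"
          using k zc bc vv q_breaking(1)[OF bv] by (metis gens(2) m_assoc q_closed)
        then have "k \<noteq> 0" using zr(4) bc vv by auto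
        \<comment> \<open>Multiplying by \<open>p_v^H\<close> from the left removes the positive
          part \<open>r\<close>.\<close>
        have "breaking v \<otimes> (z \<oplus> r) = breaking v \<otimes> z"
          using breaking_pos[OF bv zr(2)] bc zc by (simp add: r_distr m_closed)
        then have "breaking v \<otimes> ((z \<oplus> r) \<otimes> breaking v) = breaking v \<otimes> (z \<otimes> breaking v)"
          using bc zc by (metis add.m_closed m_assoc)
        moreover have "breaking v \<otimes> ((z \<oplus> r) \<otimes> breaking v) \<in> J"
          using eq tlJ[OF yJ] J.I_l_closed bc by simp
        ultimately have mem: "breaking v \<otimes> (q k {v} \<otimes> breaking v) \<in> J" using zb by simp
        show ?thesis using breaking_scale_mem[OF J bv \<open>k \<noteq> 0\<close> mem] w by auto
      next
        case nw: False
        show ?thesis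
        proof (cases "inner_edges v \<noteq> {} \<and> finite (inner_edges v)")
          case True
          then have "q 1 {v} = esum (inner_edges v)" using vertex_expansion vv vH nw by blast
          then have "x \<otimes> q 1 {v} = \<zero>"
            using True inner_edges_edges[of v] xs xc by (simp, intro mult_esum_zero) auto
          then show ?thesis using v by simp
        next
          case False
          show ?thesis
          proof (cases "inner_edges v = {}")
            case True
            \<comment> \<open>In \<open>Q\<close> the vertex is a sink, as ghosts of edges with
              range in \<open>H\<close> are zero; so \<open>p_v\<close> itself can serve as the
              factor.\<close>
            have "x \<otimes> q 1 {v} = y \<otimes> q 1 {v}"
            proof (rule xm0)
              fix e assume "e \<in> F"
              then have e: "e \<in> edges G" using F by auto
              then have "source G e = v \<Longrightarrow> erange G e \<in> H" using True by (auto simp: inner_edges_def out_edges_def)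
              then show "t e \<otimes> q 1 {v} = \<zero>" using e vv t_null by (simp add: t_q)
            qed (use vv in simp)
            then show ?thesis using v y vv J.I_r_closed[OF Suc.prems(2), of "q 1 {v}"]
              by (intro disjI2 bexI[of _ "y \<otimes> q 1 {v}"] pos_mult_q) auto
          next
            case ne: False
            then have "infinite (inner_edges v)" using False by simp
            \<comment> \<open>An edge outside the finite set \<open>F\<close> is not seen by
              \<open>esum F\<close>, so \<open>y s_f = x s_f = 0\<close>. Injectivity gives
              \<open>y p_v = 0\<close> and then \<open>x p_v = 0\<close>, against the choice of
              \<open>v\<close>.\<close>
            then obtain f where "f \<in> inner_edges v" "f \<notin> F"
              using F(1) by (meson finite_subset subsetI)
            then have f: "f \<in> edges G" "source G f = v" "erange G f \<notin> H" "f \<notin> F"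
              by (auto simp: inner_edges_def out_edges_def)
            have "x \<otimes> s f = y \<otimes> s f"
              by (rule xm0) (use f F in \<open>auto simp: t_s subset_iff\<close>)
            then have "y \<otimes> s f = \<zero>" using xs[OF f(1)] by simp
            then have y0: "y \<otimes> q 1 {v} = \<zero>" using inner_edge_injective[OF y f(1,3)] f by simp
            have "esum F \<otimes> q 1 {v} = q 1 {v} \<otimes> esum F"
            proof -
              have "esum F \<otimes> q 1 {v} = (\<Oplus>e\<in>F. s e \<otimes> (t e \<otimes> q 1 {v}))"
                using vv F by (simp add: esum_mult)
              also have "\<dots> = (\<Oplus>e\<in>F. (q 1 {v} \<otimes> s e) \<otimes> t e)"
              proof (intro add.finprod_cong')
                fix e assume "e \<in> F"
                then have "e \<in> edges G" using F by auto
                then show "s e \<otimes> (t e \<otimes> q 1 {v}) = (q 1 {v} \<otimes> s e) \<otimes> t e"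
                  using vv by (simp add: q_s t_q m_assoc)
              qed (use vv F in \<open>auto simp: m_closed subset_iff\<close>)
              also have "\<dots> = q 1 {v} \<otimes> esum F"
                using vv F by (simp add: mult_esum)
              finally show ?thesis .
            qed
            then have "x \<otimes> q 1 {v} = y \<otimes> q 1 {v} \<ominus> (y \<otimes> q 1 {v}) \<otimes> esum F"
              using xm[of "q 1 {v}"] vv c F by (simp add: m_assoc)
            then have "x \<otimes> q 1 {v} = \<zero>" using y0 F by (simp add: a_minus_def minus_equality[of \<zero> \<zero>])
            then show ?thesis using v by simp
          qed
        qed
      qed
    qed
  qed
qed

lemma ideal_lghost:
  assumes "rng_ideal J Q" "set \<alpha> \<subseteq> edges G" "x \<in> J"
  shows "tl \<alpha> x \<in> J"
  using assms(2,3) rng_ideal.I_l_closed[OF assms(1)] by (induction \<alpha> arbitrary: x) auto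

text \<open>A ghost-free element of the ideal is stripped of leading edges until its degree zero
  part is nonzero; on a suitable \<open>D\<close> that part is a nonzero scalar.\<close>

theorem reduction:
  assumes J: "rng_ideal J Q" "J \<noteq> {\<zero>}"
  shows "(\<exists>w\<in>breaking_vertices G H - S. breaking w \<in> J) \<or>
    (\<exists>k D y. k \<noteq> 0 \<and> D \<in> gen_vertices G - H \<and> y \<in> aspan Q (trm {1..}) \<and> q k D \<oplus> y \<in> J)"
proof -
  interpret J: rng_ideal J Q by (rule J)
  obtain x where x: "x \<in> J" "x \<noteq> \<zero>" using J(2) J.zero_closed by blast
  then obtain n where "x \<in> aspan Q (mon {..n})" using mon_bounded carrier_span J.a_Hcarr by blast
  then consider (breaking) "\<exists>w\<in>breaking_vertices G H - S. breaking w \<in> J"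
    | (real) y where "y \<in> aspan Q (trm UNIV)" "y \<in> J" "y \<noteq> \<zero>"
    using ghost_reduce[OF J(1) _ x] by blast
  then show ?thesis
  proof cases
    case real
    have yc: "y \<in> carrier Q" using real J.a_Hcarr by blast
    obtain B where B: "B \<in> gen_vertices G" "y \<otimes> q 1 B = y" using right_unit[OF yc] by blast
    obtain n where "y \<in> aspan Q (trm {..n})" using trm_bounded[OF real(1)] by blast
    then obtain z r \<alpha> where zr: "z \<in> aspan Q (trm {0})" "r \<in> aspan Q (trm {1..})" "set \<alpha> \<subseteq> edges G"
        "z \<otimes> q 1 B \<noteq> \<zero>" and eq: "(z \<oplus> r) \<otimes> q 1 B = tl \<alpha> (y \<otimes> q 1 B)"
      using reduce_left[of y n "q 1 B"] B real(3) by auto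
    have zc: "z \<in> carrier Q" "r \<in> carrier Q" using zr aspan_closed[OF trm_closed] by auto
    obtain D k where D: "D \<in> gen_vertices G - H" "k \<noteq> 0" "D \<subseteq> B" "z \<otimes> q 1 D = q k D"
      using degree_zero_local[OF zr(1) B(1) zr(4)] by blast
    then have BD: "q 1 B \<otimes> q 1 D = q 1 D" using B by (simp add: q_mult Int_absorb1)
    have "q k D \<oplus> r \<otimes> q 1 D = (z \<oplus> r) \<otimes> (q 1 B \<otimes> q 1 D)"
      using D zc BD by (simp add: l_distr)
    also have "\<dots> = tl \<alpha> y \<otimes> q 1 D" using zc B D eq by (simp flip: m_assoc)
    also have "\<dots> \<in> J" using ideal_lghost[OF J(1) zr(3) real(2)] J.I_r_closed D by simp
    finally show ?thesis using D(1,2) pos_mult_q[OF zr(2), of D 1] by blast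
  qed simp
qed

end

section \<open>Sufficiency\<close>

lemma countable_gen_vertices:
  assumes "ultragraph G"
  shows "countable (gen_vertices G)"
proof -
  interpret ultragraph G by fact
  \<comment> \<open>\<open>stage n\<close> holds the sets obtained within \<open>n\<close> rounds of
    union, intersection and difference; every stage is countable.\<close>
  define stage where "stage = rec_nat ({{}} \<union> (\<lambda>v. {v}) ` vertices G \<union> erange G ` edges G)
    (\<lambda>_ T. T \<union> (\<lambda>(A, B). A \<union> B) ` (T \<times> T) \<union> (\<lambda>(A, B). A \<inter> B) ` (T \<times> T) \<union> (\<lambda>(A, B). A - B) ` (T \<times> T))"
  have S0: "stage 0 = {{}} \<union> (\<lambda>v. {v}) ` vertices G \<union> erange G ` edges G"
    and SS: "stage (Suc n) = stage n \<union> (\<lambda>(A, B). A \<union> B) ` (stage n \<times> stage n) \<union>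
      (\<lambda>(A, B). A \<inter> B) ` (stage n \<times> stage n) \<union> (\<lambda>(A, B). A - B) ` (stage n \<times> stage n)" for n
    by (simp_all add: stage_def)
  have stage_mono: "stage i \<subseteq> stage j" if "i \<le> j" for i j
    using that by (induction j rule: dec_induct) (auto simp: SS)
  have common: "\<exists>k. A \<in> stage k \<and> B \<in> stage k" if AB: "A \<in> (\<Union>n. stage n)" "B \<in> (\<Union>n. stage n)" for A B
  proof -
    obtain m n where "A \<in> stage m" "B \<in> stage n" using AB by auto
    then have "A \<in> stage (max m n)" "B \<in> stage (max m n)"
      using stage_mono[of m "max m n"] stage_mono[of n "max m n"] by auto
    then show ?thesis by blast
  qed
  have "countable (stage n)" for n
    by (induction n) (auto simp: S0 SS countable_vertices countable_edges)
  then have "countable (\<Union>n. stage n)" by auto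
  moreover have "gen_vertices G \<subseteq> (\<Union>n. stage n)"
  proof
    fix A assume "A \<in> gen_vertices G"
    then show "A \<in> (\<Union>n. stage n)"
    proof (induction rule: gen_vertices.induct)
      case empty
      then show ?case by (intro UN_I[of 0]) (auto simp: S0)
    next
      case (singleton v)
      then show ?case by (intro UN_I[of 0]) (auto simp: S0)
    next
      case (erange e)
      then show ?case by (intro UN_I[of 0]) (auto simp: S0)
    next
      case (union A B)
      then obtain k where "A \<in> stage k" "B \<in> stage k" using common by blast
      then show ?case by (intro UN_I[of "Suc k"]) (auto simp: SS)
    next
      case (inter A B)
      then obtain k where "A \<in> stage k" "B \<in> stage k" using common by blast
      then show ?case by (intro UN_I[of "Suc k"]) (auto simp: SS)
    next
      case (diff A B)
      then obtain k where "A \<in> stage k" "B \<in> stage k" using common by blast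
      then show ?case by (intro UN_I[of "Suc k"]) (auto simp: SS)
    qed
  qed
  ultimately show ?thesis by (rule countable_subset[rotated])
qed

lemma reach_take:
  "reach G A \<beta> \<noteq> {} \<Longrightarrow> i < length \<beta> \<Longrightarrow> reach G A (take (Suc i) \<beta>) = erange G (\<beta> ! i)"
proof (induction \<beta> arbitrary: A i)
  case (Cons e \<beta>)
  then show ?case by (cases i) (auto split: if_splits)
qed simp

text \<open>The cyclic successor from \<open>has_exit_outside\<close> read off linearly: it lies in
  the first round of the loop, or it is the first edge of the second round.\<close>

lemma nth_rotate_loop:
  assumes "i < length \<beta>"
  shows "(\<beta> @ take (Suc i) \<beta> @ \<gamma>) ! Suc i = \<beta> ! (Suc i mod length \<beta>)"
proof (cases "Suc i < length \<beta>")
  case False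
  then have "Suc i = length \<beta>" using assms by simp
  then show ?thesis using assms by (cases \<beta>) (simp_all add: nth_append)
qed (simp add: nth_append)

section \<open>Conjugation by paths and the removal of terms of positive degree\<close>

context leavitt_quotient
begin

text \<open>\<open>s_\<mu>^* s_\<beta> s_\<mu>\<close> survives only if \<open>\<mu>\<close> is a
  prefix of \<open>\<beta> \<mu>\<close>, and then it is a path \<open>\<delta>\<close> as long as
  \<open>\<beta>\<close>. The equation \<open>\<beta> @ \<mu> = \<mu> @ \<delta>\<close> is recorded
  because exits are exploited through it.\<close>

lemma shift_term:
  assumes "set \<mu> \<subseteq> edges G" "set \<beta> \<subseteq> edges G" "A \<in> gen_vertices G" "E \<in> gen_vertices G" "x \<in> carrier Q"
  shows "tl \<mu> (sl \<beta> (q l A) \<otimes> sl \<mu> (q 1 E \<otimes> x)) = \<zero> \<or>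
    (\<exists>\<delta>. \<beta> @ \<mu> = \<mu> @ \<delta> \<and> (\<exists>C\<in>gen_vertices G. C \<subseteq> E \<and>
      tl \<mu> (sl \<beta> (q l A) \<otimes> sl \<mu> (q 1 E \<otimes> x)) = sl \<delta> (q l C \<otimes> x)))"
proof -
  have R: "reach G A \<mu> \<in> gen_vertices G" using assms by (simp add: reach_gen)
  have "q l A \<otimes> sl \<mu> (q 1 E \<otimes> x) = sl \<mu> (q l (reach G A \<mu> \<inter> E) \<otimes> x)"
    using assms R by (simp add: q_lpath q_mult m_closed flip: m_assoc)
  then have *: "sl \<beta> (q l A) \<otimes> sl \<mu> (q 1 E \<otimes> x) = sl (\<beta> @ \<mu>) (q l (reach G A \<mu> \<inter> E) \<otimes> x)"
    using assms by (simp add: lpath_mult lpath_append m_closed)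
  show ?thesis
  proof (cases "take (length \<mu>) (\<beta> @ \<mu>) = \<mu>")
    case False
    then show ?thesis
      using assms R * lghost_lpath_mismatch[of \<mu> "\<beta> @ \<mu>"] by (simp add: m_closed)
  next
    case True
    then obtain \<delta> where \<delta>: "\<beta> @ \<mu> = \<mu> @ \<delta>" by (metis append_take_drop_id)
    let ?C = "reach G A \<mu> \<inter> E \<inter> reach G UNIV (\<mu> @ \<delta>)"
    have \<delta>e: "set (\<mu> @ \<delta>) \<subseteq> edges G" using assms \<delta> by (metis set_append Un_subset_iff)
    have C: "?C \<in> gen_vertices G"
    proof (cases "\<mu> @ \<delta>")
      case (Cons e \<gamma>)
      then show ?thesis using \<delta>e R assms by (auto intro!: gen_vertices.inter reach_gen)
    qed (use R assms in auto)
    have "tl \<mu> (sl (\<mu> @ \<delta>) (q l (reach G A \<mu> \<inter> E) \<otimes> x)) = sl \<delta> (q l ?C \<otimes> x)"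
      using assms R \<delta>e by (intro lghost_lpath_prefix) auto
    then show ?thesis using * \<delta> C by (intro disjI2 exI[of _ \<delta>] conjI bexI[of _ ?C]) auto
  qed
qed

lemma length_shift: "\<beta> @ \<mu> = \<mu> @ \<delta> \<Longrightarrow> length \<delta> = length \<beta>"
  by (metis add.commute add_left_cancel length_append)

lemma set_shift: "\<beta> @ \<mu> = \<mu> @ \<delta> \<Longrightarrow> set \<mu> \<union> set \<beta> \<subseteq> E \<Longrightarrow> set \<delta> \<subseteq> E"
  by (metis le_sup_iff set_append)

lemma shift_head:
  assumes "set \<mu> \<subseteq> edges G" "D \<in> gen_vertices G" "E \<in> gen_vertices G" "E \<subseteq> reach G D \<mu>" "x \<in> carrier Q"
  shows "tl \<mu> (q k D \<otimes> sl \<mu> (q 1 E \<otimes> x)) = q k E \<otimes> x"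
proof -
  have R: "reach G D \<mu> \<in> gen_vertices G" using assms by (simp add: reach_gen)
  have "q k D \<otimes> sl \<mu> (q 1 E \<otimes> x) = sl \<mu> (q k (reach G D \<mu> \<inter> E) \<otimes> x)"
    using assms R by (simp add: q_lpath q_mult m_closed flip: m_assoc)
  moreover have "reach G D \<mu> \<inter> E = E" "E \<inter> reach G UNIV \<mu> = E"
    using assms reach_mono[of D UNIV G \<mu>] by auto
  ultimately show ?thesis using lghost_lpath[of E \<mu> x k] assms by simp
qed

text \<open>\<open>p_C = s_\<gamma>^* p_A s_\<gamma> p_C\<close> whenever
  \<open>C \<subseteq> reach G A \<gamma>\<close>.\<close>

lemma connect_mem:
  assumes J: "rng_ideal J Q" "q 1 A \<in> J" and "A \<in> gen_vertices G" "C \<in> gen_vertices G"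
    "set \<gamma> \<subseteq> edges G" "C \<subseteq> reach G A \<gamma>"
  shows "q 1 C \<in> J"
proof -
  have "tl \<gamma> (q 1 A \<otimes> sl \<gamma> (q 1 C \<otimes> q 1 C)) \<in> J"
    using assms by (intro ideal_lghost rng_ideal.I_r_closed[OF J(1)]) (auto intro!: lpath_closed m_closed)
  then show ?thesis using shift_head[of \<gamma> A C "q 1 C" 1] assms by (simp add: q_mult)
qed

text \<open>Conjugate by a path from \<open>D\<close> to \<open>w\<close> and multiply by
  \<open>p_w^H\<close> on both sides. The head becomes \<open>k p_w^H\<close>; conjugation keeps
  positive lengths positive, and \<open>p_w^H\<close> kills these terms.\<close>

lemma connect_breaking_mem:
  assumes J: "rng_ideal J Q" and w: "w \<in> breaking_vertices G H - S"
    and "k \<noteq> 0" "D \<in> gen_vertices G" "y \<in> aspan Q (trm {1..})" and mem: "q k D \<oplus> y \<in> J"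
    and con: "connects G D {w}"
  shows "breaking w \<in> J"
proof -
  obtain \<alpha> where \<alpha>: "set \<alpha> \<subseteq> edges G" "{w} \<subseteq> reach G D \<alpha>" using con by (auto simp: connects_iff_reach)
  have bw: "w \<in> breaking_vertices G H" and wv: "{w} \<in> gen_vertices G" using w breaking_vertex by auto
  have b: "breaking w \<in> carrier Q" using bw by simp
  have yc: "y \<in> carrier Q" using aspan_closed[OF trm_closed assms(5)] .
  define F where "F x = breaking w \<otimes> tl \<alpha> (x \<otimes> sl \<alpha> (q 1 {w} \<otimes> breaking w))" for x
  have Fadd: "F (x \<oplus> z) = F x \<oplus> F z" if "x \<in> carrier Q" "z \<in> carrier Q" for x z
    using that \<alpha> b wv by (simp add: F_def l_distr r_distr lghost_add m_closed)
  have F0: "F \<zero> = \<zero>" using \<alpha> b wv by (simp add: F_def m_closed)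
  have "F (q k D) = breaking w \<otimes> (q k {w} \<otimes> breaking w)"
    using shift_head[OF \<alpha>(1) assms(4) wv \<alpha>(2) b] by (simp add: F_def)
  moreover have "F y = \<zero>"
    using assms(5) trm_closed
  proof (induction rule: aspan_induct)
    case (add a x)
    then obtain e \<gamma> l A where a: "a = sl (e # \<gamma>) (q l A)" "e \<in> edges G" "set \<gamma> \<subseteq> edges G" "A \<in> gen_vertices G"
      unfolding trm_Suc_iff lpath.simps by blast
    have e\<gamma>: "set (e # \<gamma>) \<subseteq> edges G" using a by simp
    have "F a = \<zero>"
      using shift_term[OF \<alpha>(1) e\<gamma> a(4) wv b, of l]
    proof (elim disjE exE conjE bexE)
      assume "tl \<alpha> (sl (e # \<gamma>) (q l A) \<otimes> sl \<alpha> (q 1 {w} \<otimes> breaking w)) = \<zero>"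
      then show ?thesis unfolding F_def a(1) using b by simp
    next
      fix \<delta> C assume \<delta>: "(e # \<gamma>) @ \<alpha> = \<alpha> @ \<delta>" "C \<in> gen_vertices G"
        "tl \<alpha> (sl (e # \<gamma>) (q l A) \<otimes> sl \<alpha> (q 1 {w} \<otimes> breaking w)) = sl \<delta> (q l C \<otimes> breaking w)"
      have "\<delta> \<noteq> []" using length_shift[OF \<delta>(1)] by auto
      moreover have "set \<delta> \<subseteq> edges G" using set_shift[OF \<delta>(1)] a \<alpha> by auto
      ultimately show ?thesis unfolding F_def a(1) \<delta>(3) using b \<delta>(2) bw by (intro breaking_lpath) (auto intro: m_closed)
    qed
    moreover have "a \<in> carrier Q" using add(1) trm_closed by blast
    ultimately show ?case using add Fadd by simp
  qed (rule F0)
  moreover have "F (q k D \<oplus> y) \<in> J"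
    unfolding F_def using \<alpha> b wv mem
    by (intro rng_ideal.I_l_closed[OF J] ideal_lghost[OF J] rng_ideal.I_r_closed[OF J]) (auto intro!: lpath_closed m_closed)
  ultimately have "breaking w \<otimes> (q k {w} \<otimes> breaking w) \<in> J"
    using Fadd[of "q k D" y] assms(4) yc b wv by (simp add: m_closed)
  then show ?thesis using breaking_scale_mem[OF J bw assms(3)] by blast
qed

text \<open>An element with the fewest terms of positive degree has none: cutting down with projections shows
  that such a term comes from a loop, and an exit of the loop removes the term.\<close>

lemma projection_mem:
  assumes J: "rng_ideal J Q" and exits: "\<And>p. loop_outside G H p \<Longrightarrow> has_exit_outside G H p"
    and ex: "k0 \<noteq> 0" "D0 \<in> gen_vertices G - H" "y0 \<in> aspan Q (trm {1..})" "q k0 D0 \<oplus> y0 \<in> J"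
  shows "\<exists>D\<in>gen_vertices G - H. q 1 D \<in> J"
proof -
  interpret J: rng_ideal J Q by (rule J)
  \<comment> \<open>\<open>n\<close> bounds the number of terms of positive degree; for
    \<open>n = 0\<close> only a multiple of a projection is left.\<close>
  define P where "P n \<longleftrightarrow> (\<exists>k D y. k \<noteq> 0 \<and> D \<in> gen_vertices G - H \<and> y \<in> nspan Q (trm {1..}) n \<and>
    q k D \<oplus> y \<in> J)" for n
  have "\<exists>n. P n" using ex unfolding P_def aspan_def by blast
  then obtain n where "P n" and least: "\<And>m. m < n \<Longrightarrow> \<not> P m"
    using exists_least_iff[of P] by blast
  then obtain k D y where k: "k \<noteq> 0" and D: "D \<in> gen_vertices G - H" and y: "y \<in> nspan Q (trm {1..}) n"
    and mem: "q k D \<oplus> y \<in> J" unfolding P_def by blast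
  show ?thesis
  proof (cases n)
    case 0
    then have "q k D \<in> J" using mem y D by simp
    then have "q (1 / k) D \<otimes> q k D \<in> J" using J.I_l_closed D by simp
    then show ?thesis using D k by (auto simp: q_mult)
  next
    case (Suc m)
    then obtain a y' where y': "y = a \<oplus> y'" "a \<in> insert \<zero> (trm {1..})" "y' \<in> nspan Q (trm {1..}) m"
      using y by auto
    have y'c: "y' \<in> carrier Q" using nspan_closed[OF trm_closed y'(3)] .
    \<comment> \<open>By minimality, no additive map that preserves the ideal and the shape of the
      terms can send the head to \<open>q k E\<close> with \<open>E\<close> outside \<open>H\<close>
      and also kill the term \<open>a\<close>.\<close>
    have contra: False if F: "\<And>x z. x \<in> carrier Q \<Longrightarrow> z \<in> carrier Q \<Longrightarrow> F (x \<oplus> z) = F x \<oplus> F z"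
      "F \<zero> = \<zero>" "\<And>x. x \<in> J \<Longrightarrow> F x \<in> J" "\<And>b. b \<in> trm {1..} \<Longrightarrow> F b \<in> insert \<zero> (trm {1..})"
      "F a = \<zero>" "F (q k D) = q k E" "E \<in> gen_vertices G - H" for F E
    proof -
      have "a \<in> carrier Q" using y'(2) trm_closed by auto
      then have "F (q k D \<oplus> y) = q k E \<oplus> (\<zero> \<oplus> F y')" using F(1,5,6) D y'c y'(1) by simp
      moreover have Fy': "F y' \<in> nspan Q (trm {1..}) m"
        using nspan_map[OF trm_closed y'(3) F(2,1,4)] by blast
      ultimately have "q k E \<oplus> F y' \<in> J" 
        using F(3)[OF mem] nspan_closed[OF trm_closed Fy'] by simp
      then have "P m" using k F(7) Fy' unfolding P_def by blast
      then show False using least[of m] Suc by simp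
    qed
    have "a \<noteq> \<zero>"
    proof
      assume "a = \<zero>"
      then have "P m" using y' y'c mem k D unfolding P_def by auto
      then show False using least[of m] Suc by simp
    qed
    then have "a \<in> trm {1..}" using y' by simp
    then obtain \<beta> l A where a: "a = sl \<beta> (q l A)" "set \<beta> \<subseteq> edges G" "1 \<le> length \<beta>" "A \<in> gen_vertices G"
      by (auto simp: trm_def)
    have \<beta>ne: "\<beta> \<noteq> []" using a by auto
    define v where "v = source G (hd \<beta>)"
    have vv: "v \<in> vertices G" using a \<beta>ne source_closed unfolding v_def by (cases \<beta>) auto
    \<comment> \<open>Compressing with \<open>E\<close> replaces the set of the term by
      \<open>reach G E \<beta> \<inter> A \<inter> E\<close>, which therefore has to stay outside
      \<open>H\<close>.\<close>
    have cut: "reach G E \<beta> \<inter> A \<inter> E \<notin> H" if E: "E \<in> gen_vertices G - H" "E \<subseteq> D" for E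
    proof
      assume inH: "reach G E \<beta> \<inter> A \<inter> E \<in> H"
      define F where "F x = q 1 E \<otimes> (x \<otimes> q 1 E)" for x
      have Fb: "F (sl \<alpha> (q l B)) = sl \<alpha> (q l (reach G E \<alpha> \<inter> B \<inter> E))"
        if "set \<alpha> \<subseteq> edges G" "B \<in> gen_vertices G" for \<alpha> B l
        using that E by (simp add: F_def lpath_mult q_mult q_lpath reach_gen Int_assoc)
      show False
      proof (rule contra[of F E])
        show "F b \<in> insert \<zero> (trm {1..})" if b1: "b \<in> trm {1..}" for b
        proof -
          obtain \<alpha> l B where "b = sl \<alpha> (q l B)" "set \<alpha> \<subseteq> edges G" "length \<alpha> \<in> {1..}" "B \<in> gen_vertices G"
            using b1 by (auto simp: trm_def)
          then show ?thesis using Fb E by (auto intro!: trmI reach_gen)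
        qed
        show "F a = \<zero>" using Fb[OF a(2,4)] inH a q_null by simp
        have "E \<inter> (D \<inter> E) = E" using E by auto
        then show "F (q k D) = q k E" using E D by (simp add: F_def q_mult)
      qed (use E in \<open>auto simp: F_def l_distr r_distr m_closed J.I_l_closed J.I_r_closed\<close>)
    qed
    have R: "reach G D \<beta> \<inter> A \<inter> D \<notin> H" using cut[of D] D by simp
    then have RD: "reach G D \<beta> \<noteq> {}" by auto
    have vD: "v \<in> D" using RD \<beta>ne unfolding v_def by (cases \<beta>) (auto split: if_splits)
    \<comment> \<open>Since \<open>\<beta>\<close> starts at \<open>v\<close>, compressing with
      \<open>D - {v}\<close> would kill the term; so \<open>D - {v}\<close> cannot be outside
      \<open>H\<close>.\<close>
    have "reach G (D - {v}) \<beta> = {}" using \<beta>ne unfolding v_def by (cases \<beta>) auto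
    then have Dv: "D - {v} \<in> H" using cut[of "D - {v}"] D vv by auto
    have vH: "{v} \<notin> H"
    proof
      assume "{v} \<in> H"
      then have "(D - {v}) \<union> {v} \<in> H" using Dv H_union by blast
      then show False using D vD by (simp add: insert_absorb)
    qed
    \<comment> \<open>Up to \<open>H\<close> the set \<open>D\<close> is just \<open>{v}\<close>, so
      what survives must contain \<open>v\<close>, and \<open>\<beta>\<close> returns to its
      source.\<close>
    have "v \<in> reach G D \<beta>"
    proof (rule ccontr)
      assume "v \<notin> reach G D \<beta>"
      then have "reach G D \<beta> \<inter> A \<inter> D \<subseteq> D - {v}" by auto
      then show False using R H_subset[OF Dv] D a by (auto simp: reach_gen)
    qed
    then have loop: "is_loop G \<beta>" and range: "v \<in> path_range G \<beta>"
      using reach_path[OF a(2) \<beta>ne RD] by (auto simp: is_loop_def v_def path_source_def)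
    have pr: "path_range G \<beta> \<in> gen_vertices G"
      using a \<beta>ne by (auto simp: path_range_def intro!: gen_vertices.erange)
    have "path_range G \<beta> \<notin> H" using H_subset[of "path_range G \<beta>" "{v}"] vH vv range by auto
    then have exit: "has_exit_outside G H \<beta>" using exits loop pr by (simp add: loop_outside_def)
    \<comment> \<open>Conjugation by \<open>\<mu>\<close> kills \<open>a\<close> as soon as
      \<open>p_E\<close> annihilates every path \<open>\<delta>\<close> with
      \<open>\<beta> @ \<mu> = \<mu> @ \<delta>\<close>.\<close>
    have shift: False if \<mu>: "set \<mu> \<subseteq> edges G" "E \<in> gen_vertices G - H" "E \<subseteq> reach G D \<mu>"
      and kill: "\<And>\<delta> C. \<beta> @ \<mu> = \<mu> @ \<delta> \<Longrightarrow> C \<in> gen_vertices G \<Longrightarrow> q 1 E \<otimes> sl \<delta> (q l C) = \<zero>" for \<mu> E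
    proof -
      have Ec: "E \<in> gen_vertices G" using \<mu> by simp
      define F where "F x = q 1 E \<otimes> tl \<mu> (x \<otimes> sl \<mu> (q 1 E \<otimes> q 1 E))" for x
      have trm_F: "F (sl \<alpha> (q i B)) = \<zero> \<or> (\<exists>\<delta>. \<alpha> @ \<mu> = \<mu> @ \<delta> \<and> (\<exists>C\<in>gen_vertices G. C \<subseteq> E \<and>
          F (sl \<alpha> (q i B)) = q 1 E \<otimes> sl \<delta> (q i C)))"
        if \<alpha>: "set \<alpha> \<subseteq> edges G" "B \<in> gen_vertices G" for \<alpha> B i
        using shift_term[OF \<mu>(1) \<alpha> Ec q_closed[OF Ec, of 1], of i]
      proof (elim disjE exE conjE bexE)
        assume "tl \<mu> (sl \<alpha> (q i B) \<otimes> sl \<mu> (q 1 E \<otimes> q 1 E)) = \<zero>"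
        then show ?thesis unfolding F_def using Ec by simp
      next
        fix \<delta> C assume \<delta>: "\<alpha> @ \<mu> = \<mu> @ \<delta>" "C \<in> gen_vertices G" "C \<subseteq> E"
          "tl \<mu> (sl \<alpha> (q i B) \<otimes> sl \<mu> (q 1 E \<otimes> q 1 E)) = sl \<delta> (q i C \<otimes> q 1 E)"
        have "F (sl \<alpha> (q i B)) = q 1 E \<otimes> sl \<delta> (q i C)"
          unfolding F_def \<delta>(4) using \<delta> Ec by (simp add: q_mult Int_absorb2)
        then show ?thesis using \<delta> by blast
      qed
      show False
      proof (rule contra[of F E])
        show "F b \<in> insert \<zero> (trm {1..})" if b1: "b \<in> trm {1..}" for b
        proof -
          obtain \<alpha> i B where b: "b = sl \<alpha> (q i B)" "set \<alpha> \<subseteq> edges G" "1 \<le> length \<alpha>" "B \<in> gen_vertices G"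
            using b1 by (auto simp: trm_def)
          show ?thesis
            using trm_F[OF b(2,4), of i]
          proof (elim disjE exE conjE bexE)
            fix \<delta> C assume \<delta>: "\<alpha> @ \<mu> = \<mu> @ \<delta>" "C \<in> gen_vertices G" "C \<subseteq> E" "F (sl \<alpha> (q i B)) = q 1 E \<otimes> sl \<delta> (q i C)"
            have "length \<delta> \<in> {1..}" using length_shift[OF \<delta>(1)] b by simp
            moreover have "set \<delta> \<subseteq> edges G" using set_shift[OF \<delta>(1)] b \<mu> by auto
            ultimately show ?thesis unfolding b(1) \<delta>(4) using \<delta> Ec
              by (auto simp: q_lpath q_mult reach_gen intro!: trmI)
          qed (use b in auto)
        qed
        show "F a = \<zero>" using trm_F[OF a(2,4), of l] kill a(1) by auto
        show "F (q k D) = q k E" using shift_head[OF \<mu>(1) _ Ec \<mu>(3) q_closed[OF Ec, of 1], of k] D Ec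
          by (simp add: F_def q_mult)
      qed (use \<mu> in \<open>auto simp: F_def l_distr r_distr lghost_add m_closed J.I_l_closed J.I_r_closed
          ideal_lghost[OF J]\<close>)
    qed
    from exit show ?thesis
      unfolding has_exit_outside_def
    proof (elim disjE exE conjE bexE)
      fix i assume i: "i < length \<beta>"
        and E: "erange G (\<beta> ! i) - {source G (\<beta> ! (Suc i mod length \<beta>))} \<in> gen_vertices G - H"
      \<comment> \<open>Follow the loop through its edge number \<open>i\<close> and keep only the
        vertices other than the next source; \<open>\<delta>\<close> begins with the next edge of
        the loop, which does not start there.\<close>
      let ?\<mu> = "take (Suc i) \<beta>" and ?E = "erange G (\<beta> ! i) - {source G (\<beta> ! (Suc i mod length \<beta>))}"
      have False
      proof (rule shift[of ?\<mu> ?E])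
        show "set ?\<mu> \<subseteq> edges G" using a set_take_subset by fast
        show "?E \<subseteq> reach G D ?\<mu>" using reach_take[OF RD i] by auto
        fix \<delta> C assume \<delta>: "\<beta> @ ?\<mu> = ?\<mu> @ \<delta>" and C: "C \<in> gen_vertices G"
        obtain f \<gamma> where f: "\<delta> = f # \<gamma>" using length_shift[OF \<delta>] \<beta>ne by (cases \<delta>) auto
        have "f = (\<beta> @ ?\<mu> @ []) ! Suc i" using f i by (simp add: \<delta> nth_append)
        then have "source G f \<notin> ?E" using nth_rotate_loop[OF i, of "[]"] by simp
        then have "reach G ?E \<delta> = {}" unfolding f by auto
        moreover have "set \<delta> \<subseteq> edges G" using set_shift[OF \<delta>, of "edges G"] a set_take_subset by fast
        ultimately show "q 1 ?E \<otimes> sl \<delta> (q l C) = \<zero>" using E C q_lpath[of ?E \<delta> "q l C" 1] by simp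
      qed (rule E)
      then show ?thesis ..
    next
      fix f i assume f: "f \<in> edges G" and i: "i < length \<beta>" and E: "erange G f \<in> gen_vertices G - H"
        and src: "source G f \<in> erange G (\<beta> ! i)" and neq: "f \<noteq> \<beta> ! (Suc i mod length \<beta>)"
      \<comment> \<open>Follow the loop and leave it along \<open>f\<close>; then
        \<open>\<beta> @ \<mu> = \<mu> @ \<delta>\<close> fails at position
        \<open>Suc i\<close>.\<close>
      let ?\<mu> = "take (Suc i) \<beta> @ [f]"
      have \<mu>: "set ?\<mu> \<subseteq> edges G" using a f set_take_subset[of "Suc i" \<beta>] by auto
      have False
      proof (rule shift[of ?\<mu> "erange G f"])
        show "erange G f \<subseteq> reach G D ?\<mu>" using reach_take[OF RD i] src by (simp add: reach_append)
        fix \<delta> C assume \<delta>: "\<beta> @ ?\<mu> = ?\<mu> @ \<delta>"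
        have "(?\<mu> @ \<delta>) ! Suc i = f" using i by (simp add: nth_append)
        moreover have "(\<beta> @ ?\<mu>) ! Suc i = \<beta> ! (Suc i mod length \<beta>)" using nth_rotate_loop[OF i, of "[f]"] by simp
        ultimately have False using neq unfolding \<delta> by simp
        then show "q 1 (erange G f) \<otimes> sl \<delta> (q l C) = \<zero>" ..
      qed (rule \<mu>, rule E)
      then show ?thesis ..
    qed
  qed
qed

section \<open>Primitivity in the two cases\<close>

lemma sufficient_breaking:
  assumes w: "w \<in> breaking_vertices G H" "S = breaking_vertices G H - {w}"
    and con: "\<And>A. A \<in> gen_vertices G - H \<Longrightarrow> connects G A {w}"
  shows "left_primitive Q"
proof (rule left_primitive_criterion[where e = "\<lambda>_. breaking w"])
  have wS: "w \<in> breaking_vertices G H - S" using w by auto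
  show "breaking w \<noteq> \<zero>" using breaking_nonzero[OF wS] by (simp add: breaking_def inner_edges_def)
  fix J assume "rng_ideal J Q" "J \<noteq> {\<zero>}"
  from reduction[OF this] show "\<exists>n::nat. breaking w \<in> J"
  proof (elim disjE bexE exE conjE)
    fix w' assume "w' \<in> breaking_vertices G H - S" "breaking w' \<in> J"
    then show ?thesis using w by auto
  next
    fix k D y assume "k \<noteq> 0" "D \<in> gen_vertices G - H" "y \<in> aspan Q (trm {1..})" "q k D \<oplus> y \<in> J"
    then have "breaking w \<in> J"
      using connect_breaking_mem[OF \<open>rng_ideal J Q\<close> wS] con by blast
    then show ?thesis by blast
  qed
qed (use w rng_axioms in auto)

definition path_idem :: "'e list \<times> 'v set \<Rightarrow> 'q" where
  "path_idem = (\<lambda>(\<kappa>, C). sl \<kappa> (tr \<kappa> (q 1 C)))"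

text \<open>\<open>C \<subseteq> reach G UNIV \<kappa>\<close> makes
  \<open>s_\<kappa>^* s_\<kappa>\<close> fix \<open>p_C\<close>, so that \<open>path_idem\<close> is
  idempotent and, as \<open>C\<close> is outside \<open>H\<close>, nonzero.\<close>

definition good_pair :: "'e list \<times> 'v set \<Rightarrow> bool" where
  "good_pair = (\<lambda>(\<kappa>, C). set \<kappa> \<subseteq> edges G \<and> C \<in> gen_vertices G - H \<and> C \<subseteq> reach G UNIV \<kappa>)"

lemma path_idem_closed: "good_pair x \<Longrightarrow> path_idem x \<in> carrier Q"
  by (auto simp: path_idem_def good_pair_def)

text \<open>Prolonging the path and shrinking the set gives a smaller idempotent: the inner
  \<open>s_\<kappa>^*\<close> cancels the prefix, and
  \<open>p_C s_\<alpha> p_{C'} = s_\<alpha> p_{C'}\<close>.\<close>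

lemma path_idem_mult:
  assumes "good_pair (\<kappa>, C)" "good_pair (\<kappa> @ \<alpha>, C')" "C' \<subseteq> reach G C \<alpha>"
  shows "path_idem (\<kappa>, C) \<otimes> path_idem (\<kappa> @ \<alpha>, C') = path_idem (\<kappa> @ \<alpha>, C')"
proof -
  have g: "set \<kappa> \<subseteq> edges G" "set \<alpha> \<subseteq> edges G" "C \<in> gen_vertices G" "C' \<in> gen_vertices G"
    "C' \<subseteq> reach G UNIV (\<kappa> @ \<alpha>)" using assms by (auto simp: good_pair_def)
  define w where "w = tr (\<kappa> @ \<alpha>) (q 1 C')"
  have w: "w \<in> carrier Q" "q 1 C' \<otimes> w = w" using g by (simp_all add: w_def rpath_mult q_mult)
  have R: "reach G C \<alpha> \<in> gen_vertices G" using g by (simp add: reach_gen)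
  have "path_idem (\<kappa>, C) \<otimes> path_idem (\<kappa> @ \<alpha>, C') = sl \<kappa> (q 1 C \<otimes> tl \<kappa> (sl (\<kappa> @ \<alpha>) (q 1 C' \<otimes> w)))"
    using g w by (simp add: path_idem_def lpath_mult rpath_adjoint w_def)
  also have "tl \<kappa> (sl (\<kappa> @ \<alpha>) (q 1 C' \<otimes> w)) = sl \<alpha> (q 1 C' \<otimes> w)"
    using lghost_lpath_prefix[of C' \<kappa> \<alpha> w 1] g w by (simp add: Int_absorb2)
  also have "q 1 C \<otimes> sl \<alpha> (q 1 C' \<otimes> w) = sl \<alpha> ((q 1 (reach G C \<alpha>) \<otimes> q 1 C') \<otimes> w)"
    using g w R by (simp add: q_lpath m_closed m_assoc)
  also have "q 1 (reach G C \<alpha>) \<otimes> q 1 C' = q 1 C'" using R g assms(3) by (simp add: q_mult Int_absorb1)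
  finally show ?thesis using w by (simp add: path_idem_def w_def lpath_append)
qed

text \<open>Edges and ghosts stand on different sides of \<open>p_C\<close>, so they may be attached
  in either order and the idempotent is self-dual.\<close>

lemma op_path_idem: "good_pair x \<Longrightarrow> leavitt_quotient.path_idem (rng_op Q) q t s x = path_idem x"
  using leavitt_quotient.path_idem_def[OF op] lpath_rpath by (auto simp: path_idem_def good_pair_def)

lemma path_idem_mult':
  assumes "good_pair (\<kappa>, C)" "good_pair (\<kappa> @ \<alpha>, C')" "C' \<subseteq> reach G C \<alpha>"
  shows "path_idem (\<kappa> @ \<alpha>, C') \<otimes> path_idem (\<kappa>, C) = path_idem (\<kappa> @ \<alpha>, C')"
  using leavitt_quotient.path_idem_mult[OF op assms] op_path_idem[OF assms(1)] op_path_idem[OF assms(2)] by simp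

lemma path_idem_nonzero:
  assumes "good_pair (\<kappa>, C)" shows "path_idem (\<kappa>, C) \<noteq> \<zero>"
proof
  have g: "set \<kappa> \<subseteq> edges G" "C \<in> gen_vertices G - H" "C \<subseteq> reach G UNIV \<kappa>" 
    using assms by (auto simp: good_pair_def)
  assume "path_idem (\<kappa>, C) = \<zero>"
  then have "tl \<kappa> (path_idem (\<kappa>, C) \<otimes> sl \<kappa> (q 1 C \<otimes> q 1 C)) = \<zero>" using g by (simp add: m_closed)
  moreover have "tl \<kappa> (sl \<kappa> (q 1 C)) = q 1 C"
    using lghost_lpath[of C \<kappa> "q 1 C" 1] g by (simp add: Int_absorb2 q_mult)
  ultimately have "q 1 C = \<zero>"
    using g by (simp add: path_idem_def lpath_mult rpath_adjoint q_mult m_closed)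
  then show False using q_nonzero[of C 1] g by simp
qed

lemma path_idem_mem:
  assumes "rng_ideal J Q" "good_pair (\<kappa>, C)" "q 1 C \<in> J"
  shows "path_idem (\<kappa>, C) \<in> J"
proof -
  have tr: "tr \<alpha> x \<in> J" if "set \<alpha> \<subseteq> edges G" "x \<in> J" for \<alpha> x
    using that rng_ideal.I_r_closed[OF assms(1)] by (induction \<alpha>) auto
  have sl: "sl \<alpha> x \<in> J" if "set \<alpha> \<subseteq> edges G" "x \<in> J" for \<alpha> x
    using that rng_ideal.I_l_closed[OF assms(1)] by (induction \<alpha>) auto
  show ?thesis using assms tr sl by (simp add: path_idem_def good_pair_def)
qed

lemma sufficient_directed:
  assumes S: "S = breaking_vertices G H" and dir: "downward_directed G (gen_vertices G - H)"
    and exits: "\<And>p. loop_outside G H p \<Longrightarrow> has_exit_outside G H p"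
  shows "left_primitive Q"
proof -
  define A where "A = from_nat_into (gen_vertices G - H)"
  have ne: "gen_vertices G - H \<noteq> {}" using dir by (simp add: downward_directed_def)
  have cnt: "countable (gen_vertices G - H)" using countable_gen_vertices[OF ultragraph_axioms] by simp
  have A: "A n \<in> gen_vertices G - H" for n unfolding A_def by (rule from_nat_into[OF ne])
  have A_surj: "\<exists>n. A n = D" if "D \<in> gen_vertices G - H" for D
    unfolding A_def using from_nat_into_surj[OF cnt that] by blast
  \<comment> \<open>Each step prolongs the path, so the idempotents decrease, and makes the new set
    reachable from \<open>A n\<close>. Hence an ideal containing the projection of
    \<open>A n\<close> contains the idempotent with index \<open>Suc n\<close>.\<close>
  define R where "R n x y \<longleftrightarrow> (\<exists>\<alpha>. fst y = fst x @ \<alpha> \<and> snd y \<subseteq> reach G (snd x) \<alpha>) \<and>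
    (\<exists>\<gamma>. set \<gamma> \<subseteq> edges G \<and> snd y \<subseteq> reach G (A n) \<gamma>)" for n :: nat and x y :: "'e list \<times> 'v set"
  have "\<exists>f. \<forall>n. good_pair (f n) \<and> R n (f n) (f (Suc n))"
  proof (rule dependent_nat_choice)
    show "\<exists>x. good_pair x" using A[of 0] by (intro exI[of _ "([], A 0)"]) (simp add: good_pair_def)
    fix x n assume x: "good_pair x"
    obtain \<kappa> C where xc: "x = (\<kappa>, C)" by (cases x)
    then have g: "set \<kappa> \<subseteq> edges G" "C \<in> gen_vertices G - H" "C \<subseteq> reach G UNIV \<kappa>"
      using x by (auto simp: good_pair_def)
    obtain C' where C': "C' \<in> gen_vertices G - H" "C' \<noteq> {}" "connects G C C'" "connects G (A n) C'"
      using dir g(2) A[of n] unfolding downward_directed_def by blast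
    obtain \<alpha> where \<alpha>: "set \<alpha> \<subseteq> edges G" "C' \<subseteq> reach G C \<alpha>" using C' connects_iff_reach by metis
    obtain \<gamma> where \<gamma>: "set \<gamma> \<subseteq> edges G" "C' \<subseteq> reach G (A n) \<gamma>" using C' connects_iff_reach by metis
    have "good_pair (\<kappa> @ \<alpha>, C')"
      using g \<alpha> C' reach_mono[OF g(3), of G \<alpha>] by (auto simp: good_pair_def reach_append)
    then show "\<exists>y. good_pair y \<and> R n x y" using \<alpha> \<gamma> xc by (auto simp: R_def)
  qed
  then obtain f where f: "\<And>n. good_pair (f n)" "\<And>n. R n (f n) (f (Suc n))" by blast
  show ?thesis
  proof (rule left_primitive_criterion[where e = "\<lambda>n. path_idem (f n)"])
    fix n
    show "path_idem (f n) \<in> carrier Q" using f path_idem_closed by blast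
    show "path_idem (f n) \<noteq> \<zero>" using f(1)[of n] path_idem_nonzero by (cases "f n") auto
    show "path_idem (f n) \<otimes> path_idem (f n) = path_idem (f n)"
      using f(1)[of n] path_idem_mult[of "fst (f n)" "snd (f n)" "[]" "snd (f n)"] by simp
    obtain \<alpha> where \<alpha>: "f (Suc n) = (fst (f n) @ \<alpha>, snd (f (Suc n)))" "snd (f (Suc n)) \<subseteq> reach G (snd (f n)) \<alpha>"
      using f(2)[of n] unfolding R_def by (metis prod.collapse)
    show "path_idem (f n) \<otimes> path_idem (f (Suc n)) = path_idem (f (Suc n))"
      using path_idem_mult[of "fst (f n)" "snd (f n)" \<alpha> "snd (f (Suc n))"] \<alpha> f(1)[of n] f(1)[of "Suc n"] by simp
    show "path_idem (f (Suc n)) \<otimes> path_idem (f n) = path_idem (f (Suc n))"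
      using path_idem_mult'[of "fst (f n)" "snd (f n)" \<alpha> "snd (f (Suc n))"] \<alpha> f(1)[of n] f(1)[of "Suc n"] by simp
  next
    fix J assume J: "rng_ideal J Q" "J \<noteq> {\<zero>}"
    have "\<exists>D\<in>gen_vertices G - H. q 1 D \<in> J"
      using reduction[OF J] S projection_mem[OF J(1) exits] by auto
    then obtain n where n: "q 1 (A n) \<in> J" using A_surj by metis
    obtain \<gamma> where "set \<gamma> \<subseteq> edges G" "snd (f (Suc n)) \<subseteq> reach G (A n) \<gamma>"
      using f(2)[of n] by (auto simp: R_def)
    moreover have "snd (f (Suc n)) \<in> gen_vertices G" using f(1)[of "Suc n"] by (auto simp: good_pair_def split: prod.splits)
    ultimately have "q 1 (snd (f (Suc n))) \<in> J" using connect_mem[OF J(1) n] A[of n] by blast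
    then have "path_idem (f (Suc n)) \<in> J" using path_idem_mem[OF J(1), of "fst (f (Suc n))" "snd (f (Suc n))"] f(1)[of "Suc n"] by simp
    then show "\<exists>n. path_idem (f n) \<in> J" ..
  qed (rule rng_axioms)
qed

end

section \<open>Necessity\<close>

context leavitt_quotient
begin

text \<open>The monomials span \<open>Q\<close>, so the factor supplied by primeness may be taken
  among them.\<close>

lemma monomial_nonzero:
  assumes "a \<in> carrier Q" "b \<in> carrier Q" "r \<in> carrier Q" "a \<otimes> r \<otimes> b \<noteq> \<zero>"
  shows "\<exists>\<alpha> \<beta> k A. set \<alpha> \<subseteq> edges G \<and> set \<beta> \<subseteq> edges G \<and> A \<in> gen_vertices G \<and>
    a \<otimes> tr \<beta> (sl \<alpha> (q k A)) \<otimes> b \<noteq> \<zero>"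
proof -
  have "\<exists>m\<in>mon UNIV. a \<otimes> m \<otimes> b \<noteq> \<zero>"
  proof (rule ccontr)
    assume *: "\<not> ?thesis"
    have "a \<otimes> r \<otimes> b = \<zero>"
      using carrier_span[OF assms(3)] mon_closed
    proof (induction rule: aspan_induct)
      case (add m x)
      then have "m \<in> carrier Q" using mon_closed by blast
      then show ?case using add * assms by (simp add: l_distr r_distr m_closed)
    qed (use assms in simp)
    then show False using assms by simp
  qed
  then show ?thesis unfolding mon_def by blast
qed

lemma q_breaking_left:
  assumes "w \<in> breaking_vertices G H" "A \<in> gen_vertices G" "w \<notin> A"
  shows "q k A \<otimes> breaking w = \<zero>"
proof -
  have wv: "{w} \<in> gen_vertices G" using breaking_vertex[OF assms(1)] by simp
  have "q k A \<otimes> breaking w = (q k A \<otimes> q 1 {w}) \<otimes> breaking w"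
    using assms wv by (simp add: m_assoc)
  then show ?thesis using assms wv by (simp add: q_mult)
qed

lemma rpath_breaking:
  assumes "w \<in> breaking_vertices G H" "set \<beta> \<subseteq> edges G" "\<beta> \<noteq> []" "x \<in> carrier Q"
  shows "tr \<beta> x \<otimes> breaking w = \<zero>"
  using assms by (cases \<beta>) (simp_all add: m_assoc)

text \<open>A nonzero \<open>p_A s_\<alpha> p_D s_\<beta>^* p_B\<close> has a set \<open>C\<close>
  in the middle that is reached from \<open>A\<close> along \<open>\<alpha>\<close> and from
  \<open>B\<close> along \<open>\<beta>\<close>.\<close>

lemma necessary_directed:
  assumes prim: "left_primitive Q"
  shows "downward_directed G (gen_vertices G - H)"
  unfolding downward_directed_def
proof (intro conjI ballI)
  show "gen_vertices G - H \<noteq> {}"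
  proof
    assume *: "gen_vertices G - H = {}"
    have "x = \<zero>" if x: "x \<in> carrier Q" for x
    proof -
      obtain B where "B \<in> gen_vertices G" "x \<otimes> q 1 B = x" using right_unit[OF x] by blast
      then show ?thesis using * q_null[of B 1] x by auto
    qed
    then have "carrier Q = {\<zero>}" using zero_closed by blast
    then show False using left_primitive_nonzero[OF prim] by simp
  qed
  fix A B assume AB: "A \<in> gen_vertices G - H" "B \<in> gen_vertices G - H"
  then obtain r where "r \<in> carrier Q" "q 1 A \<otimes> r \<otimes> q 1 B \<noteq> \<zero>"
    using left_primitive_prime[OF prim, of "q 1 A" "q 1 B"] q_nonzero by auto
  then obtain \<alpha> \<beta> k D where m: "set \<alpha> \<subseteq> edges G" "set \<beta> \<subseteq> edges G" "D \<in> gen_vertices G"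
      "q 1 A \<otimes> tr \<beta> (sl \<alpha> (q k D)) \<otimes> q 1 B \<noteq> \<zero>"
    using monomial_nonzero[of "q 1 A" "q 1 B" r] AB by fastforce
  define C where "C = reach G A \<alpha> \<inter> D \<inter> reach G B \<beta>"
  have C: "C \<in> gen_vertices G" using m AB by (auto simp: C_def intro!: gen_vertices.inter reach_gen)
  have "q 1 A \<otimes> tr \<beta> (sl \<alpha> (q k D)) \<otimes> q 1 B = tr \<beta> (sl \<alpha> (q k C))"
    using m AB by (simp add: rpath_mult q_lpath q_mult reach_gen q_rpath lpath_mult C_def)
  then have "C \<notin> H" using m q_null by auto
  moreover have "C \<noteq> {}" using \<open>C \<notin> H\<close> by auto
  moreover have "connects G A C" "connects G B C"
    using m \<open>C \<noteq> {}\<close> connects_iff_reach[of C G] by (auto simp: C_def)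
  ultimately show "\<exists>C\<in>gen_vertices G - H. C \<noteq> {} \<and> connects G A C \<and> connects G B C" using C by blast
qed

lemma breaking_ne: "w \<in> breaking_vertices G H - S \<Longrightarrow> breaking w \<noteq> \<zero>"
  using breaking_nonzero[of w] by (simp add: breaking_def inner_edges_def)

text \<open>As ghosts annihilate \<open>p_w^H\<close>, a monomial surviving between
  \<open>p_A\<close> and \<open>p_w^H\<close> is free of ghosts, and its path leads from
  \<open>A\<close> to \<open>w\<close>.\<close>

lemma necessary_breaking_connects:
  assumes prim: "left_primitive Q" and w: "w \<in> breaking_vertices G H - S" and A: "A \<in> gen_vertices G - H"
  shows "connects G A {w}"
proof -
  have bw: "w \<in> breaking_vertices G H" using w by simp
  obtain r where "r \<in> carrier Q" "q 1 A \<otimes> r \<otimes> breaking w \<noteq> \<zero>"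
    using left_primitive_prime[OF prim, of "q 1 A" "breaking w"] q_nonzero[OF A, of 1] A bw breaking_ne[OF w] by auto
  then obtain \<alpha> \<beta> k D where m: "set \<alpha> \<subseteq> edges G" "set \<beta> \<subseteq> edges G" "D \<in> gen_vertices G"
      "q 1 A \<otimes> tr \<beta> (sl \<alpha> (q k D)) \<otimes> breaking w \<noteq> \<zero>"
    using monomial_nonzero[of "q 1 A" "breaking w" r] A bw by fastforce
  have eq: "q 1 A \<otimes> tr \<beta> (sl \<alpha> (q k D)) = tr \<beta> (sl \<alpha> (q k (reach G A \<alpha> \<inter> D)))"
    using m A by (simp add: rpath_mult q_lpath q_mult reach_gen)
  have R: "reach G A \<alpha> \<inter> D \<in> gen_vertices G" using m A by (simp add: reach_gen)
  have "\<beta> = []"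
    using m eq R rpath_breaking[OF bw m(2)] by (metis lpath_closed q_closed)
  then have "sl \<alpha> (q k (reach G A \<alpha> \<inter> D) \<otimes> breaking w) \<noteq> \<zero>"
    using m(4) eq m(1) R bw by (simp add: lpath_mult)
  then have "w \<in> reach G A \<alpha>" using q_breaking_left[OF bw R, of k] lpath_zero[OF m(1)] by (metis IntD1)
  then show ?thesis using m connects_iff_reach[of "{w}" G A] by auto
qed

text \<open>Between two such idempotents neither edges nor ghosts survive, and projections at
  different vertices are orthogonal.\<close>

lemma necessary_breaking_unique:
  assumes prim: "left_primitive Q"
    and w: "w \<in> breaking_vertices G H - S" and w': "w' \<in> breaking_vertices G H - S"
  shows "w = w'"
proof (rule ccontr)
  assume neq: "w \<noteq> w'"
  have bw: "w \<in> breaking_vertices G H" "w' \<in> breaking_vertices G H" using w w' by simp_all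
  obtain r where "r \<in> carrier Q" "breaking w \<otimes> r \<otimes> breaking w' \<noteq> \<zero>"
    using left_primitive_prime[OF prim, of "breaking w" "breaking w'"] bw breaking_ne w w' by auto
  then obtain \<alpha> \<beta> k D where m: "set \<alpha> \<subseteq> edges G" "set \<beta> \<subseteq> edges G" "D \<in> gen_vertices G"
      "breaking w \<otimes> tr \<beta> (sl \<alpha> (q k D)) \<otimes> breaking w' \<noteq> \<zero>"
    using monomial_nonzero[of "breaking w" "breaking w'" r] bw by fastforce
  have eq: "breaking w \<otimes> tr \<beta> (sl \<alpha> (q k D)) = tr \<beta> (breaking w \<otimes> sl \<alpha> (q k D))"
    using m bw by (simp add: rpath_mult)
  have "\<beta> = []"
    using m(4) eq rpath_breaking[OF bw(2) m(2)] bw m by (metis lpath_closed m_closed q_closed breaking_closed)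
  moreover have "\<alpha> = []"
    using m(4) eq breaking_lpath[OF bw(1) m(1)] bw m by (metis rpath_zero l_null q_closed breaking_closed)
  ultimately have nz: "breaking w \<otimes> q k D \<otimes> breaking w' \<noteq> \<zero>" using m by simp
  have "breaking w \<otimes> q k D = (if w \<in> D then breaking w \<otimes> q k {w} else \<zero>)" by (rule breaking_q[OF bw(1) m(3)])
  then have "breaking w \<otimes> (q k {w} \<otimes> breaking w') \<noteq> \<zero>"
    using nz bw breaking_vertex[OF bw(1)] by (auto simp: m_assoc split: if_splits)
  then show False using q_breaking_left[of w' "{w}" k] neq bw breaking_vertex[OF bw(1)] by auto
qed

text \<open>A loop without exit, unrolled to an infinite walk to avoid index arithmetic modulo its
  length. In \<open>Q\<close> every range is the single next vertex, and only one edge survives at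
  each source. That the walk closes up is required separately, as an equality of two
  sources.\<close>

definition bare_cycle :: "(nat \<Rightarrow> 'e) \<Rightarrow> bool" where
  "bare_cycle h \<longleftrightarrow> (\<forall>i. h i \<in> edges G \<and> {source G (h i)} \<notin> H \<and> source G (h (Suc i)) \<in> erange G (h i) \<and>
     (\<forall>k. q k (erange G (h i)) = q k {source G (h (Suc i))}) \<and>
     q 1 {source G (h i)} = s (h i) \<otimes> t (h i) \<and>
     (\<forall>e\<in>edges G. erange G e \<notin> H \<longrightarrow> source G e = source G (h i) \<longrightarrow> e = h i))"

lemma bare_cycleD:
  assumes "bare_cycle h"
  shows "h i \<in> edges G" "{source G (h i)} \<notin> H" "source G (h (Suc i)) \<in> erange G (h i)"
    "q k (erange G (h i)) = q k {source G (h (Suc i))}" "q 1 {source G (h i)} = s (h i) \<otimes> t (h i)"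
    "e \<in> edges G \<Longrightarrow> erange G e \<notin> H \<Longrightarrow> source G e = source G (h i) \<Longrightarrow> e = h i"
  using assms unfolding bare_cycle_def by blast+

lemma op_bare_cycle: "leavitt_quotient.bare_cycle G (rng_op Q) H q t s = bare_cycle"
  unfolding leavitt_quotient.bare_cycle_def[OF op] bare_cycle_def by simp

text \<open>A path surviving from a vertex of the walk must follow the walk, since at each vertex
  only one edge is nonzero.\<close>

lemma cycle_lpath:
  assumes h: "bare_cycle h" and "set \<alpha> \<subseteq> edges G" "x \<in> carrier Q" "q k {source G (h i)} \<otimes> sl \<alpha> x \<noteq> \<zero>"
  shows "\<alpha> = map h [i..<i + length \<alpha>] \<and>
    q k {source G (h i)} \<otimes> sl \<alpha> x = sl \<alpha> (q k {source G (h (i + length \<alpha>))} \<otimes> x)"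
  using assms(2-)
proof (induction \<alpha> arbitrary: i)
  case (Cons e \<alpha>)
  note hi = bare_cycleD[OF h, where i = i]
  have e: "e \<in> edges G" "set \<alpha> \<subseteq> edges G" using Cons.prems by auto
  have eq: "q k {source G (h i)} \<otimes> sl (e # \<alpha>) x = (q k {source G (h i)} \<otimes> s e) \<otimes> sl \<alpha> x"
    using e hi(1) Cons.prems by (simp add: m_assoc)
  then have nz: "q k {source G (h i)} \<otimes> s e \<noteq> \<zero>" using Cons.prems e by auto
  then have src: "source G e = source G (h i)" using e hi(1) by (auto simp: q_s split: if_splits)
  moreover have "erange G e \<notin> H" using nz s_null[OF e(1)] hi(1) by auto
  ultimately have eh: "e = h i" using hi(6) e by blast
  have "q k {source G (h i)} \<otimes> s e = s e \<otimes> q k {source G (h (Suc i))}"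
    using eh hi(1,4) by (simp add: q_source_s)
  then have eq': "q k {source G (h i)} \<otimes> sl (e # \<alpha>) x = s e \<otimes> (q k {source G (h (Suc i))} \<otimes> sl \<alpha> x)"
    using eq e Cons.prems bare_cycleD(1)[OF h, of "Suc i"] by (simp add: m_assoc)
  then have "q k {source G (h (Suc i))} \<otimes> sl \<alpha> x \<noteq> \<zero>" using Cons.prems e by auto
  then have IH: "\<alpha> = map h [Suc i..<Suc i + length \<alpha>]"
    "q k {source G (h (Suc i))} \<otimes> sl \<alpha> x = sl \<alpha> (q k {source G (h (Suc i + length \<alpha>))} \<otimes> x)"
    using Cons.IH[of "Suc i"] e Cons.prems by blast+
  have "[i..<i + length (e # \<alpha>)] = i # [Suc i..<Suc i + length \<alpha>]" by (subst upt_conv_Cons) simp_all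
  then have "e # \<alpha> = map h [i..<i + length (e # \<alpha>)]" using IH(1) eh by simp
  moreover have "q k {source G (h i)} \<otimes> sl (e # \<alpha>) x =
      sl (e # \<alpha>) (q k {source G (h (i + length (e # \<alpha>)))} \<otimes> x)"
    using eq' IH(2) by simp
  ultimately show ?case ..
qed simp

lemma cycle_rpath:
  assumes "bare_cycle h" and "set \<alpha> \<subseteq> edges G" "x \<in> carrier Q" "tr \<alpha> x \<otimes> q k {source G (h i)} \<noteq> \<zero>"
  shows "\<alpha> = map h [i..<i + length \<alpha>] \<and>
    tr \<alpha> x \<otimes> q k {source G (h i)} = tr \<alpha> (x \<otimes> q k {source G (h (i + length \<alpha>))})"
  using leavitt_quotient.cycle_lpath[OF op, unfolded op_bare_cycle, of h \<alpha> x k i] assms by simp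

lemma cycle_reach:
  assumes h: "bare_cycle h"
  shows "source G (h n) \<in> reach G UNIV (map h [0..<n])"
proof (induction n)
  case (Suc n)
  then show ?case using bare_cycleD(3)[OF h, of n] by (simp add: reach_append)
qed simp

text \<open>\<open>k s_\<mu> p_v s_\<nu>^*\<close> for the initial stretches \<open>\<mu>\<close>
  and \<open>\<nu>\<close> of lengths \<open>a\<close> and \<open>b\<close>; it is used when both
  end at the same vertex \<open>v\<close>.\<close>

definition cycle_mon :: "(nat \<Rightarrow> 'e) \<Rightarrow> nat \<Rightarrow> nat \<Rightarrow> 'k \<Rightarrow> 'q" where
  "cycle_mon h a b k = sl (map h [0..<a]) (tr (map h [0..<b]) (q k {source G (h a)}))"

lemma cycle_edges: "bare_cycle h \<Longrightarrow> set (map h [a..<b]) \<subseteq> edges G"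
  using bare_cycleD(1) by auto

text \<open>Equal sources have equal edges by uniqueness. The next vertices agree because the common
  range has the same projection as each of them, and projections of distinct vertices are orthogonal
  and nonzero here.\<close>

lemma cycle_next:
  assumes h: "bare_cycle h" and eq: "source G (h a) = source G (h b)"
  shows "h a = h b" "source G (h (Suc a)) = source G (h (Suc b))"
proof -
  note ha = bare_cycleD[OF h, where i = a] and ha' = bare_cycleD[OF h, where i = "Suc a"] and hb' = bare_cycleD[OF h, where i = "Suc b"]
  have "erange G (h a) \<notin> H" using H_subset[of "erange G (h a)" "{source G (h (Suc a))}"] ha ha' by auto
  then show hab: "h a = h b" using bare_cycleD(6)[OF h ha(1), of b] eq by simp
  have "q 1 {source G (h (Suc a))} = q 1 {source G (h (Suc b))}"
    using ha(4)[of 1] bare_cycleD(4)[OF h, of 1 b] hab by simp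
  then have "q 1 {source G (h (Suc a))} \<otimes> q 1 {source G (h (Suc b))} \<noteq> \<zero>"
    using q_nonzero[of "{source G (h (Suc b))}" 1] hb'(1,2) by (simp add: q_mult)
  then have "{source G (h (Suc a))} \<inter> {source G (h (Suc b))} \<noteq> {}"
    using ha'(1) hb'(1) q_empty by (metis mult_1 q_mult source_gen)
  then show "source G (h (Suc a)) = source G (h (Suc b))" by simp
qed

text \<open>Both paths of such a monomial may be prolonged around the cycle; prolonged suitably, two monomials can
  be multiplied in either order, which shows that they commute.\<close>

lemma cycle_mon_shift:
  assumes h: "bare_cycle h" and eq: "source G (h a) = source G (h b)"
  shows "source G (h (a + m)) = source G (h (b + m)) \<and> cycle_mon h a b k = cycle_mon h (a + m) (b + m) k"
proof (induction m)
  case (Suc m)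
  let ?a = "a + m" and ?b = "b + m"
  have eq: "source G (h ?a) = source G (h ?b)" using Suc by simp
  note nx = cycle_next[OF h eq] and hm = bare_cycleD[OF h, where i = ?a] and hm' = bare_cycleD[OF h, where i = "Suc ?a"]
  \<comment> \<open>The relation \<open>p_v = s_e t_e\<close> is inserted at the common end, with
    one factor for each of the two paths.\<close>
  have "q k {source G (h ?a)} = q k {source G (h ?a)} \<otimes> (s (h ?a) \<otimes> t (h ?a))"
    using hm(1) by (simp add: q_mult flip: hm(5))
  also have "\<dots> = (q k {source G (h ?a)} \<otimes> s (h ?a)) \<otimes> t (h ?a)"
    using hm(1) by (simp add: m_assoc)
  also have "\<dots> = s (h ?a) \<otimes> (q k {source G (h (Suc ?a))} \<otimes> t (h ?b))"
    unfolding q_source_s[OF hm(1)] hm(4) nx(1)[symmetric] using hm(1) hm'(1) by (simp add: m_assoc)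
  finally have qeq: "q k {source G (h ?a)} = s (h ?a) \<otimes> (q k {source G (h (Suc ?a))} \<otimes> t (h ?b))" .
  have hb: "h ?b \<in> edges G" by (rule bare_cycleD(1)[OF h])
  have "cycle_mon h ?a ?b k = sl (map h [0..<?a]) (s (h ?a) \<otimes> tr (map h [0..<?b]) (q k {source G (h (Suc ?a))} \<otimes> t (h ?b)))"
    using hm(1) hm'(1) hb cycle_edges[OF h] by (simp only: cycle_mon_def qeq) (subst rpath_mult; simp add: m_closed)
  also have "\<dots> = cycle_mon h (Suc ?a) (Suc ?b) k"
    by (simp add: cycle_mon_def lpath_append rpath_append)
  finally show ?case using Suc nx by simp
qed (use eq in simp)

text \<open>In the middle stands \<open>s_\<nu>^* s_\<nu>\<close> with \<open>\<nu>\<close> the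
  first \<open>b\<close> edges, which is the identity on the projection at their end.\<close>

lemma cycle_mon_mult:
  assumes h: "bare_cycle h" and eq: "source G (h a) = source G (h b)"
  shows "cycle_mon h a b k \<otimes> cycle_mon h b c l = cycle_mon h a c (k * l)"
proof -
  let ?v = "source G (h b)" and ?P = "\<lambda>n. map h [0..<n]"
  have P: "set (?P n) \<subseteq> edges G" for n using cycle_edges[OF h] .
  have v: "{?v} \<in> gen_vertices G" using bare_cycleD(1)[OF h, of b] by simp
  define z where "z = tr (?P c) (q l {?v})"
  have z: "z \<in> carrier Q" "q k {?v} \<otimes> z = tr (?P c) (q (k * l) {?v})" for k
    unfolding z_def using v P by (simp_all only: rpath_closed q_closed rpath_mult q_mult Int_absorb)
  have z1: "q 1 {?v} \<otimes> z = z" using z(2)[of 1] by (simp add: z_def)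
  have "cycle_mon h a b k \<otimes> cycle_mon h b c l = sl (?P a) (tr (?P b) (q k {?v})) \<otimes> sl (?P b) z"
    by (simp add: cycle_mon_def eq z_def)
  also have "\<dots> = sl (?P a) (tr (?P b) (q k {?v}) \<otimes> sl (?P b) z)"
    using P v z by (intro lpath_mult) (simp_all only: rpath_closed lpath_closed q_closed)
  also have "tr (?P b) (q k {?v}) \<otimes> sl (?P b) z = q k {?v} \<otimes> tl (?P b) (sl (?P b) z)"
    using P v z by (intro rpath_adjoint) (simp_all only: lpath_closed q_closed)
  also have "tl (?P b) (sl (?P b) z) = tl (?P b) (sl (?P b) (q 1 {?v} \<otimes> z))" using z1 by simp
  also have "\<dots> = q 1 ({?v} \<inter> reach G UNIV (?P b)) \<otimes> z" by (rule lghost_lpath[OF v P z(1)])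
  also have "{?v} \<inter> reach G UNIV (?P b) = {?v}" using cycle_reach[OF h, of b] by simp
  finally show ?thesis using z1 z(2)[of k] by (simp add: cycle_mon_def eq)
qed

lemma cycle_mon_commute:
  assumes h: "bare_cycle h" and "source G (h a) = source G (h b)" "source G (h a') = source G (h b')"
  shows "cycle_mon h a b k \<otimes> cycle_mon h a' b' l = cycle_mon h a' b' l \<otimes> cycle_mon h a b k"
proof -
  \<comment> \<open>Prolonging by \<open>a'\<close> and \<open>b\<close> makes the inner lengths
    agree; for the other order \<open>b'\<close> and \<open>a\<close> do so. Both products have
    outer lengths \<open>a + a'\<close> and \<open>b + b'\<close>.\<close>
  have "cycle_mon h a b k \<otimes> cycle_mon h a' b' l = cycle_mon h (a + a') (b + a') k \<otimes> cycle_mon h (a' + b) (b' + b) l"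
    using cycle_mon_shift[OF h assms(2), of a' k] cycle_mon_shift[OF h assms(3), of b l] by simp
  also have "\<dots> = cycle_mon h (a + a') (b' + b) (k * l)"
    using cycle_mon_mult[OF h, of "a + a'" "b + a'" k "b' + b" l] cycle_mon_shift[OF h assms(2), of a' k]
    by (simp add: add.commute)
  also have "\<dots> = cycle_mon h (a' + a) (b' + a) l \<otimes> cycle_mon h (a + b') (b + b') k"
    using cycle_mon_mult[OF h, of "a' + a" "b' + a" l "b + b'" k] cycle_mon_shift[OF h assms(3), of a l]
    by (simp add: ac_simps)
  also have "\<dots> = cycle_mon h a' b' l \<otimes> cycle_mon h a b k"
    using cycle_mon_shift[OF h assms(2), of b' k] cycle_mon_shift[OF h assms(3), of a l] by simp
  finally show ?thesis .
qed

text \<open>Cut down to the corner, both the path and the ghost path of a monomial must run along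
  the walk and end at a common vertex.\<close>

lemma cycle_corner_mon:
  assumes h: "bare_cycle h" and m: "m \<in> mon UNIV" and nz: "q 1 {source G (h 0)} \<otimes> m \<otimes> q 1 {source G (h 0)} \<noteq> \<zero>"
  shows "\<exists>a b k. source G (h a) = source G (h b) \<and>
    q 1 {source G (h 0)} \<otimes> m \<otimes> q 1 {source G (h 0)} = cycle_mon h a b k"
proof -
  let ?v = "\<lambda>n. source G (h n)"
  have v: "{?v n} \<in> gen_vertices G" for n using bare_cycleD(1)[OF h] by simp
  obtain \<alpha> \<beta> k A where a: "m = tr \<beta> (sl \<alpha> (q k A))" "set \<alpha> \<subseteq> edges G" "set \<beta> \<subseteq> edges G" "A \<in> gen_vertices G"
    using m by (auto simp: mon_def)
  have 1: "q 1 {?v 0} \<otimes> m = tr \<beta> (q 1 {?v 0} \<otimes> sl \<alpha> (q k A))" using a v by (simp add: rpath_mult)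
  then have "q 1 {?v 0} \<otimes> sl \<alpha> (q k A) \<noteq> \<zero>" using nz a v by auto
  then have \<alpha>: "\<alpha> = map h [0..<length \<alpha>]"
    "q 1 {?v 0} \<otimes> sl \<alpha> (q k A) = sl \<alpha> (q k ({?v (length \<alpha>)} \<inter> A))"
    using cycle_lpath[OF h a(2), of "q k A" 1 0] a v by (auto simp: q_mult)
  let ?y = "sl \<alpha> (q k ({?v (length \<alpha>)} \<inter> A))"
  have y: "?y \<in> carrier Q" using a v by simp
  have "tr \<beta> ?y \<otimes> q 1 {?v 0} \<noteq> \<zero>" using nz 1 \<alpha> by simp
  then have \<beta>: "\<beta> = map h [0..<length \<beta>]" "tr \<beta> ?y \<otimes> q 1 {?v 0} = tr \<beta> (?y \<otimes> q 1 {?v (length \<beta>)})"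
    using cycle_rpath[OF h a(3) y, of 1 0] by auto
  let ?C = "{?v (length \<alpha>)} \<inter> A \<inter> {?v (length \<beta>)}"
  have eq: "q 1 {?v 0} \<otimes> m \<otimes> q 1 {?v 0} = tr \<beta> (sl \<alpha> (q k ?C))"
    using 1 \<alpha> \<beta> a v by (simp add: lpath_mult q_mult)
  have "?C \<noteq> {}"
  proof
    assume "?C = {}"
    then have "q 1 {?v 0} \<otimes> m \<otimes> q 1 {?v 0} = tr \<beta> (sl \<alpha> (q k {}))" using eq by simp
    then show False using nz a by simp
  qed
  then have "?v (length \<alpha>) = ?v (length \<beta>)" "?C = {?v (length \<alpha>)}" by auto
  with eq have "q 1 {?v 0} \<otimes> m \<otimes> q 1 {?v 0} = cycle_mon h (length \<alpha>) (length \<beta>) k"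
    using \<alpha>(1) \<beta>(1) a lpath_rpath[OF a(2,3), of "q k ?C"] v unfolding cycle_mon_def by simp
  then show ?thesis using \<open>?v (length \<alpha>) = ?v (length \<beta>)\<close> by blast
qed

lemma cycle_corner_commutes:
  assumes h: "bare_cycle h" and x: "x \<in> carrier Q" and y: "y \<in> carrier Q"
    and p: "p = q 1 {source G (h 0)}"
  shows "(p \<otimes> x \<otimes> p) \<otimes> (p \<otimes> y \<otimes> p) = (p \<otimes> y \<otimes> p) \<otimes> (p \<otimes> x \<otimes> p)"
proof -
  have pc: "p \<in> carrier Q" using p bare_cycleD(1)[OF h] by simp
  have mm: "(p \<otimes> m \<otimes> p) \<otimes> (p \<otimes> m' \<otimes> p) = (p \<otimes> m' \<otimes> p) \<otimes> (p \<otimes> m \<otimes> p)"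
    if m: "m \<in> mon UNIV" "m' \<in> mon UNIV" for m m'
  proof -
    have c: "m \<in> carrier Q" "m' \<in> carrier Q" using m mon_closed by auto
    show ?thesis
    proof (cases "p \<otimes> m \<otimes> p = \<zero> \<or> p \<otimes> m' \<otimes> p = \<zero>")
      case True
      then show ?thesis using pc c by (auto simp: m_closed)
    next
      case False
      then obtain a b k a' b' l where "source G (h a) = source G (h b)" "p \<otimes> m \<otimes> p = cycle_mon h a b k"
          "source G (h a') = source G (h b')" "p \<otimes> m' \<otimes> p = cycle_mon h a' b' l"
        using cycle_corner_mon[OF h m(1)] cycle_corner_mon[OF h m(2)] p by metis
      then show ?thesis using cycle_mon_commute[OF h] by metis
    qed
  qed
  have "(p \<otimes> m \<otimes> p) \<otimes> (p \<otimes> y \<otimes> p) = (p \<otimes> y \<otimes> p) \<otimes> (p \<otimes> m \<otimes> p)" if m: "m \<in> mon UNIV" for m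
    using carrier_span[OF y] mon_closed
  proof (induction rule: aspan_induct)
    case (add a x)
    then have "a \<in> carrier Q" "m \<in> carrier Q" using m mon_closed by auto
    then show ?case using add mm[OF m, of a] pc by (simp add: l_distr r_distr m_closed)
  qed (use pc subsetD[OF mon_closed m] in \<open>simp add: m_closed\<close>)
  then show ?thesis
  proof -
    assume *: "\<And>m. m \<in> mon UNIV \<Longrightarrow> (p \<otimes> m \<otimes> p) \<otimes> (p \<otimes> y \<otimes> p) = (p \<otimes> y \<otimes> p) \<otimes> (p \<otimes> m \<otimes> p)"
    show ?thesis
      using carrier_span[OF x] mon_closed
    proof (induction rule: aspan_induct)
      case (add a x)
      then have "a \<in> carrier Q" using mon_closed by auto
      then show ?case using add *[of a] pc y by (simp add: l_distr r_distr m_closed)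
    qed (use pc y in \<open>simp add: m_closed\<close>)
  qed
qed

lemma not_primitive_of_bare_cycle:
  assumes h: "bare_cycle h" and n: "n > 0" "source G (h n) = source G (h 0)" and prim: "left_primitive Q"
  shows False
proof -
  define p where "p = q 1 {source G (h 0)}"
  define c where "c = sl (map h [0..<n]) p"
  note h0 = bare_cycleD[OF h, where i = 0]
  have P: "set (map h [0..<n]) \<subseteq> edges G" using cycle_edges[OF h] .
  have pc: "p \<in> carrier Q" "p \<otimes> p = p" using h0(1) by (simp_all add: p_def q_mult)
  have cc: "c \<in> carrier Q" using P pc by (simp only: c_def lpath_closed)
  \<comment> \<open>The negative is rewritten as a term with coefficient \<open>- 1\<close>, so that
    \<open>p \<ominus> c\<close> is a head plus a term of positive length and
    \<open>head_nonzero\<close> applies.\<close>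
  have neg: "\<ominus> c = sl (map h [0..<n]) (q (- 1) {source G (h 0)})"
  proof (rule minus_equality)
    have "q (- 1) {source G (h 0)} \<oplus> p = \<zero>" using h0(1) by (simp add: p_def q_add)
    moreover have "sl (map h [0..<n]) (q (- 1) {source G (h 0)}) \<oplus> c =
        sl (map h [0..<n]) (q (- 1) {source G (h 0)} \<oplus> p)"
      unfolding c_def by (rule lpath_add[symmetric, OF P _ pc(1)]) (use h0(1) in simp)
    ultimately show "sl (map h [0..<n]) (q (- 1) {source G (h 0)}) \<oplus> c = \<zero>"
      using lpath_zero[OF P] by simp
  qed (use P cc h0 in \<open>simp_all only: lpath_closed q_closed source_gen\<close>)
  have "length (map h [0..<n]) \<in> {1..}" using n by simp
  then have "\<ominus> c \<in> aspan Q (trm {1..})"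
    unfolding neg using P h0 by (intro aspan_base[OF trm_closed] trmI) (auto simp del: One_nat_def)
  then have nz: "p \<ominus> c \<noteq> \<zero>"
    using head_nonzero[of "{source G (h 0)}" 1 "\<ominus> c"] h0 by (simp add: p_def a_minus_def)
  have "p \<otimes> c = c"
  proof -
    have "[0..<n] = 0 # [Suc 0..<n]" using n by (simp add: upt_conv_Cons)
    then have ceq: "c = s (h 0) \<otimes> sl (map h [Suc 0..<n]) p" by (simp add: c_def)
    have "p \<otimes> c = (p \<otimes> s (h 0)) \<otimes> sl (map h [Suc 0..<n]) p"
      unfolding ceq using pc h0(1) cycle_edges[OF h, of "Suc 0" n] by (simp only: m_assoc s_closed lpath_closed)
    then show ?thesis using s_source[OF h0(1)] ceq by (simp add: p_def)
  qed
  moreover have "c \<otimes> p = c" using P pc by (simp add: c_def lpath_mult)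
  ultimately have corner: "p \<otimes> (p \<ominus> c) \<otimes> p = p \<ominus> c"
    using pc cc by (simp add: l_diff r_diff m_closed)
  have comm: "x \<otimes> y = y \<otimes> x"
    if "x \<in> carrier Q" "y \<in> carrier Q" "p \<otimes> x \<otimes> p = x" "p \<otimes> y \<otimes> p = y" for x y
    using cycle_corner_commutes[OF h that(1,2) p_def] that(3,4) by simp
  have pcc: "p \<ominus> c \<in> carrier Q" using pc(1) cc by simp
  have "\<exists>y\<in>carrier Q. y \<otimes> (p \<ominus> c) = p \<and> (p \<ominus> c) \<otimes> y = p"
    by (rule left_primitive_commutative_corner[OF prim pc _ pcc nz corner]) (rule comm)
  then obtain y where y: "y \<in> carrier Q" "y \<otimes> (p \<ominus> c) = p" "(p \<ominus> c) \<otimes> y = p"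
    by blast
  show False
    by (rule cycle_not_invertible[OF n(1) bare_cycleD(1,5,4)[OF h] n(2) h0(2)
          disjI1[OF c_def[unfolded p_def]] y[unfolded p_def]])
qed

lemma necessary_exit:
  assumes prim: "left_primitive Q" and S: "S = breaking_vertices G H" and loop: "loop_outside G H \<gamma>"
  shows "has_exit_outside G H \<gamma>"
proof (rule ccontr)
  assume noexit: "\<not> has_exit_outside G H \<gamma>"
  have path: "is_path G \<gamma>" and wrap: "source G (hd \<gamma>) \<in> erange G (last \<gamma>)" and out: "erange G (last \<gamma>) \<notin> H"
    using loop by (auto simp: loop_outside_def is_loop_def path_source_def path_range_def)
  define n where "n = length \<gamma>"
  have ne: "\<gamma> \<noteq> []" "n > 0" and ed: "set \<gamma> \<subseteq> edges G"
    and succ: "successively (\<lambda>e f. source G f \<in> erange G e) \<gamma>"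
    using path by (auto simp: is_path_def n_def)
  define h where "h i = \<gamma> ! (i mod n)" for i
  have hE: "h i \<in> edges G" for i using ed ne nth_mem[of "i mod n" \<gamma>] by (auto simp: h_def n_def)
  have hS: "h (Suc i) = \<gamma> ! (Suc (i mod n) mod n)" for i by (simp add: h_def mod_Suc_eq)
  have h_next: "source G (h (Suc i)) \<in> erange G (h i)" for i
  proof (cases "Suc (i mod n) < n")
    case True
    then have "source G (\<gamma> ! Suc (i mod n)) \<in> erange G (\<gamma> ! (i mod n))"
      using succ by (auto simp: successively_conv_nth n_def)
    then show ?thesis using True by (simp add: hS) (simp add: h_def)
  next
    case False
    then have "Suc (i mod n) = n" using ne mod_less_divisor[of n i] by linarith
    moreover then have "i mod n = n - 1" by simp
    ultimately show ?thesis using wrap ne by (simp add: hS) (simp add: h_def hd_conv_nth last_conv_nth n_def)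
  qed
  have im: "i mod n < length \<gamma>" for i using ne by (simp add: n_def)
  have rest: "erange G (h i) - {source G (h (Suc i))} \<in> H" for i
    using noexit im[of i] hE[of i] hE[of "Suc i"] hS[of i]
    unfolding has_exit_outside_def by (auto simp: h_def n_def)
  have unique: "e = h (Suc i)" if "e \<in> edges G" "erange G e \<notin> H" "source G e = source G (h (Suc i))" for e i
    using noexit im[of i] that h_next[of i] hS[of i]
    unfolding has_exit_outside_def by (auto simp: h_def n_def)
  have hn: "h (i + n) = h i" for i by (simp add: h_def)
  \<comment> \<open>\<open>unique\<close> speaks of successors only; adding a period before stepping
    back makes it available for every index.\<close>
  have unique': "e = h i" if "e \<in> edges G" "erange G e \<notin> H" "source G e = source G (h i)" for e i
  proof -
    have "h (Suc (i + n - 1)) = h i" using ne hn[of i] by simp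
    then show ?thesis using unique[of e "i + n - 1"] that by simp
  qed
  \<comment> \<open>If one vertex lay in \<open>H\<close>, heredity would carry this along the walk
    to the last edge of \<open>\<gamma>\<close>, whose range is outside \<open>H\<close>; the index
    \<open>n * i + (n - 1)\<close> is at least \<open>i\<close> and belongs to that edge.\<close>
  have vH: "{source G (h i)} \<notin> H" for i
  proof
    assume i: "{source G (h i)} \<in> H"
    have "{source G (h j)} \<in> H" if "i \<le> j" for j
      using that
    proof (induction j rule: dec_induct)
      case (step j)
      then have "erange G (h j) \<in> H" using H_source hE by blast
      then show ?case using H_subset h_next[of j] hE[of "Suc j"] by auto
    qed (rule i)
    moreover have "i \<le> n * i + (n - 1)" using ne by (cases n) auto
    ultimately have "erange G (h (n * i + (n - 1))) \<in> H" using H_source hE by blast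
    moreover have "h (n * i + (n - 1)) = last \<gamma>" using ne by (simp add: h_def last_conv_nth n_def)
    ultimately show False using out by simp
  qed
  have qr: "q k (erange G (h i)) = q k {source G (h (Suc i))}" for i k
  proof -
    have v: "{source G (h (Suc i))} \<in> gen_vertices G" and r: "erange G (h i) \<in> gen_vertices G"
      using hE by auto
    have "erange G (h i) \<inter> {source G (h (Suc i))} = {source G (h (Suc i))}" using h_next[of i] by auto
    then show ?thesis using q_split[OF r v, of k] q_null[OF rest[of i], of k] v by simp
  qed
  \<comment> \<open>\<open>S = B_H\<close> leaves no gap vertex, so the expansion over surviving
    edges applies, with a single summand.\<close>
  have ck: "q 1 {source G (h i)} = s (h i) \<otimes> t (h i)" for i
  proof -
    have "erange G (h i) \<notin> H" using H_subset[of "erange G (h i)"] vH[of "Suc i"] h_next[of i] hE[of "Suc i"] by auto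
    then have "inner_edges (source G (h i)) = {h i}"
      using hE unique' by (auto simp: inner_edges_def out_edges_def)
    then show ?thesis
      using vertex_expansion[of "source G (h i)"] vH[of i] hE[of i] source_closed S
      by (simp add: esum_def m_closed)
  qed
  have bc: "bare_cycle h"
    unfolding bare_cycle_def using hE vH h_next qr ck unique' by blast
  then show False using not_primitive_of_bare_cycle[OF bc ne(2) _ prim] hn[of 0] by simp
qed

theorem left_primitive_iff:
  "left_primitive Q \<longleftrightarrow>
    (S = breaking_vertices G H \<and> downward_directed G (gen_vertices G - H) \<and>
      (\<forall>p. loop_outside G H p \<longrightarrow> has_exit_outside G H p)) \<or>
    (\<exists>w\<in>breaking_vertices G H. S = breaking_vertices G H - {w} \<and>
      (\<forall>A\<in>gen_vertices G - H. connects G A {w}))"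
proof
  assume prim: "left_primitive Q"
  show "(S = breaking_vertices G H \<and> downward_directed G (gen_vertices G - H) \<and>
      (\<forall>p. loop_outside G H p \<longrightarrow> has_exit_outside G H p)) \<or>
    (\<exists>w\<in>breaking_vertices G H. S = breaking_vertices G H - {w} \<and>
      (\<forall>A\<in>gen_vertices G - H. connects G A {w}))"
  proof (cases "S = breaking_vertices G H")
    case True
    then show ?thesis using necessary_directed[OF prim] necessary_exit[OF prim True] by blast
  next
    case False
    then obtain w where w: "w \<in> breaking_vertices G H - S" using S_breaking by blast
    then have "S = breaking_vertices G H - {w}"
      using S_breaking necessary_breaking_unique[OF prim w] by blast
    then show ?thesis using w necessary_breaking_connects[OF prim w] by blast
  qed
next
  assume "(S = breaking_vertices G H \<and> downward_directed G (gen_vertices G - H) \<and>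
      (\<forall>p. loop_outside G H p \<longrightarrow> has_exit_outside G H p)) \<or>
    (\<exists>w\<in>breaking_vertices G H. S = breaking_vertices G H - {w} \<and>
      (\<forall>A\<in>gen_vertices G - H. connects G A {w}))"
  then show "left_primitive Q"
    using sufficient_directed sufficient_breaking by blast
qed

end

section \<open>Branching systems\<close>

text \<open>The Boolean prime ideal argument relative to \<open>H\<close>: take the complement of an
  ideal that contains \<open>H\<close> and is maximal with respect to omitting \<open>D\<close>. A
  top element need not exist, and \<open>D\<close> takes its place.\<close>

lemma prime_filter_exists:
  assumes gen: "\<And>A B. A \<in> \<G> \<Longrightarrow> B \<in> \<G> \<Longrightarrow> A \<inter> B \<in> \<G>" "\<And>A B. A \<in> \<G> \<Longrightarrow> B \<in> \<G> \<Longrightarrow> A \<union> B \<in> \<G>"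
    and H: "H \<subseteq> \<G>" "{} \<in> H" "\<And>A B. A \<in> H \<Longrightarrow> B \<in> H \<Longrightarrow> A \<union> B \<in> H"
      "\<And>A B. A \<in> H \<Longrightarrow> B \<in> \<G> \<Longrightarrow> B \<subseteq> A \<Longrightarrow> B \<in> H"
    and D: "D \<in> \<G>" "D \<notin> H"
  shows "\<exists>u. u \<inter> H = {} \<and> D \<in> u \<and> (\<forall>A\<in>\<G>. \<forall>B\<in>\<G>. (A \<union> B \<in> u \<longleftrightarrow> A \<in> u \<or> B \<in> u) \<and>
    (A \<inter> B \<in> u \<longleftrightarrow> A \<in> u \<and> B \<in> u))"
proof -
  define ideals where "ideals = {P. H \<subseteq> P \<and> P \<subseteq> \<G> \<and> D \<notin> P \<and> (\<forall>A\<in>P. \<forall>B\<in>P. A \<union> B \<in> P) \<and>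
    (\<forall>A\<in>P. \<forall>B\<in>\<G>. B \<subseteq> A \<longrightarrow> B \<in> P)}"
  have "H \<in> ideals" using H D by (auto simp: ideals_def)
  then have "ideals \<noteq> {}" by auto
  moreover have "\<Union>\<C> \<in> ideals" if ne: "\<C> \<noteq> {}" and chain: "subset.chain ideals \<C>" for \<C>
  proof -
    have C: "P \<in> ideals" if "P \<in> \<C>" for P using chain that by (auto simp: subset_chain_def)
    have "A \<union> B \<in> \<Union>\<C>" if AB: "A \<in> \<Union>\<C>" "B \<in> \<Union>\<C>" for A B
    proof -
      have "P \<subseteq> P' \<or> P' \<subseteq> P" if "P \<in> \<C>" "P' \<in> \<C>" for P P'
        using chain that by (auto simp: subset_chain_def)
      then obtain P where "P \<in> \<C>" "A \<in> P" "B \<in> P" using AB by blast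
      then show ?thesis using C[of P] unfolding ideals_def by blast
    qed
    moreover have "H \<subseteq> \<Union>\<C>" using ne C by (fastforce simp: ideals_def)
    moreover have "\<Union>\<C> \<subseteq> \<G>" "D \<notin> \<Union>\<C>" using C unfolding ideals_def by blast+
    moreover have "B \<in> \<Union>\<C>" if "A \<in> \<Union>\<C>" "B \<in> \<G>" "B \<subseteq> A" for A B
      using that C unfolding ideals_def by blast
    ultimately show ?thesis unfolding ideals_def by blast
  qed
  ultimately obtain M where M: "M \<in> ideals" and max: "\<And>P. P \<in> ideals \<Longrightarrow> M \<subseteq> P \<Longrightarrow> P = M"
    using subset_Zorn_nonempty[of ideals] by blast
  have HM: "H \<subseteq> M" and MG: "M \<subseteq> \<G>" and DM: "D \<notin> M"
    and MU: "\<And>A B. A \<in> M \<Longrightarrow> B \<in> M \<Longrightarrow> A \<union> B \<in> M"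
    and Msub: "\<And>A B. A \<in> M \<Longrightarrow> B \<in> \<G> \<Longrightarrow> B \<subseteq> A \<Longrightarrow> B \<in> M"
    using M by (auto simp: ideals_def)
  \<comment> \<open>By maximality, the ideal generated by \<open>M\<close> and \<open>A\<close>
    contains \<open>D\<close>.\<close>
  have extend: "\<exists>N\<in>M. D \<subseteq> N \<union> A" if A: "A \<in> \<G>" "A \<notin> M" for A
  proof (rule ccontr)
    assume no: "\<not> ?thesis"
    define P where "P = {C \<in> \<G>. \<exists>N\<in>M. C \<subseteq> N \<union> A}"
    have "M \<subseteq> P" using MG by (auto simp: P_def)
    have "A \<in> P" using A H(2) HM by (auto simp: P_def)
    have PU: "C \<union> C' \<in> P" if CC: "C \<in> P" "C' \<in> P" for C C'
    proof -
      obtain N N' where "N \<in> M" "C \<subseteq> N \<union> A" "N' \<in> M" "C' \<subseteq> N' \<union> A" using CC by (auto simp: P_def)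
      then have "N \<union> N' \<in> M" "C \<union> C' \<subseteq> (N \<union> N') \<union> A" using MU by auto
      then show ?thesis using CC gen(2) by (auto simp: P_def)
    qed
    have Psub: "C' \<in> P" if "C \<in> P" "C' \<in> \<G>" "C' \<subseteq> C" for C C' using that by (auto simp: P_def)
    have "D \<notin> P" "P \<subseteq> \<G>" using no by (auto simp: P_def)
    moreover have "H \<subseteq> P" using HM \<open>M \<subseteq> P\<close> by blast
    ultimately have "P \<in> ideals" using PU Psub by (simp add: ideals_def)
    then have "P = M" using max \<open>M \<subseteq> P\<close> by blast
    then show False using \<open>A \<in> P\<close> A by simp
  qed
  have prime: "A \<in> M \<or> B \<in> M" if AB: "A \<in> \<G>" "B \<in> \<G>" "A \<inter> B \<in> M" for A B
  proof (rule ccontr)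
    assume "\<not> ?thesis"
    then obtain N N' where "N \<in> M" "D \<subseteq> N \<union> A" "N' \<in> M" "D \<subseteq> N' \<union> B" using extend AB by metis
    then have "D \<subseteq> (N \<union> N') \<union> (A \<inter> B)" "(N \<union> N') \<union> (A \<inter> B) \<in> M" using MU AB by auto
    then show False using Msub D DM by blast
  qed
  have "(A \<union> B \<in> \<G> - M \<longleftrightarrow> A \<in> \<G> - M \<or> B \<in> \<G> - M) \<and> (A \<inter> B \<in> \<G> - M \<longleftrightarrow> A \<in> \<G> - M \<and> B \<in> \<G> - M)"
    if AB: "A \<in> \<G>" "B \<in> \<G>" for A B
  proof -
    have "A \<union> B \<in> M \<longleftrightarrow> A \<in> M \<and> B \<in> M" using AB MU Msub[of "A \<union> B"] by blast
    moreover have "A \<inter> B \<in> M \<longleftrightarrow> A \<in> M \<or> B \<in> M"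
      using prime[OF AB] Msub[OF _ gen(1)[OF AB] Int_lower1] Msub[OF _ gen(1)[OF AB] Int_lower2] by iprover
    ultimately show ?thesis using AB gen[OF AB] by simp
  qed
  moreover have "(\<G> - M) \<inter> H = {}" "D \<in> \<G> - M" using HM DM D by auto
  ultimately show ?thesis by (intro exI[of _ "\<G> - M"]) simp
qed

text \<open>A branching system: the vertex sets act on the functions on a point set as indicator functions, and
  every edge outside \<open>H\<close> by a partial bijection. The vertices in \<open>B_H - S\<close> are not covered by their edges.\<close>

locale branching_system = ultragraph G for G :: "('v, 'e) ultragraph" +
  fixes H :: "'v set set" and S :: "'v set" and X :: "'v set \<Rightarrow> 'x set" and f :: "'e \<Rightarrow> 'x \<Rightarrow> 'x"
  assumes adm: "admissible_pair G H S"
    and X_union: "A \<in> gen_vertices G \<Longrightarrow> B \<in> gen_vertices G \<Longrightarrow> X (A \<union> B) = X A \<union> X B"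
    and X_inter: "A \<in> gen_vertices G \<Longrightarrow> B \<in> gen_vertices G \<Longrightarrow> X (A \<inter> B) = X A \<inter> X B"
    and X_null: "A \<in> H \<Longrightarrow> X A = {}"
    and X_nonempty: "A \<in> gen_vertices G - H \<Longrightarrow> X A \<noteq> {}"
    and f_inj: "e \<in> edges G \<Longrightarrow> inj_on (f e) (X (erange G e))"
    and f_source: "e \<in> edges G \<Longrightarrow> f e ` X (erange G e) \<subseteq> X {source G e}"
    and f_disjoint: "e \<in> edges G \<Longrightarrow> e' \<in> edges G \<Longrightarrow> e \<noteq> e' \<Longrightarrow>
      f e ` X (erange G e) \<inter> f e' ` X (erange G e') = {}"
    and covered: "v \<in> vertices G \<Longrightarrow> v \<notin> breaking_vertices G H - S \<Longrightarrow>
      {e \<in> out_edges G v. erange G e \<notin> H} \<noteq> {} \<Longrightarrow>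
      X {v} \<subseteq> (\<Union>e\<in>{e \<in> out_edges G v. erange G e \<notin> H}. f e ` X (erange G e))"
    and uncovered: "w \<in> breaking_vertices G H - S \<Longrightarrow>
      \<not> X {w} \<subseteq> (\<Union>e\<in>out_edges G w. f e ` X (erange G e))"

lemma countable_infinite_bij:
  assumes "countable A" "infinite A" "countable B" "infinite B"
  shows "\<exists>b. bij_betw b A B"
proof -
  obtain a :: "'a \<Rightarrow> nat" where a: "bij_betw a A UNIV" using countableE_infinite[OF assms(1,2)] by blast
  obtain b :: "'b \<Rightarrow> nat" where b: "bij_betw b B UNIV" using countableE_infinite[OF assms(3,4)] by blast
  show ?thesis using bij_betw_trans[OF a bij_betw_inv_into[OF b]] by blast
qed

text \<open>Infinitely many copies of countably many prime filters leave room to split every vertex as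
  required.\<close>

lemma branching_system_exists:
  fixes G :: "('v, 'e) ultragraph"
  assumes "ultragraph G" "admissible_pair G H S"
  shows "\<exists>(X :: 'v set \<Rightarrow> ('v set set \<times> nat) set) f. branching_system G H S X f"
proof -
  interpret ultragraph G by fact
  let ?\<G> = "gen_vertices G"
  have her: "H \<subseteq> ?\<G>" "{} \<in> H" "\<And>A B. A \<in> H \<Longrightarrow> B \<in> H \<Longrightarrow> A \<union> B \<in> H"
    "\<And>A B. A \<in> H \<Longrightarrow> B \<in> ?\<G> \<Longrightarrow> B \<subseteq> A \<Longrightarrow> B \<in> H"
    using assms(2) by (auto simp: admissible_pair_def hereditary_def)
  have "\<exists>u. D \<in> ?\<G> - H \<longrightarrow> u \<inter> H = {} \<and> D \<in> u \<and> (\<forall>A\<in>?\<G>. \<forall>B\<in>?\<G>. (A \<union> B \<in> u \<longleftrightarrow> A \<in> u \<or> B \<in> u) \<and>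
      (A \<inter> B \<in> u \<longleftrightarrow> A \<in> u \<and> B \<in> u))" for D
    using prime_filter_exists[of ?\<G> H D] her by (auto intro: gen_vertices.intros)
  then obtain uf where uf: "\<And>D. D \<in> ?\<G> - H \<Longrightarrow> uf D \<inter> H = {} \<and> D \<in> uf D \<and>
      (\<forall>A\<in>?\<G>. \<forall>B\<in>?\<G>. (A \<union> B \<in> uf D \<longleftrightarrow> A \<in> uf D \<or> B \<in> uf D) \<and> (A \<inter> B \<in> uf D \<longleftrightarrow> A \<in> uf D \<and> B \<in> uf D))"
    by metis
  define U where "U = uf ` (?\<G> - H)"
  have U: "u \<inter> H = {}" "A \<in> ?\<G> \<Longrightarrow> B \<in> ?\<G> \<Longrightarrow> A \<union> B \<in> u \<longleftrightarrow> A \<in> u \<or> B \<in> u"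
    "A \<in> ?\<G> \<Longrightarrow> B \<in> ?\<G> \<Longrightarrow> A \<inter> B \<in> u \<longleftrightarrow> A \<in> u \<and> B \<in> u" if "u \<in> U" for u A B
    using that uf unfolding U_def by blast+
  have "countable U" unfolding U_def using countable_gen_vertices[OF assms(1)] by auto
  \<comment> \<open>A point is a prime filter with a copy number and belongs to \<open>A\<close>
    when the filter does. The filters avoid \<open>H\<close> and respect unions and
    intersections.\<close>
  define X where "X A = {(u, n :: nat). u \<in> U \<and> A \<in> u}" for A
  have X_count: "countable (X A)" for A
    by (rule countable_subset[of _ "U \<times> UNIV"]) (use \<open>countable U\<close> in \<open>auto simp: X_def\<close>)
  have X_inf: "infinite (X A)" if A: "A \<in> ?\<G> - H" for A
  proof -
    have "(\<lambda>n. (uf A, n)) ` (UNIV :: nat set) \<subseteq> X A" using uf[OF A] A by (auto simp: X_def U_def)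
    moreover have "infinite ((\<lambda>n. (uf A, n)) ` (UNIV :: nat set))"
      by (subst finite_image_iff) (auto simp: inj_on_def)
    ultimately show ?thesis using finite_subset by blast
  qed
  have X_null: "X A = {}" if "A \<in> H" for A using U(1) that by (auto simp: X_def)
  define E where "E v = {e \<in> out_edges G v. erange G e \<notin> H}" for v
  \<comment> \<open>The disjoint union of the ranges of the surviving edges at \<open>v\<close>. If
    there are any, it is countably infinite like \<open>X {v}\<close>, so one injection into
    \<open>X {v}\<close> realises all edges at \<open>v\<close> and makes their images
    disjoint.\<close>
  define Y where "Y v = Sigma (E v) (\<lambda>e. X (erange G e))" for v
  have "\<exists>b. E v \<noteq> {} \<longrightarrow> v \<in> vertices G \<longrightarrow> inj_on b (Y v) \<and> b ` Y v \<subseteq> X {v} \<and>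
      (v \<notin> breaking_vertices G H - S \<longrightarrow> b ` Y v = X {v}) \<and>
      (v \<in> breaking_vertices G H - S \<longrightarrow> b ` Y v \<noteq> X {v})" for v
  proof (cases "E v \<noteq> {} \<and> v \<in> vertices G")
    case True
    then obtain e where e: "e \<in> edges G" "source G e = v" "erange G e \<notin> H" by (auto simp: E_def out_edges_def)
    have "{v} \<notin> H" using assms(2) e by (auto simp: admissible_pair_def hereditary_def)
    then have v: "{v} \<in> ?\<G> - H" using True by (auto intro: gen_vertices.intros)
    have "erange G e \<in> ?\<G> - H" using e by (auto intro: gen_vertices.intros)
    then have "infinite (Pair e ` X (erange G e))" using X_inf by (subst finite_image_iff) (auto simp: inj_on_def)
    moreover have "Pair e ` X (erange G e) \<subseteq> Y v" using e by (auto simp: Y_def E_def out_edges_def)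
    ultimately have Yi: "infinite (Y v)" using finite_subset by blast
    have "countable (E v)" using countable_edges by (rule countable_subset[rotated]) (auto simp: E_def out_edges_def)
    then have Yc: "countable (Y v)" unfolding Y_def using X_count by auto
    obtain x0 where x0: "x0 \<in> X {v}" using X_inf[OF v] by (metis finite.emptyI all_not_in_conv)
    \<comment> \<open>One point is left uncovered exactly at the gap vertices.\<close>
    define Z where "Z = (if v \<in> breaking_vertices G H - S then X {v} - {x0} else X {v})"
    have "infinite Z" "countable Z" using X_inf[OF v] X_count[of "{v}"] by (auto simp: Z_def)
    then obtain b where "bij_betw b (Y v) Z" using countable_infinite_bij[OF Yc Yi] by blast
    then have "inj_on b (Y v)" "b ` Y v = Z" by (auto simp: bij_betw_def)
    then show ?thesis using x0 by (intro exI[of _ b]) (auto simp: Z_def)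
  qed auto
  then obtain b where b: "\<And>v. E v \<noteq> {} \<Longrightarrow> v \<in> vertices G \<Longrightarrow> inj_on (b v) (Y v) \<and> b v ` Y v \<subseteq> X {v} \<and>
      (v \<notin> breaking_vertices G H - S \<longrightarrow> b v ` Y v = X {v}) \<and>
      (v \<in> breaking_vertices G H - S \<longrightarrow> b v ` Y v \<noteq> X {v})"
    by metis
  define f where "f e x = b (source G e) (e, x)" for e x
  have src: "e \<in> E (source G e)" if "e \<in> edges G" "erange G e \<notin> H" for e
    using that by (auto simp: E_def out_edges_def)
  have f_image: "f e ` X (erange G e) \<subseteq> X {source G e}" and f_inj: "inj_on (f e) (X (erange G e))"
    if e: "e \<in> edges G" for e
  proof -
    have "f e ` X (erange G e) \<subseteq> X {source G e} \<and> inj_on (f e) (X (erange G e))"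
    proof (cases "erange G e \<in> H")
      case False
      then have "E (source G e) \<noteq> {}" using src e by blast
      then have injb: "inj_on (b (source G e)) (Y (source G e))"
        and imb: "b (source G e) ` Y (source G e) \<subseteq> X {source G e}"
        using b source_closed[OF e] by blast+
      have mem: "(e, x) \<in> Y (source G e)" if "x \<in> X (erange G e)" for x
        using that src[OF e False] by (simp add: Y_def)
      have "inj_on (f e) (X (erange G e))"
      proof (rule inj_onI)
        fix x y assume "x \<in> X (erange G e)" "y \<in> X (erange G e)" "f e x = f e y"
        then show "x = y" using inj_onD[OF injb _ mem mem] unfolding f_def by blast
      qed
      moreover have "f e x \<in> X {source G e}" if "x \<in> X (erange G e)" for x
        using imb mem[OF that] unfolding f_def by blast
      ultimately show ?thesis by blast
    qed (simp add: X_null)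
    then show "f e ` X (erange G e) \<subseteq> X {source G e}" "inj_on (f e) (X (erange G e))" by auto
  qed
  have Y_image: "(\<Union>e\<in>E v. f e ` X (erange G e)) = b v ` Y v" for v
    by (force simp: f_def Y_def E_def out_edges_def)
  have X_union: "X (A \<union> B) = X A \<union> X B" and X_inter: "X (A \<inter> B) = X A \<inter> X B"
    if "A \<in> ?\<G>" "B \<in> ?\<G>" for A B
    using U(2)[OF _ that] U(3)[OF _ that] unfolding X_def by blast+
  have X_disj: "X {v} \<inter> X {v'} = {}" if "v \<in> vertices G" "v' \<in> vertices G" "v \<noteq> v'" for v v'
  proof -
    have "X ({v} \<inter> {v'}) = X {v} \<inter> X {v'}"
      using that by (intro X_inter) (auto intro: gen_vertices.singleton)
    then show ?thesis using that X_null[OF her(2)] by simp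
  qed
  have "branching_system G H S X f"
  proof (intro branching_system.intro branching_system_axioms.intro assms)
    fix A B assume "A \<in> ?\<G>" "B \<in> ?\<G>"
    then show "X (A \<union> B) = X A \<union> X B" "X (A \<inter> B) = X A \<inter> X B" by (fact X_union, fact X_inter)
  next
    fix A assume "A \<in> ?\<G> - H" then show "X A \<noteq> {}" using X_inf by fastforce
  next
    fix e e' assume e: "e \<in> edges G" "e' \<in> edges G" "e \<noteq> e'"
    show "f e ` X (erange G e) \<inter> f e' ` X (erange G e') = {}"
    proof (cases "source G e = source G e' \<and> erange G e \<notin> H \<and> erange G e' \<notin> H")
      case True
      then have "E (source G e) \<noteq> {}" using src e by blast
      then have inj: "inj_on (b (source G e)) (Y (source G e))" using b source_closed e by blast
      have "(e, x) \<in> Y (source G e)" if "x \<in> X (erange G e)" for x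
        using that src[OF e(1)] True by (simp add: Y_def)
      moreover have "(e', x) \<in> Y (source G e)" if "x \<in> X (erange G e')" for x
        using that src[OF e(2)] True by (simp add: Y_def)
      ultimately have "f e x \<noteq> f e' x'" if "x \<in> X (erange G e)" "x' \<in> X (erange G e')" for x x'
        using inj_onD[OF inj, of "(e, x)" "(e', x')"] that e(3) True by (auto simp: f_def)
      then show ?thesis by blast
    next
      case False
      then show ?thesis
        using X_disj[of "source G e" "source G e'"] f_image[OF e(1)] f_image[OF e(2)] source_closed e X_null
        by auto
    qed
  next
    fix v assume "v \<in> vertices G" "v \<notin> breaking_vertices G H - S" "{e \<in> out_edges G v. erange G e \<notin> H} \<noteq> {}"
    then show "X {v} \<subseteq> (\<Union>e\<in>{e \<in> out_edges G v. erange G e \<notin> H}. f e ` X (erange G e))"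
      using b[of v] Y_image[of v] by (simp add: E_def)
  next
    fix w assume w: "w \<in> breaking_vertices G H - S"
    then have "E w \<noteq> {}" "w \<in> vertices G" by (auto simp: breaking_vertices_def E_def)
    then have "b w ` Y w \<noteq> X {w}" "b w ` Y w \<subseteq> X {w}" using b[of w] w by auto
    moreover have "(\<Union>e\<in>out_edges G w. f e ` X (erange G e)) = (\<Union>e\<in>E w. f e ` X (erange G e))"
      using X_null by (auto simp: E_def)
    ultimately show "\<not> X {w} \<subseteq> (\<Union>e\<in>out_edges G w. f e ` X (erange G e))" using Y_image[of w] by auto
  next
    fix A assume "A \<in> H" then show "X A = {}" by (rule X_null)
  next
    fix e assume e: "e \<in> edges G"
    show "inj_on (f e) (X (erange G e))" by (rule f_inj[OF e])
    show "f e ` X (erange G e) \<subseteq> X {source G e}" by (rule f_image[OF e])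
  qed
  then show ?thesis by blast
qed

section \<open>The representation on functions\<close>

lemma poly_mapping_decompose:
  fixes x :: "'a \<Rightarrow>\<^sub>0 'b::comm_monoid_add"
  shows "x = (\<Sum>w\<in>Poly_Mapping.keys x. Poly_Mapping.single w (Poly_Mapping.lookup x w))"
proof (rule poly_mapping_eqI)
  fix w
  show "Poly_Mapping.lookup x w =
      Poly_Mapping.lookup (\<Sum>w\<in>Poly_Mapping.keys x. Poly_Mapping.single w (Poly_Mapping.lookup x w)) w"
    by (simp add: lookup_sum lookup_single when_def in_keys_iff)
qed

context branching_system
begin

text \<open>Edges push functions forward along \<open>f e\<close> and ghosts pull them back. The
  integer coordinate makes the grading visible: edges raise the degree of the support by one, ghosts
  lower it.\<close>

primrec opr :: "('v, 'e) generator \<Rightarrow> ('x \<times> int \<Rightarrow> 'k::field) \<Rightarrow> 'x \<times> int \<Rightarrow> 'k" where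
  "opr (Proj A) \<phi> = (\<lambda>(x, d). if x \<in> X A then \<phi> (x, d) else 0)"
| "opr (Edge e) \<phi> = (\<lambda>(x, d). if x \<in> f e ` X (erange G e)
     then \<phi> (the_inv_into (X (erange G e)) (f e) x, d - 1) else 0)"
| "opr (Ghost e) \<phi> = (\<lambda>(x, d). if x \<in> X (erange G e) then \<phi> (f e x, d + 1) else 0)"

definition opw :: "('v, 'e) generator word \<Rightarrow> ('x \<times> int \<Rightarrow> 'k::field) \<Rightarrow> 'x \<times> int \<Rightarrow> 'k" where
  "opw w = foldr opr (letters w)"

definition rep :: "('v, 'e, 'k::field) free_elem \<Rightarrow> ('x \<times> int \<Rightarrow> 'k) \<Rightarrow> 'x \<times> int \<Rightarrow> 'k" where
  "rep y \<phi> z = (\<Sum>w\<in>Poly_Mapping.keys y. Poly_Mapping.lookup y w * opw w \<phi> z)"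

lemma opr_sum: "opr g (\<lambda>z. \<Sum>i\<in>I. c i * \<phi> i z) z = (\<Sum>i\<in>I. c i * opr g (\<phi> i) z)"
  by (cases g; cases z) auto

lemma opw_sum: "opw w (\<lambda>z. \<Sum>i\<in>I. c i * \<phi> i z) z = (\<Sum>i\<in>I. c i * opw w (\<phi> i) z)"
proof -
  have "foldr opr gs (\<lambda>z. \<Sum>i\<in>I. c i * \<phi> i z) = (\<lambda>z. \<Sum>i\<in>I. c i * foldr opr gs (\<phi> i) z)" for gs
  proof (induction gs)
    case (Cons g gs)
    show ?case by (rule ext) (simp add: Cons opr_sum)
  qed simp
  then show ?thesis by (simp add: opw_def)
qed

lemma rep_superset:
  assumes "finite W" "Poly_Mapping.keys y \<subseteq> W"
  shows "rep y \<phi> z = (\<Sum>w\<in>W. Poly_Mapping.lookup y w * opw w \<phi> z)"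
  unfolding rep_def using assms by (intro sum.mono_neutral_left) (auto simp: in_keys_iff)

lemma rep_add: "rep (x + y) \<phi> z = rep x \<phi> z + rep y \<phi> z"
proof -
  let ?W = "Poly_Mapping.keys x \<union> Poly_Mapping.keys y"
  have "Poly_Mapping.keys (x + y) \<subseteq> ?W" by (rule Poly_Mapping.keys_add)
  then show ?thesis
    using rep_superset[of ?W "x + y" \<phi> z] rep_superset[of ?W x \<phi> z] rep_superset[of ?W y \<phi> z]
    by (simp add: lookup_add algebra_simps sum.distrib)
qed

lemma rep_zero [simp]: "rep 0 \<phi> z = 0"
  by (simp add: rep_def)

lemma rep_minus: "rep (x - y) \<phi> z = rep x \<phi> z - rep y \<phi> z"
  using rep_add[of "x - y" y \<phi> z] by simp

lemma rep_uminus: "rep (- x) \<phi> z = - rep x \<phi> z"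
  using rep_minus[of 0 x \<phi> z] by simp

lemma rep_sum: "rep (sum h I) \<phi> z = (\<Sum>i\<in>I. rep (h i) \<phi> z)"
  by (induction I rule: infinite_finite_induct) (simp_all add: rep_add)

lemma rep_single: "rep (Poly_Mapping.single w c) \<phi> z = c * opw w \<phi> z"
  using rep_superset[of "{w}" "Poly_Mapping.single w c" \<phi> z] by simp

lemma rep_gen [simp]: "rep (gen g) \<phi> = opr g \<phi>"
  by (simp add: fun_eq_iff rep_single opw_def)

lemma opw_plus: "opw (u + v) \<phi> = opw u (opw v \<phi>)"
  by (simp add: opw_def plus_word_def)

lemma rep_mult: "rep (x * y) \<phi> = rep x (rep y \<phi>)"
proof
  fix z
  have "x * y = (\<Sum>u\<in>Poly_Mapping.keys x. Poly_Mapping.single u (Poly_Mapping.lookup x u)) *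
      (\<Sum>v\<in>Poly_Mapping.keys y. Poly_Mapping.single v (Poly_Mapping.lookup y v))"
    using poly_mapping_decompose[of x] poly_mapping_decompose[of y] by simp
  also have "\<dots> = (\<Sum>u\<in>Poly_Mapping.keys x. \<Sum>v\<in>Poly_Mapping.keys y.
      Poly_Mapping.single (u + v) (Poly_Mapping.lookup x u * Poly_Mapping.lookup y v))"
    by (simp add: sum_product mult_single)
  finally have "rep (x * y) \<phi> z = (\<Sum>u\<in>Poly_Mapping.keys x. \<Sum>v\<in>Poly_Mapping.keys y.
      Poly_Mapping.lookup x u * Poly_Mapping.lookup y v * opw u (opw v \<phi>) z)"
    by (simp add: rep_sum rep_single opw_plus)
  also have "\<dots> = (\<Sum>u\<in>Poly_Mapping.keys x. Poly_Mapping.lookup x u * opw u (rep y \<phi>) z)"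
  proof -
    have "rep y \<phi> = (\<lambda>z. \<Sum>v\<in>Poly_Mapping.keys y. Poly_Mapping.lookup y v * opw v \<phi> z)"
      by (rule ext) (simp add: rep_def)
    then show ?thesis by (simp add: opw_sum sum_distrib_left mult.assoc)
  qed
  finally show "rep (x * y) \<phi> z = rep x (rep y \<phi>) z" by (simp add: rep_def)
qed

lemma rep_fun_zero [simp]: "rep x (\<lambda>_. 0 :: 'k::field) = (\<lambda>_. 0)"
proof
  fix z
  have "opw w (\<lambda>_. 0 :: 'k) z = 0" for w using opw_sum[of w _ _ "{}" z] by simp
  then show "rep x (\<lambda>_. 0) z = 0" by (simp add: rep_def)
qed

lemma opr_Edge_Ghost: 
  assumes "e \<in> edges G"
  shows "opr (Edge e) (opr (Ghost e) \<phi>) (x, d) = (if x \<in> f e ` X (erange G e) then \<phi> (x, d) else 0)"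
proof (cases "x \<in> f e ` X (erange G e)")
  case True
  then obtain y where y: "y \<in> X (erange G e)" "x = f e y" by blast
  then show ?thesis using the_inv_into_f_f[OF f_inj[OF assms] y(1)] by auto
qed simp

text \<open>\<open>s_e s_e^*\<close> acts as the indicator of the image of \<open>f e\<close>, and
  these images are disjoint.\<close>

lemma rep_edge_sum:
  fixes \<phi> :: "'x \<times> int \<Rightarrow> 'k::field"
  assumes "finite F" "F \<subseteq> edges G"
  shows "rep (\<Sum>e\<in>F. gen (Edge e) * gen (Ghost e)) \<phi> (x, d) =
    (if x \<in> (\<Union>e\<in>F. f e ` X (erange G e)) then \<phi> (x, d) else 0)"
proof -
  have "rep (\<Sum>e\<in>F. gen (Edge e) * gen (Ghost e)) \<phi> (x, d) =
      (\<Sum>e\<in>F. if x \<in> f e ` X (erange G e) then \<phi> (x, d) else 0)"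
    unfolding rep_sum rep_mult rep_gen
  proof (rule sum.cong[OF refl])
    fix e assume "e \<in> F"
    then have "e \<in> edges G" using assms by blast
    then show "opr (Edge e) (opr (Ghost e) \<phi>) (x, d) = (if x \<in> f e ` X (erange G e) then \<phi> (x, d) else 0)"
      by (rule opr_Edge_Ghost)
  qed
  also have "\<dots> = (if x \<in> (\<Union>e\<in>F. f e ` X (erange G e)) then \<phi> (x, d) else 0)"
    using assms
  proof (induction F rule: finite_induct)
    case (insert e F)
    have "x \<notin> (\<Union>e'\<in>F. f e' ` X (erange G e'))" if "x \<in> f e ` X (erange G e)"
    proof
      assume "x \<in> (\<Union>e'\<in>F. f e' ` X (erange G e'))"
      then obtain e' where "e' \<in> F" "x \<in> f e' ` X (erange G e')" by blast
      then show False using f_disjoint[of e e'] that insert.hyps(2) insert.prems by blast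
    qed
    then show ?case using insert by auto
  qed simp
  finally show ?thesis .
qed

lemma edge_images:
  assumes "F \<subseteq> out_edges G v" shows "(\<Union>e\<in>F. f e ` X (erange G e)) \<subseteq> X {v}"
proof (rule UN_least)
  fix e assume "e \<in> F"
  then have "e \<in> edges G" "source G e = v" using assms by (auto simp: out_edges_def)
  then show "f e ` X (erange G e) \<subseteq> X {v}" using f_source by blast
qed

lemma X_empty [simp]: "X {} = {}"
  using adm X_null by (auto simp: admissible_pair_def hereditary_def)

lemma rep_relators:
  assumes "r \<in> relators K G"
  shows "rep r \<phi> z = 0"
proof -
  obtain x d where z: "z = (x, d)" by (cases z)
  have src: "x \<in> X {source G e}" if "e \<in> edges G" "x \<in> f e ` X (erange G e)" for e x
    using f_source that by blast
  have inv_in: "the_inv_into (X (erange G e)) (f e) x \<in> X (erange G e)"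
    if "e \<in> edges G" "x \<in> f e ` X (erange G e)" for e x
    using the_inv_into_into[OF f_inj that(2) subset_refl] that by simp
  have img: "f e x \<in> f e' ` X (erange G e') \<longleftrightarrow> e = e'"
    if "e \<in> edges G" "e' \<in> edges G" "x \<in> X (erange G e)" for e e' x
    using f_disjoint[of e e'] that by blast
  have sgl: "{source G e} \<in> gen_vertices G" if "e \<in> edges G" for e
    using source_closed[OF that] by (rule gen_vertices.singleton)
  have inv_f: "the_inv_into (X (erange G e)) (f e) (f e x) = x" if "e \<in> edges G" "x \<in> X (erange G e)" for e x
    using the_inv_into_f_f[OF f_inj] that by simp
  consider (1) "r = gen (Proj {})"
    | (2) A B where "r = gen (Proj A) * gen (Proj B) - gen (Proj (A \<inter> B))" "A \<in> gen_vertices G" "B \<in> gen_vertices G"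
    | (3) A B where "r = gen (Proj (A \<union> B)) - (gen (Proj A) + gen (Proj B) - gen (Proj (A \<inter> B)))"
        "A \<in> gen_vertices G" "B \<in> gen_vertices G"
    | (4) e where "r = gen (Proj {source G e}) * gen (Edge e) - gen (Edge e)" "e \<in> edges G"
    | (5) e where "r = gen (Edge e) * gen (Proj (erange G e)) - gen (Edge e)" "e \<in> edges G"
    | (6) e where "r = gen (Proj (erange G e)) * gen (Ghost e) - gen (Ghost e)" "e \<in> edges G"
    | (7) e where "r = gen (Ghost e) * gen (Proj {source G e}) - gen (Ghost e)" "e \<in> edges G"
    | (8) e e' where "r = gen (Ghost e) * gen (Edge e') - (if e = e' then gen (Proj (erange G e)) else 0)"
        "e \<in> edges G" "e' \<in> edges G"
    | (9) v where "r = gen (Proj {v}) - (\<Sum>e \<in> out_edges G v. gen (Edge e) * gen (Ghost e))"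
        "v \<in> vertices G" "out_edges G v \<noteq> {}" "finite (out_edges G v)"
    using assms unfolding relators_def by blast
  then show ?thesis
  proof cases
    case 1
    then show ?thesis by (simp add: z)
  next
    case (2 A B)
    then show ?thesis by (auto simp: z rep_minus rep_mult X_inter)
  next
    case (3 A B)
    then show ?thesis by (auto simp: z rep_minus rep_add X_inter X_union)
  next
    case (4 e)
    then show ?thesis using src by (auto simp: z rep_minus rep_mult)
  next
    case (5 e)
    then show ?thesis using inv_in by (auto simp: z rep_minus rep_mult)
  next
    case (6 e)
    then show ?thesis by (auto simp: z rep_minus rep_mult)
  next
    case (7 e)
    then show ?thesis using src by (auto simp: z rep_minus rep_mult)
  next
    case (8 e e')
    then show ?thesis using img inv_f by (auto simp: z rep_minus rep_mult)
  next
    case (9 v)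
    have F: "out_edges G v \<subseteq> edges G" by (auto simp: out_edges_def)
    \<comment> \<open>At a vertex with finitely many edges their images must exhaust
      \<open>X {v}\<close>. If \<open>{v} \<notin> H\<close>, saturation supplies an edge with range
      outside \<open>H\<close> and the vertex is not breaking, so \<open>covered\<close> applies; if
      \<open>{v} \<in> H\<close>, both sides are empty.\<close>
    have "X {v} = (\<Union>e\<in>out_edges G v. f e ` X (erange G e))"
    proof (cases "{v} \<in> H")
      case True
      then show ?thesis using edge_images[OF subset_refl] X_null by auto
    next
      case False
      then have "{e \<in> out_edges G v. erange G e \<notin> H} \<noteq> {}"
        using adm 9 unfolding admissible_pair_def saturated_def by blast
      moreover have "v \<notin> breaking_vertices G H" using 9 by (auto simp: breaking_vertices_def)
      ultimately have "X {v} \<subseteq> (\<Union>e\<in>{e \<in> out_edges G v. erange G e \<notin> H}. f e ` X (erange G e))"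
        using covered 9 by blast
      then show ?thesis using edge_images[OF subset_refl] by blast
    qed
    then show ?thesis using rep_edge_sum[OF 9(4) F, of \<phi> x d] by (simp add: 9(1) z rep_minus)
  qed
qed

end

section \<open>The quotient by a graded ideal\<close>

context rng_ideal
begin

lemma abelian_subgroup: "abelian_subgroup I R"
  by (simp add: abelian_group_axioms abelian_subgroupI3 is_additive_subgroup)

lemma coset_eq_iff:
  assumes "x \<in> carrier R" "y \<in> carrier R"
  shows "I +> x = I +> y \<longleftrightarrow> x \<ominus> y \<in> I"
proof -
  interpret S: abelian_subgroup I R by (rule abelian_subgroup)
  show ?thesis
    using S.a_rcos_module[OF assms(2,1)] S.a_rcos_self[OF assms(1)] S.a_repr_independence'[of x y] assms
    by (auto simp: a_minus_def)
qed

lemma coset_carrier: "carrier (R Quot I) = (\<lambda>x. I +> x) ` carrier R"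
  by (auto simp: FactRing_def A_RCOSETS_def')

lemma coset_add: "x \<in> carrier R \<Longrightarrow> y \<in> carrier R \<Longrightarrow> (I +> x) \<oplus>\<^bsub>R Quot I\<^esub> (I +> y) = I +> (x \<oplus> y)"
  using abelian_subgroup.a_rcos_sum[OF abelian_subgroup] by (simp add: FactRing_def)

lemma coset_mult:
  assumes x: "x \<in> carrier R" and y: "y \<in> carrier R"
  shows "(I +> x) \<otimes>\<^bsub>R Quot I\<^esub> (I +> y) = I +> (x \<otimes> y)"
proof -
  interpret S: abelian_subgroup I R by (rule abelian_subgroup)
  have "I +> (a \<otimes> b) = I +> (x \<otimes> y)" if a: "a \<in> I +> x" and b: "b \<in> I +> y" for a b
  proof -
    obtain i j where ij: "i \<in> I" "a = i \<oplus> x" "j \<in> I" "b = j \<oplus> y"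
      using a b by (auto simp: a_r_coset_def')
    then have c: "i \<in> carrier R" "j \<in> carrier R" by auto
    have "a \<otimes> b = (i \<otimes> b \<oplus> x \<otimes> j) \<oplus> x \<otimes> y"
      using x y c by (simp add: ij l_distr r_distr m_closed a_ac)
    then have "a \<otimes> b \<ominus> x \<otimes> y = i \<otimes> b \<oplus> x \<otimes> j"
      using x y c by (simp add: ij a_minus_def a_assoc r_neg m_closed)
    moreover have "i \<otimes> b \<oplus> x \<otimes> j \<in> I" using x y c ij I_l_closed I_r_closed by simp
    ultimately show ?thesis using coset_eq_iff[of "a \<otimes> b" "x \<otimes> y"] x y c m_closed ij by simp
  qed
  moreover have "x \<in> I +> x" "y \<in> I +> y" using S.a_rcos_self x y by auto
  ultimately have "rcoset_mult R I (I +> x) (I +> y) = I +> (x \<otimes> y)"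
    unfolding rcoset_mult_def by blast
  then show ?thesis by (simp add: FactRing_def)
qed

lemma coset_zero_iff: "x \<in> carrier R \<Longrightarrow> I +> x = \<zero>\<^bsub>R Quot I\<^esub> \<longleftrightarrow> x \<in> I"
  using coset_eq_iff[of x \<zero>] abelian_subgroup.a_rcos_const[OF abelian_subgroup additive_subgroup.zero_closed[OF is_additive_subgroup]]
    minus_equality[of \<zero> \<zero>]
  by (simp add: FactRing_def a_minus_def)

end

locale branching_representation = branching_system G H S X f
  for G :: "('v, 'e) ultragraph" and H S and X :: "'v set \<Rightarrow> 'x set" and f +
  fixes K :: "'k::field itself"
begin

abbreviation "F \<equiv> free_algebra K G"
abbreviation "N \<equiv> relation_ideal K G"
abbreviation "L \<equiv> leavitt_path_algebra K G"
abbreviation "J \<equiv> graded_ideal K G H S"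
abbreviation "Q \<equiv> leavitt_path_algebra K G Quot graded_ideal K G H S"

definition coset :: "('v, 'e, 'k) free_elem \<Rightarrow> ('v, 'e, 'k) free_elem set" where
  "coset x = N +>\<^bsub>F\<^esub> x"

text \<open>Both quotients are passed at once, so that computations in \<open>Q\<close> take place
  in the free algebra.\<close>

definition proj :: "('v, 'e, 'k) free_elem \<Rightarrow> ('v, 'e, 'k) free_elem set set" where
  "proj x = J +>\<^bsub>L\<^esub> coset x"

sublocale N: rng_ideal "relation_ideal K G" "free_algebra K G"
  by (rule rng_ideal_relation_ideal[OF ultragraph_axioms])

sublocale J: rng_ideal "graded_ideal K G H S" "leavitt_path_algebra K G"
  by (rule rng_ideal_graded_ideal[OF ultragraph_axioms adm])

sublocale Q: rng "leavitt_path_algebra K G Quot graded_ideal K G H S"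
  by (rule J.quotient_is_rng)

lemma N_zero: "0 \<in> N"
  using additive_subgroup.zero_closed[OF N.is_additive_subgroup] by simp

lemma J_zero: "\<zero>\<^bsub>L\<^esub> \<in> J"
  by (rule additive_subgroup.zero_closed[OF J.is_additive_subgroup])

lemma coset_closed: "x \<in> carrier F \<Longrightarrow> coset x \<in> carrier L"
  by (simp add: coset_def leavitt_path_algebra_def N.coset_carrier)

lemma coset_surj: "y \<in> carrier L \<Longrightarrow> \<exists>x\<in>carrier F. y = coset x"
  by (auto simp: coset_def leavitt_path_algebra_def N.coset_carrier)

lemma coset_add: "x \<in> carrier F \<Longrightarrow> y \<in> carrier F \<Longrightarrow> coset x \<oplus>\<^bsub>L\<^esub> coset y = coset (x + y)"
  using N.coset_add by (simp add: coset_def leavitt_path_algebra_def)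

lemma coset_mult: "x \<in> carrier F \<Longrightarrow> y \<in> carrier F \<Longrightarrow> coset x \<otimes>\<^bsub>L\<^esub> coset y = coset (x * y)"
  using N.coset_mult by (simp add: coset_def leavitt_path_algebra_def)

lemma coset_zero_iff: "x \<in> carrier F \<Longrightarrow> coset x = \<zero>\<^bsub>L\<^esub> \<longleftrightarrow> x \<in> N"
  using N.coset_zero_iff by (simp add: coset_def leavitt_path_algebra_def)

lemma coset_zero: "coset 0 = \<zero>\<^bsub>L\<^esub>"
  using coset_zero_iff[of 0] N_zero free_algebra_closed(1) by simp

lemma coset_minus:
  assumes "x \<in> carrier F" "y \<in> carrier F"
  shows "coset x \<ominus>\<^bsub>L\<^esub> coset y = coset (x - y)"
proof -
  have "coset (- y) \<oplus>\<^bsub>L\<^esub> coset y = \<zero>\<^bsub>L\<^esub>"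
    using assms by (simp add: coset_add free_algebra_closed coset_zero)
  then have "\<ominus>\<^bsub>L\<^esub> coset y = coset (- y)"
    using assms by (intro J.minus_equality) (auto intro: coset_closed free_algebra_closed)
  then show ?thesis using assms by (simp add: a_minus_def coset_add free_algebra_closed)
qed

lemma sum_closed: "(\<And>i. i \<in> A \<Longrightarrow> h i \<in> carrier F) \<Longrightarrow> sum h A \<in> carrier F"
  by (induction A rule: infinite_finite_induct) (auto intro: free_algebra_closed)

lemma coset_sum:
  assumes "finite A" "\<And>i. i \<in> A \<Longrightarrow> h i \<in> carrier F"
  shows "coset (sum h A) = (\<Oplus>\<^bsub>L\<^esub>i\<in>A. coset (h i))"
  using assms
proof (induction A rule: finite_induct)
  case (insert i A)
  then have "(\<Oplus>\<^bsub>L\<^esub>i\<in>insert i A. coset (h i)) = coset (h i) \<oplus>\<^bsub>L\<^esub> (\<Oplus>\<^bsub>L\<^esub>i\<in>A. coset (h i))"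
    by (intro J.finsum_insert) (auto intro: coset_closed)
  then show ?case using insert by (simp add: sum_closed flip: coset_add)
qed (simp add: coset_zero)

lemma proj_closed: "x \<in> carrier F \<Longrightarrow> proj x \<in> carrier Q"
  by (simp add: proj_def J.coset_carrier coset_closed)

lemma proj_surj: "y \<in> carrier Q \<Longrightarrow> \<exists>x\<in>carrier F. y = proj x"
  using coset_surj by (auto simp: proj_def J.coset_carrier)

lemma proj_add: "x \<in> carrier F \<Longrightarrow> y \<in> carrier F \<Longrightarrow> proj x \<oplus>\<^bsub>Q\<^esub> proj y = proj (x + y)"
  by (simp add: proj_def J.coset_add coset_closed coset_add)

lemma proj_mult: "x \<in> carrier F \<Longrightarrow> y \<in> carrier F \<Longrightarrow> proj x \<otimes>\<^bsub>Q\<^esub> proj y = proj (x * y)"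
  by (simp add: proj_def J.coset_mult coset_closed coset_mult)

lemma proj_zero_iff: "x \<in> carrier F \<Longrightarrow> proj x = \<zero>\<^bsub>Q\<^esub> \<longleftrightarrow> coset x \<in> J"
  by (simp add: proj_def J.coset_zero_iff coset_closed)

lemma proj_zero: "proj 0 = \<zero>\<^bsub>Q\<^esub>"
  by (simp add: proj_zero_iff free_algebra_closed coset_zero J_zero)

lemma proj_relation: "x \<in> N \<Longrightarrow> proj x = \<zero>\<^bsub>Q\<^esub>"
  using proj_zero_iff[of x] coset_zero_iff[of x] J_zero N.a_Hcarr[of x] by auto

lemma proj_minus:
  assumes "x \<in> carrier F" "y \<in> carrier F"
  shows "proj x \<ominus>\<^bsub>Q\<^esub> proj y = proj (x - y)"
proof -
  have "proj (- y) \<oplus>\<^bsub>Q\<^esub> proj y = \<zero>\<^bsub>Q\<^esub>"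
    using assms by (simp add: proj_add free_algebra_closed proj_zero)
  then have "\<ominus>\<^bsub>Q\<^esub> proj y = proj (- y)"
    using assms by (intro Q.minus_equality) (auto intro: proj_closed free_algebra_closed)
  then show ?thesis using assms by (simp add: a_minus_def proj_add free_algebra_closed)
qed

lemma proj_eqI: "x \<in> carrier F \<Longrightarrow> y \<in> carrier F \<Longrightarrow> proj (x - y) = \<zero>\<^bsub>Q\<^esub> \<Longrightarrow> proj x = proj y"
  using proj_minus[of x y] Q.diff_eq_zero_iff[of "proj x" "proj y"] proj_closed by simp

lemma proj_sum:
  assumes "finite A" "\<And>i. i \<in> A \<Longrightarrow> h i \<in> carrier F"
  shows "proj (sum h A) = (\<Oplus>\<^bsub>Q\<^esub>i\<in>A. proj (h i))"
  using assms
proof (induction A rule: finite_induct)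
  case (insert i A)
  then have "(\<Oplus>\<^bsub>Q\<^esub>i\<in>insert i A. proj (h i)) = proj (h i) \<oplus>\<^bsub>Q\<^esub> (\<Oplus>\<^bsub>Q\<^esub>i\<in>A. proj (h i))"
    by (intro Q.finsum_insert) (auto intro: proj_closed)
  then show ?case using insert by (simp add: sum_closed flip: proj_add)
qed (simp add: proj_zero)

lemma relators_N: "relators K G \<subseteq> N"
  unfolding relation_ideal_def by blast

lemma N_scalar: "x \<in> N \<Longrightarrow> Poly_Mapping.single 0 c * x \<in> N"
  unfolding relation_ideal_def by blast

text \<open>The relation ideal is closed under scalars, so each relation holds with an arbitrary
  coefficient, as the axioms about \<open>q k A\<close> demand.\<close>

lemma proj_relator:
  assumes "a - b \<in> relators K G" "a \<in> carrier F" "b \<in> carrier F"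
  shows "proj (Poly_Mapping.single 0 k * a) = proj (Poly_Mapping.single 0 k * b)"
proof (rule proj_eqI)
  have "Poly_Mapping.single 0 k * (a - b) \<in> N" using assms(1) relators_N N_scalar by blast
  then show "proj (Poly_Mapping.single 0 k * a - Poly_Mapping.single 0 k * b) = \<zero>\<^bsub>Q\<^esub>"
    using proj_relation by (simp add: right_diff_distrib)
qed (use assms free_algebra_closed(3) in auto)

lemma single_letter_closed:
  "g \<in> generators G \<Longrightarrow> Poly_Mapping.single (Word [g]) k \<in> carrier F"
  by (simp add: free_algebra_def)

lemma generators_simps [simp]:
  "A \<in> gen_vertices G \<Longrightarrow> Proj A \<in> generators G"
  "e \<in> edges G \<Longrightarrow> Edge e \<in> generators G" "e \<in> edges G \<Longrightarrow> Ghost e \<in> generators G"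
  by (simp_all add: generators_def)

definition qq :: "'k \<Rightarrow> 'v set \<Rightarrow> ('v, 'e, 'k) free_elem set set" where
  "qq k A = proj (Poly_Mapping.single (Word [Proj A]) k)"

definition ss :: "'e \<Rightarrow> ('v, 'e, 'k) free_elem set set" where
  "ss e = proj (gen (Edge e))"

definition tt :: "'e \<Rightarrow> ('v, 'e, 'k) free_elem set set" where
  "tt e = proj (gen (Ghost e))"

lemma qst_closed [simp]:
  "A \<in> gen_vertices G \<Longrightarrow> qq k A \<in> carrier Q" "e \<in> edges G \<Longrightarrow> ss e \<in> carrier Q"
  "e \<in> edges G \<Longrightarrow> tt e \<in> carrier Q"
  by (simp_all add: qq_def ss_def tt_def proj_closed single_letter_closed)

text \<open>The kernel of the representation. It contains the relation ideal, and its image in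
  \<open>L\<close> contains the graded ideal; hence \<open>rep\<close> descends to
  \<open>Q\<close>.\<close>

definition ann :: "('v, 'e, 'k) free_elem set" where
  "ann = {x \<in> carrier F. \<forall>\<phi> z. rep x \<phi> z = 0}"

lemma ann_carrier: "x \<in> ann \<Longrightarrow> x \<in> carrier F" and ann_rep: "x \<in> ann \<Longrightarrow> rep x \<phi> = (\<lambda>_. 0)"
  by (auto simp: ann_def)

lemma annI: "x \<in> carrier F \<Longrightarrow> (\<And>\<phi> z. rep x \<phi> z = 0) \<Longrightarrow> x \<in> ann"
  by (simp add: ann_def)

lemma ann_closed:
  shows "0 \<in> ann" and "x \<in> ann \<Longrightarrow> y \<in> ann \<Longrightarrow> x + y \<in> ann" and "x \<in> ann \<Longrightarrow> - x \<in> ann"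
    and "x \<in> ann \<Longrightarrow> y \<in> carrier F \<Longrightarrow> y * x \<in> ann" and "x \<in> ann \<Longrightarrow> y \<in> carrier F \<Longrightarrow> x * y \<in> ann"
    and "x \<in> ann \<Longrightarrow> Poly_Mapping.single 0 c * x \<in> ann"
  by (auto intro!: annI intro: free_algebra_closed ann_carrier
      simp: ann_rep rep_add rep_uminus rep_mult)

lemma rep_relation:
  assumes "x \<in> N" shows "rep x \<phi> z = 0"
proof -
  have neg: "\<ominus>\<^bsub>F\<^esub> x = - x" if "x \<in> carrier F" for x
    using that by (intro N.minus_equality) (auto intro: free_algebra_closed)
  have "rng_ideal ann F"
    by (rule N.rng_idealI) (auto simp: neg ann_carrier intro: ann_closed)
  moreover have "relators K G \<subseteq> ann"
    using relators_subset_carrier[OF ultragraph_axioms, of K] rep_relators[where K = K] by (auto intro!: annI)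
  ultimately have "N \<subseteq> ann" unfolding relation_ideal_def using ann_closed(6) by blast
  then show ?thesis using assms ann_rep by fastforce
qed

lemma breaking_elem_coset:
  assumes "w \<in> breaking_vertices G H"
  shows "breaking_elem K G H w =
    coset (gen (Proj {w}) - (\<Sum>e\<in>{e \<in> out_edges G w. erange G e \<notin> H}. gen (Edge e) * gen (Ghost e)))"
proof -
  let ?E = "{e \<in> out_edges G w. erange G e \<notin> H}"
  have w: "finite ?E" "{w} \<in> gen_vertices G" and E: "?E \<subseteq> edges G"
    using assms by (auto simp: breaking_vertices_def out_edges_def intro: gen_vertices.singleton)
  have g: "gen (Edge e) \<in> carrier F" "gen (Ghost e) \<in> carrier F" if "e \<in> ?E" for e
    using that E by (auto intro!: single_letter_closed)
  have "(\<Oplus>\<^bsub>L\<^esub>e\<in>?E. lpa_gen K G (Edge e) \<otimes>\<^bsub>L\<^esub> lpa_gen K G (Ghost e)) =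
      (\<Oplus>\<^bsub>L\<^esub>e\<in>?E. coset (gen (Edge e) * gen (Ghost e)))"
    using g by (intro J.finsum_cong') (auto simp: lpa_gen_def coset_mult free_algebra_closed coset_closed simp flip: coset_def)
  also have "\<dots> = coset (\<Sum>e\<in>?E. gen (Edge e) * gen (Ghost e))"
    using w g by (intro coset_sum[symmetric]) (auto intro: free_algebra_closed)
  finally have "breaking_elem K G H w = coset (gen (Proj {w})) \<ominus>\<^bsub>L\<^esub> coset (\<Sum>e\<in>?E. gen (Edge e) * gen (Ghost e))"
    by (simp add: breaking_elem_def lpa_gen_def flip: coset_def)
  also have "\<dots> = coset (gen (Proj {w}) - (\<Sum>e\<in>?E. gen (Edge e) * gen (Ghost e)))"
    using w g by (intro coset_minus sum_closed free_algebra_closed(5)) (auto intro: single_letter_closed)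
  finally show ?thesis .
qed

lemma rep_kernel:
  assumes "x \<in> carrier F" "proj x = \<zero>\<^bsub>Q\<^esub>"
  shows "rep x \<phi> z = 0"
proof -
  have neg: "\<ominus>\<^bsub>L\<^esub> coset x = coset (- x)" if "x \<in> carrier F" for x
    using that by (intro J.minus_equality)
      (auto intro: coset_closed free_algebra_closed simp: coset_add free_algebra_closed coset_zero)
  have "rng_ideal (coset ` ann) L"
  proof (rule J.rng_idealI)
    show "coset ` ann \<subseteq> carrier L" using ann_carrier coset_closed by blast
    show "\<zero>\<^bsub>L\<^esub> \<in> coset ` ann" using ann_closed(1) coset_zero by (metis imageI)
    show "a \<oplus>\<^bsub>L\<^esub> b \<in> coset ` ann" if "a \<in> coset ` ann" "b \<in> coset ` ann" for a b
      using that by (auto simp: coset_add ann_carrier intro: ann_closed)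
    show "\<ominus>\<^bsub>L\<^esub> a \<in> coset ` ann" if "a \<in> coset ` ann" for a
      using that by (auto simp: neg ann_carrier intro: ann_closed)
    fix a y assume "a \<in> coset ` ann" "y \<in> carrier L"
    then obtain m x where "m \<in> ann" "a = coset m" "x \<in> carrier F" "y = coset x" using coset_surj by blast
    then show "y \<otimes>\<^bsub>L\<^esub> a \<in> coset ` ann" "a \<otimes>\<^bsub>L\<^esub> y \<in> coset ` ann"
      by (auto simp: coset_mult ann_carrier intro: ann_closed)
  qed
  moreover have "lpa_gen K G (Proj A) \<in> coset ` ann" if A: "A \<in> H" for A
  proof -
    have "A \<in> gen_vertices G" using A adm by (auto simp: admissible_pair_def hereditary_def)
    then have "gen (Proj A) \<in> ann" using A X_null by (auto simp: single_letter_closed intro!: annI)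
    then show ?thesis by (simp add: lpa_gen_def flip: coset_def)
  qed
  moreover have "breaking_elem K G H w \<in> coset ` ann" if w: "w \<in> S" for w
  proof -
    let ?E = "{e \<in> out_edges G w. erange G e \<notin> H}"
    have bw: "w \<in> breaking_vertices G H" using w adm by (auto simp: admissible_pair_def)
    then have E: "finite ?E" "?E \<noteq> {}" "w \<in> vertices G" "?E \<subseteq> edges G"
      by (auto simp: breaking_vertices_def out_edges_def)
    \<comment> \<open>A vertex of \<open>S\<close> is not a gap vertex, so its edges with range
      outside \<open>H\<close> cover it and \<open>p_w^H\<close> acts as zero.\<close>
    have "X {w} = (\<Union>e\<in>?E. f e ` X (erange G e))"
      using covered[of w] E w edge_images[of ?E w] by blast
    then have "rep (gen (Proj {w}) - (\<Sum>e\<in>?E. gen (Edge e) * gen (Ghost e))) \<phi> z = (0 :: 'k)" for \<phi> z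
      using rep_edge_sum[OF E(1,4), of \<phi>] by (cases z) (simp add: rep_minus)
    moreover have "gen (Proj {w}) - (\<Sum>e\<in>?E. gen (Edge e) * gen (Ghost e)) \<in> carrier F"
      using E by (intro free_algebra_diff_closed sum_closed free_algebra_closed single_letter_closed)
        (auto intro!: generators_simps gen_vertices.singleton)
    ultimately show ?thesis using breaking_elem_coset[OF bw] annI by blast
  qed
  ultimately have "J \<subseteq> coset ` ann" unfolding graded_ideal_def rng_genideal_def by blast
  then obtain m where m: "m \<in> ann" "coset x = coset m" using assms proj_zero_iff by auto
  then have "x - m \<in> N"
    using coset_minus[of x m] assms(1) ann_carrier[OF m(1)] coset_zero_iff[of "x - m"] coset_closed[of m]
      free_algebra_diff_closed[of x K G m] by (auto simp: a_minus_def J.r_neg)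
  then have "rep (x - m) \<phi> z = 0" by (rule rep_relation)
  then show ?thesis using ann_rep[OF m(1)] by (simp add: rep_minus)
qed

text \<open>Any representative gives the same operator, by \<open>rep_kernel\<close>.\<close>

definition act :: "('v, 'e, 'k) free_elem set set \<Rightarrow> ('x \<times> int \<Rightarrow> 'k) \<Rightarrow> 'x \<times> int \<Rightarrow> 'k" where
  "act a = rep (SOME x. x \<in> carrier F \<and> proj x = a)"

lemma act_proj: "x \<in> carrier F \<Longrightarrow> act (proj x) = rep x"
proof -
  assume x: "x \<in> carrier F"
  define y where "y = (SOME y. y \<in> carrier F \<and> proj y = proj x)"
  have y: "y \<in> carrier F \<and> proj y = proj x" unfolding y_def by (rule someI_ex) (use x in blast)
  then have "proj (y - x) = \<zero>\<^bsub>Q\<^esub>"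
    using x proj_minus[of y x] proj_closed[of x] by (simp add: Q.r_neg a_minus_def)
  then have "rep (y - x) \<phi> z = 0" for \<phi> z
    using rep_kernel y x free_algebra_diff_closed by blast
  then have "rep y = rep x" by (simp add: rep_minus fun_eq_iff)
  then show ?thesis by (simp add: act_def y_def)
qed

lemma act_add: "a \<in> carrier Q \<Longrightarrow> b \<in> carrier Q \<Longrightarrow> act (a \<oplus>\<^bsub>Q\<^esub> b) \<phi> z = act a \<phi> z + act b \<phi> z"
  using proj_surj[of a] proj_surj[of b] by (auto simp: proj_add act_proj free_algebra_closed rep_add)

lemma act_minus: "a \<in> carrier Q \<Longrightarrow> b \<in> carrier Q \<Longrightarrow> act (a \<ominus>\<^bsub>Q\<^esub> b) \<phi> z = act a \<phi> z - act b \<phi> z"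
  using proj_surj[of a] proj_surj[of b] by (auto simp: proj_minus act_proj free_algebra_diff_closed rep_minus)

lemma act_mult: "a \<in> carrier Q \<Longrightarrow> b \<in> carrier Q \<Longrightarrow> act (a \<otimes>\<^bsub>Q\<^esub> b) \<phi> = act a (act b \<phi>)"
  using proj_surj[of a] proj_surj[of b] by (auto simp: proj_mult act_proj free_algebra_closed rep_mult)

lemma act_fun_zero: "a \<in> carrier Q \<Longrightarrow> act a (\<lambda>_. 0) = (\<lambda>_. 0)"
  using proj_surj[of a] by (auto simp: act_proj)

lemma act_q: "A \<in> gen_vertices G \<Longrightarrow> act (qq k A) \<phi> = (\<lambda>(x, d). if x \<in> X A then k * \<phi> (x, d) else 0)"
  by (auto simp: qq_def act_proj single_letter_closed rep_single opw_def fun_eq_iff)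

lemma act_s: "e \<in> edges G \<Longrightarrow> act (ss e) = opr (Edge e)"
  and act_t: "e \<in> edges G \<Longrightarrow> act (tt e) = opr (Ghost e)"
  by (simp_all add: ss_def tt_def act_proj single_letter_closed fun_eq_iff del: opr.simps)

lemma paths_closed:
  assumes "set \<alpha> \<subseteq> edges G" "x \<in> carrier Q"
  shows "lpath Q ss \<alpha> x \<in> carrier Q" "rpath Q tt \<alpha> x \<in> carrier Q"
  using assms by (induction \<alpha>) (simp_all add: Q.m_closed)

end

section \<open>Verification of the axioms for the quotient\<close>

context branching_representation
begin

lemma scalar_letter: "Poly_Mapping.single 0 (k :: 'k) * gen g = Poly_Mapping.single (Word [g]) k"
  by (simp add: mult_single)

lemma scalar_mult: "Poly_Mapping.single 0 (k :: 'k) * (gen g * gen g') = Poly_Mapping.single (Word [g]) k * gen g'"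
  by (simp add: mult_single plus_word_def zero_word_def flip: mult.assoc)

lemma letter_mult:
  "Poly_Mapping.single (Word [g]) (k :: 'k) * Poly_Mapping.single (Word [g']) l =
     Poly_Mapping.single 0 (k * l) * (gen g * gen g')"
  by (simp add: mult_single plus_word_def zero_word_def)

lemma gen_closed:
  "A \<in> gen_vertices G \<Longrightarrow> gen (Proj A) \<in> carrier F" "e \<in> edges G \<Longrightarrow> gen (Edge e) \<in> carrier F"
  "e \<in> edges G \<Longrightarrow> gen (Ghost e) \<in> carrier F"
  by (simp_all add: single_letter_closed)

lemma source_gen: "e \<in> edges G \<Longrightarrow> {source G e} \<in> gen_vertices G"
  using source_closed by (auto intro: gen_vertices.singleton)

text \<open>The scalar multiple \<open>k s_e\<close> is a product inside \<open>Q\<close>, from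
  either side; so scalars can be handled by ring elements.\<close>

lemma letter_Edge: 
  assumes e: "e \<in> edges G"
  shows "proj (Poly_Mapping.single (Word [Edge e]) k) = qq k {source G e} \<otimes>\<^bsub>Q\<^esub> ss e"
    and "proj (Poly_Mapping.single (Word [Edge e]) k) = ss e \<otimes>\<^bsub>Q\<^esub> qq k (erange G e)"
proof -
  note c = gen_closed(2,3)[OF e] gen_closed(1)[OF source_gen[OF e]] gen_closed(1)[OF gen_vertices.erange[OF e]]
  note sc = source_gen[OF e] gen_vertices.erange[OF e]
  have "gen (Proj {source G e}) * gen (Edge e) - gen (Edge e) \<in> relators K G"
    "gen (Edge e) * gen (Proj (erange G e)) - gen (Edge e) \<in> relators K G"
    using e unfolding relators_def by blast+
  then have "proj (Poly_Mapping.single 0 k * (gen (Proj {source G e}) * gen (Edge e))) = proj (Poly_Mapping.single 0 k * gen (Edge e))"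
    "proj (Poly_Mapping.single 0 k * (gen (Edge e) * gen (Proj (erange G e)))) = proj (Poly_Mapping.single 0 k * gen (Edge e))"
    using c by (intro proj_relator free_algebra_closed; simp)+
  then show "proj (Poly_Mapping.single (Word [Edge e]) k) = qq k {source G e} \<otimes>\<^bsub>Q\<^esub> ss e"
    "proj (Poly_Mapping.single (Word [Edge e]) k) = ss e \<otimes>\<^bsub>Q\<^esub> qq k (erange G e)"
    using c sc letter_mult[of "Edge e" 1 "Proj (erange G e)" k] e
    by (simp_all add: qq_def ss_def proj_mult single_letter_closed scalar_letter scalar_mult)
qed

lemma letter_Ghost: 
  assumes e: "e \<in> edges G"
  shows "proj (Poly_Mapping.single (Word [Ghost e]) k) = qq k (erange G e) \<otimes>\<^bsub>Q\<^esub> tt e"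
    and "proj (Poly_Mapping.single (Word [Ghost e]) k) = tt e \<otimes>\<^bsub>Q\<^esub> qq k {source G e}"
proof -
  note c = gen_closed(2,3)[OF e] gen_closed(1)[OF source_gen[OF e]] gen_closed(1)[OF gen_vertices.erange[OF e]]
  note sc = source_gen[OF e] gen_vertices.erange[OF e]
  have "gen (Proj (erange G e)) * gen (Ghost e) - gen (Ghost e) \<in> relators K G"
    "gen (Ghost e) * gen (Proj {source G e}) - gen (Ghost e) \<in> relators K G"
    using e unfolding relators_def by blast+
  then have "proj (Poly_Mapping.single 0 k * (gen (Proj (erange G e)) * gen (Ghost e))) = proj (Poly_Mapping.single 0 k * gen (Ghost e))"
    "proj (Poly_Mapping.single 0 k * (gen (Ghost e) * gen (Proj {source G e}))) = proj (Poly_Mapping.single 0 k * gen (Ghost e))"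
    using c by (intro proj_relator free_algebra_closed; simp)+
  then show "proj (Poly_Mapping.single (Word [Ghost e]) k) = qq k (erange G e) \<otimes>\<^bsub>Q\<^esub> tt e"
    "proj (Poly_Mapping.single (Word [Ghost e]) k) = tt e \<otimes>\<^bsub>Q\<^esub> qq k {source G e}"
    using c sc letter_mult[of "Ghost e" 1 "Proj {source G e}" k] e
    by (simp_all add: qq_def tt_def proj_mult single_letter_closed scalar_letter scalar_mult)
qed

text \<open>The coefficient of a word is absorbed into its first letter, and a scaled letter is
  either some \<open>qq k A\<close> or a product with one; so ring operations alone produce all of
  \<open>Q\<close>.\<close>

lemma generated_by_letters:
  assumes y: "y \<in> carrier Q"
    and q: "\<And>k A. A \<in> gen_vertices G \<Longrightarrow> P (qq k A)"
    and s: "\<And>e. e \<in> edges G \<Longrightarrow> P (ss e)" and t: "\<And>e. e \<in> edges G \<Longrightarrow> P (tt e)"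
    and add: "\<And>x y. x \<in> carrier Q \<Longrightarrow> y \<in> carrier Q \<Longrightarrow> P x \<Longrightarrow> P y \<Longrightarrow> P (x \<oplus>\<^bsub>Q\<^esub> y)"
    and mult: "\<And>x y. x \<in> carrier Q \<Longrightarrow> y \<in> carrier Q \<Longrightarrow> P x \<Longrightarrow> P y \<Longrightarrow> P (x \<otimes>\<^bsub>Q\<^esub> y)"
  shows "P y"
proof -
  have letter: "P (proj (Poly_Mapping.single (Word [g]) k))" if "g \<in> generators G" for g k
    using that
    by (cases g) (auto simp: generators_def letter_Edge(1) letter_Ghost(1) simp flip: qq_def
        intro!: mult q s t source_gen gen_vertices.erange qst_closed)
  have word: "Poly_Mapping.single (Word gs) k \<in> carrier F \<and> P (proj (Poly_Mapping.single (Word gs) k))"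
    if "gs \<noteq> []" "set gs \<subseteq> generators G" for gs k
    using that
  proof (induction gs arbitrary: k rule: list_nonempty_induct)
    case (single g)
    then show ?case using letter single_letter_closed by simp
  next
    case (cons g gs)
    have eq: "Poly_Mapping.single (Word (g # gs)) k =
        Poly_Mapping.single (Word [g]) k * Poly_Mapping.single (Word gs) 1"
      by (simp add: mult_single plus_word_def)
    have c: "Poly_Mapping.single (Word [g]) k \<in> carrier F" "Poly_Mapping.single (Word gs) 1 \<in> carrier F"
      "P (proj (Poly_Mapping.single (Word gs) 1))"
      using cons single_letter_closed by auto
    then have "P (proj (Poly_Mapping.single (Word [g]) k) \<otimes>\<^bsub>Q\<^esub> proj (Poly_Mapping.single (Word gs) 1))"
      using cons.prems letter by (intro mult proj_closed) auto
    then show ?case using c eq by (simp add: proj_mult free_algebra_closed)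
  qed
  have zero: "P (proj 0)"
    using q[OF gen_vertices.empty, of 0] by (simp add: qq_def)
  obtain x where x: "x \<in> carrier F" "y = proj x" using proj_surj[OF y] by blast
  have "sum (\<lambda>w. Poly_Mapping.single w (Poly_Mapping.lookup x w)) W \<in> carrier F \<and>
      P (proj (sum (\<lambda>w. Poly_Mapping.single w (Poly_Mapping.lookup x w)) W))"
    if "finite W" "W \<subseteq> Poly_Mapping.keys x" for W
    using that
  proof (induction W rule: finite_induct)
    case (insert w W)
    have "letters w \<noteq> []" "set (letters w) \<subseteq> generators G"
      using insert.prems x by (auto simp: free_algebra_def)
    then have "Poly_Mapping.single w (Poly_Mapping.lookup x w) \<in> carrier F"
      "P (proj (Poly_Mapping.single w (Poly_Mapping.lookup x w)))"
      using word[of "letters w" "Poly_Mapping.lookup x w"] by simp_all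
    then show ?case
      using insert add proj_closed by (simp add: free_algebra_closed flip: proj_add)
  qed (simp add: zero free_algebra_closed)
  then have "P (proj (\<Sum>w\<in>Poly_Mapping.keys x. Poly_Mapping.single w (Poly_Mapping.lookup x w)))"
    using finite_keys by blast
  then show ?thesis using x by (simp flip: poly_mapping_decompose)
qed

lemma act_lpath:
  assumes "set \<alpha> \<subseteq> edges G" "x \<in> carrier Q"
    and "\<And>z. act x \<phi> z \<noteq> 0 \<Longrightarrow> snd z = m"
  shows "act (lpath Q ss \<alpha> x) \<phi> z \<noteq> 0 \<Longrightarrow> snd z = m + int (length \<alpha>)"
  using assms(1)
proof (induction \<alpha> arbitrary: z)
  case (Cons e \<alpha>)
  then show ?case using paths_closed[of \<alpha> x] assms(2)
    by (cases z) (force simp: act_mult act_s split: if_splits)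
qed (use assms in simp)

text \<open>The ghost of the first edge acts first, so the function and its degree have to vary in
  the induction.\<close>

lemma act_rpath:
  assumes "set \<alpha> \<subseteq> edges G" "A \<in> gen_vertices G"
    and "\<And>z. \<phi> z \<noteq> 0 \<Longrightarrow> snd z = m"
  shows "act (rpath Q tt \<alpha> (qq k A)) \<phi> z \<noteq> 0 \<Longrightarrow> snd z = m - int (length \<alpha>)"
  using assms
proof (induction \<alpha> arbitrary: z \<phi> m)
  case Nil
  then show ?case by (cases z) (auto simp: act_q split: if_splits)
next
  case (Cons e \<alpha>)
  have "act (rpath Q tt \<alpha> (qq k A)) (opr (Ghost e) \<phi>) z \<noteq> 0"
    using Cons.prems paths_closed[of \<alpha> "qq k A"] by (simp add: act_mult act_t del: opr.simps)
  moreover have "snd z = m - 1" if "opr (Ghost e) \<phi> z \<noteq> 0" for z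
    using that Cons.prems(4) by (cases z) (force split: if_splits)
  ultimately show ?case using Cons.IH[of "opr (Ghost e) \<phi>" z "m - 1"] Cons.prems by simp
qed

text \<open>A point mass over a point of \<open>X D\<close> in degree \<open>0\<close> is evaluated
  at the same place: \<open>qq k D\<close> returns \<open>k\<close>, while a path or ghost path of
  positive length has moved the support to another degree.\<close>

lemma trace_exists:
  assumes D: "D \<in> gen_vertices G - H"
  shows "\<exists>\<tau> :: _ \<Rightarrow> 'k. (\<forall>x\<in>carrier Q. \<forall>y\<in>carrier Q. \<tau> (x \<oplus>\<^bsub>Q\<^esub> y) = \<tau> x + \<tau> y) \<and> (\<forall>k. \<tau> (qq k D) = k) \<and>
      (\<forall>\<alpha> k A. \<alpha> \<noteq> [] \<longrightarrow> set \<alpha> \<subseteq> edges G \<longrightarrow> A \<in> gen_vertices G \<longrightarrow>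
        \<tau> (lpath Q ss \<alpha> (qq k A)) = 0 \<and> \<tau> (rpath Q tt \<alpha> (qq k A)) = 0)"
proof -
  obtain x0 where x0: "x0 \<in> X D" using X_nonempty[OF D] by blast
  define \<delta> :: "'x \<times> int \<Rightarrow> 'k" where "\<delta> z = (if z = (x0, 0) then 1 else 0)" for z
  have \<delta>: "snd z = 0" if "\<delta> z \<noteq> 0" for z using that by (auto simp: \<delta>_def split: if_splits)
  define \<tau> where "\<tau> a = act a \<delta> (x0, 0)" for a
  have "\<tau> (lpath Q ss \<alpha> (qq k A)) = 0" "\<tau> (rpath Q tt \<alpha> (qq k A)) = 0"
    if \<alpha>: "\<alpha> \<noteq> []" "set \<alpha> \<subseteq> edges G" "A \<in> gen_vertices G" for \<alpha> k A
  proof -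
    have "snd z = 0" if "act (qq k A) \<delta> z \<noteq> 0" for z
      using that \<alpha> by (cases z) (auto simp: act_q \<delta>_def split: if_splits)
    then show "\<tau> (lpath Q ss \<alpha> (qq k A)) = 0"
      using act_lpath[OF \<alpha>(2), of "qq k A" \<delta> 0 "(x0, 0)"] \<alpha> by (auto simp: \<tau>_def)
    show "\<tau> (rpath Q tt \<alpha> (qq k A)) = 0"
      using act_rpath[OF \<alpha>(2,3), of \<delta> 0 k "(x0, 0)"] \<delta> \<alpha> by (auto simp: \<tau>_def)
  qed
  then show ?thesis
    using x0 D by (intro exI[of _ \<tau>]) (auto simp: \<tau>_def act_add act_q \<delta>_def)
qed

lemma edge_sum_proj:
  assumes "finite E" "E \<subseteq> edges G"
  shows "proj (\<Sum>e\<in>E. gen (Edge e) * gen (Ghost e)) = (\<Oplus>\<^bsub>Q\<^esub>e\<in>E. ss e \<otimes>\<^bsub>Q\<^esub> tt e)"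
    and "(\<Sum>e\<in>E. gen (Edge e) * gen (Ghost e)) \<in> carrier F"
proof -
  have g: "gen (Edge e) * gen (Ghost e) \<in> carrier F" if "e \<in> E" for e
    using that assms gen_closed by (intro free_algebra_closed) auto
  show "(\<Sum>e\<in>E. gen (Edge e) * gen (Ghost e)) \<in> carrier F" by (rule sum_closed[OF g])
  have "proj (\<Sum>e\<in>E. gen (Edge e) * gen (Ghost e)) = (\<Oplus>\<^bsub>Q\<^esub>e\<in>E. proj (gen (Edge e) * gen (Ghost e)))"
    by (rule proj_sum[OF assms(1) g])
  also have "\<dots> = (\<Oplus>\<^bsub>Q\<^esub>e\<in>E. ss e \<otimes>\<^bsub>Q\<^esub> tt e)"
  proof (intro Q.add.finprod_cong')
    fix e assume "e \<in> E"
    then have e: "e \<in> edges G" using assms by blast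
    then show "proj (gen (Edge e) * gen (Ghost e)) = ss e \<otimes>\<^bsub>Q\<^esub> tt e"
      using gen_closed[of _ ] by (simp add: ss_def tt_def proj_mult single_letter_closed)
  qed (use assms in \<open>auto intro!: Q.m_closed\<close>)
  finally show "proj (\<Sum>e\<in>E. gen (Edge e) * gen (Ghost e)) = (\<Oplus>\<^bsub>Q\<^esub>e\<in>E. ss e \<otimes>\<^bsub>Q\<^esub> tt e)" .
qed

text \<open>The indicator of the first vertex, constant in the integer coordinate, is available
  because the functions need no finite support. It is fixed by the path around the loop and by its
  ghost, hence killed by \<open>p \<ominus> c\<close>; but
  \<open>y \<otimes> (p \<ominus> c) = p\<close> fixes it, and it is not zero.\<close>

lemma cycle_not_inv:
  assumes n: "n > (0::nat)" and h: "\<And>i. h i \<in> edges G"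
    and ck: "\<And>i. qq 1 {source G (h i)} = ss (h i) \<otimes>\<^bsub>Q\<^esub> tt (h i)"
    and rg: "\<And>i. qq 1 (erange G (h i)) = qq 1 {source G (h (Suc i))}"
    and closed: "source G (h n) = source G (h 0)" and out: "{source G (h 0)} \<notin> H"
    and c: "c = lpath Q ss (map h [0..<n]) (qq 1 {source G (h 0)}) \<or>
      c = rpath Q tt (map h [0..<n]) (qq 1 {source G (h 0)})"
    and y: "y \<in> carrier Q" "y \<otimes>\<^bsub>Q\<^esub> (qq 1 {source G (h 0)} \<ominus>\<^bsub>Q\<^esub> c) = qq 1 {source G (h 0)}"
  shows False
proof -
  define p where "p = qq 1 {source G (h 0)}"
  have pc: "p \<in> carrier Q" using h source_gen by (simp add: p_def)
  define \<chi> where "\<chi> i = act (qq 1 {source G (h i)}) (\<lambda>_. 1 :: 'k)" for i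
  have \<chi>_eq: "\<chi> i = (\<lambda>(x, d). if x \<in> X {source G (h i)} then 1 else 0)" for i
    using h source_gen by (auto simp: \<chi>_def act_q fun_eq_iff)
  have t1: "act (tt (h i)) (\<lambda>_. 1) = \<chi> (Suc i)" for i
  proof -
    have "act (tt (h i)) (\<lambda>_. 1) = act (qq 1 (erange G (h i))) (\<lambda>_. 1 :: 'k)"
      using h by (auto simp: act_t act_q gen_vertices.erange fun_eq_iff)
    then show ?thesis using rg[of i] by (simp add: \<chi>_def)
  qed
  \<comment> \<open>This is \<open>p_v = s_e t_e\<close> applied to the constant function
    \<open>1\<close>.\<close>
  have s\<chi>: "act (ss (h i)) (\<chi> (Suc i)) = \<chi> i" for i
    using t1[of i] ck[of i] h by (simp add: \<chi>_def act_mult)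
  have t\<chi>: "act (tt (h i)) (\<chi> i) = \<chi> (Suc i)" for i
  proof -
    have "act (tt (h i)) (\<chi> i) = (\<lambda>(x, d). if x \<in> X (erange G (h i)) then 1 else 0)"
      using f_source[OF h[of i]] h by (auto simp: act_t \<chi>_eq fun_eq_iff)
    also have "\<dots> = act (tt (h i)) (\<lambda>_. 1)" using h by (simp add: act_t)
    finally show ?thesis using t1 by simp
  qed
  have p\<chi>: "act p (\<chi> 0) = \<chi> 0"
    using h source_gen by (auto simp: p_def act_q \<chi>_eq fun_eq_iff)
  have \<chi>n: "\<chi> n = \<chi> 0" using closed by (simp add: \<chi>_eq)
  have P: "set (map h [i..<n]) \<subseteq> edges G" for i using h by auto
  have L: "act (lpath Q ss (map h [i..<n]) p) (\<chi> 0) = \<chi> i" if "i \<le> n" for i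
    using that
  proof (induction i rule: inc_induct)
    case base
    then show ?case using p\<chi> \<chi>n by simp
  next
    case (step i)
    then show ?case using paths_closed(1)[OF P[of "Suc i"] pc] h s\<chi>
      by (simp add: upt_conv_Cons act_mult)
  qed
  have R: "act (rpath Q tt (map h [i..<n]) p) (\<chi> i) = \<chi> 0" if "i \<le> n" for i
    using that
  proof (induction i rule: inc_induct)
    case base
    then show ?case using p\<chi> \<chi>n by simp
  next
    case (step i)
    then show ?case using paths_closed(2)[OF P[of "Suc i"] pc] h t\<chi>
      by (simp add: upt_conv_Cons act_mult)
  qed
  have cc: "c \<in> carrier Q" using c paths_closed[OF P pc] by (auto simp: p_def)
  have "act c (\<chi> 0) = \<chi> 0" using c L[of 0] R[of 0] by (auto simp: p_def)
  then have "act (p \<ominus>\<^bsub>Q\<^esub> c) (\<chi> 0) = (\<lambda>_. 0)" using pc cc p\<chi> by (auto simp: act_minus fun_eq_iff)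
  then have "act (y \<otimes>\<^bsub>Q\<^esub> (p \<ominus>\<^bsub>Q\<^esub> c)) (\<chi> 0) = (\<lambda>_. 0)"
    using y pc cc by (simp add: act_mult act_fun_zero)
  then have "\<chi> 0 = (\<lambda>_. 0)" using y(2) p\<chi> by (simp add: p_def)
  then have "\<chi> 0 (x, 0) = 0" for x by simp
  moreover obtain x where "x \<in> X {source G (h 0)}" using X_nonempty[of "{source G (h 0)}"] out h source_gen by blast
  ultimately show False unfolding \<chi>_eq by (metis (mono_tags, lifting) case_prod_conv zero_neq_one)
qed

lemma leavitt_quotient: "leavitt_quotient G Q H S (qq :: 'k \<Rightarrow> _) ss tt"
proof (intro leavitt_quotient.intro leavitt_quotient_axioms.intro ultragraph_axioms Q.rng_axioms adm)
  fix A B k l assume A: "A \<in> gen_vertices G" and B: "B \<in> gen_vertices G"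
  note AB = gen_vertices.inter[OF A B] gen_vertices.union[OF A B]
  have "gen (Proj A) * gen (Proj B) - gen (Proj (A \<inter> B)) \<in> relators K G"
    using A B unfolding relators_def by blast
  then have "proj (Poly_Mapping.single 0 (k * l) * (gen (Proj A) * gen (Proj B))) =
      proj (Poly_Mapping.single 0 (k * l) * gen (Proj (A \<inter> B)))"
    using A B AB gen_closed by (intro proj_relator free_algebra_closed) auto
  moreover have "qq k A \<otimes>\<^bsub>Q\<^esub> qq l B = proj (Poly_Mapping.single 0 (k * l) * (gen (Proj A) * gen (Proj B)))"
    using A B by (simp add: qq_def proj_mult single_letter_closed flip: letter_mult)
  ultimately show "qq k A \<otimes>\<^bsub>Q\<^esub> qq l B = qq (k * l) (A \<inter> B)"
    by (simp add: qq_def scalar_letter)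
  have "gen (Proj (A \<union> B)) - (gen (Proj A) + gen (Proj B) - gen (Proj (A \<inter> B))) \<in> relators K G"
    using A B unfolding relators_def by blast
  then have "proj (Poly_Mapping.single 0 k * gen (Proj (A \<union> B))) =
      proj (Poly_Mapping.single 0 k * (gen (Proj A) + gen (Proj B) - gen (Proj (A \<inter> B))))"
    using A B AB gen_closed by (intro proj_relator free_algebra_closed free_algebra_diff_closed) auto
  then have "qq k (A \<union> B) = (qq k A \<oplus>\<^bsub>Q\<^esub> qq k B) \<ominus>\<^bsub>Q\<^esub> qq k (A \<inter> B)"
    using A B AB by (simp add: qq_def distrib_left right_diff_distrib scalar_letter proj_add proj_minus
        single_letter_closed free_algebra_closed)
  then show "qq k (A \<union> B) \<oplus>\<^bsub>Q\<^esub> qq k (A \<inter> B) = qq k A \<oplus>\<^bsub>Q\<^esub> qq k B"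
    using A B AB by (simp add: a_minus_def Q.a_assoc Q.l_neg)
next
  fix A k l assume A: "A \<in> gen_vertices G"
  show "qq k A \<oplus>\<^bsub>Q\<^esub> qq l A = qq (k + l) A"
    using A by (simp add: qq_def proj_add single_letter_closed single_add)
next
  fix A assume A: "A \<in> H"
  then have "lpa_gen K G (Proj A) \<in> J"
    unfolding graded_ideal_def rng_genideal_def by blast
  moreover have "A \<in> gen_vertices G" using A adm by (auto simp: admissible_pair_def hereditary_def)
  ultimately show "qq 1 A = \<zero>\<^bsub>Q\<^esub>"
    by (simp add: qq_def proj_zero_iff single_letter_closed lpa_gen_def coset_def)
next
  fix e k assume e: "e \<in> edges G"
  show "qq k {source G e} \<otimes>\<^bsub>Q\<^esub> ss e = ss e \<otimes>\<^bsub>Q\<^esub> qq k (erange G e)" using letter_Edge[OF e] by metis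
  show "ss e \<otimes>\<^bsub>Q\<^esub> qq 1 (erange G e) = ss e" using letter_Edge(2)[OF e, of 1] by (simp add: ss_def)
  show "tt e \<otimes>\<^bsub>Q\<^esub> qq k {source G e} = qq k (erange G e) \<otimes>\<^bsub>Q\<^esub> tt e" using letter_Ghost[OF e] by metis
  show "qq 1 (erange G e) \<otimes>\<^bsub>Q\<^esub> tt e = tt e" using letter_Ghost(1)[OF e, of 1] by (simp add: tt_def)
next
  fix e f assume e: "e \<in> edges G" "f \<in> edges G"
  have c: "(if e = f then gen (Proj (erange G e)) else 0) \<in> carrier F"
    using e gen_closed free_algebra_closed by (auto intro: gen_vertices.erange)
  have "gen (Ghost e) * gen (Edge f) - (if e = f then gen (Proj (erange G e)) else 0) \<in> relators K G"
    using e unfolding relators_def by blast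
  then have "proj (Poly_Mapping.single 0 1 * (gen (Ghost e) * gen (Edge f))) =
      proj (Poly_Mapping.single 0 1 * (if e = f then gen (Proj (erange G e)) else 0))"
    using e c gen_closed by (intro proj_relator free_algebra_closed)
  then show "tt e \<otimes>\<^bsub>Q\<^esub> ss f = (if e = f then qq 1 (erange G e) else \<zero>\<^bsub>Q\<^esub>)"
    using e gen_closed by (auto simp: tt_def ss_def qq_def proj_mult proj_zero)
next
  fix v assume v: "v \<in> vertices G" "out_edges G v \<noteq> {}" "finite (out_edges G v)"
  have E: "out_edges G v \<subseteq> edges G" by (auto simp: out_edges_def)
  have "gen (Proj {v}) - (\<Sum>e \<in> out_edges G v. gen (Edge e) * gen (Ghost e)) \<in> relators K G"
    using v unfolding relators_def by blast
  then have "proj (Poly_Mapping.single 0 1 * gen (Proj {v})) =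
      proj (Poly_Mapping.single 0 1 * (\<Sum>e \<in> out_edges G v. gen (Edge e) * gen (Ghost e)))"
    using v gen_closed edge_sum_proj(2)[OF v(3) E] by (intro proj_relator) (auto intro: gen_vertices.singleton)
  then show "qq 1 {v} = (\<Oplus>\<^bsub>Q\<^esub>e\<in>out_edges G v. ss e \<otimes>\<^bsub>Q\<^esub> tt e)"
    using edge_sum_proj(1)[OF v(3) E] by (simp add: qq_def)
next
  fix w assume w: "w \<in> S"
  let ?E = "{e \<in> out_edges G w. erange G e \<notin> H}"
  have bw: "w \<in> breaking_vertices G H" using w adm by (auto simp: admissible_pair_def)
  then have E: "finite ?E" "?E \<subseteq> edges G" and wv: "{w} \<in> gen_vertices G"
    by (auto simp: breaking_vertices_def out_edges_def intro: gen_vertices.singleton)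
  have "breaking_elem K G H w \<in> J" using w unfolding graded_ideal_def rng_genideal_def by blast
  then have "proj (gen (Proj {w}) - (\<Sum>e\<in>?E. gen (Edge e) * gen (Ghost e))) = \<zero>\<^bsub>Q\<^esub>"
    unfolding breaking_elem_coset[OF bw]
    using gen_closed(1)[OF wv] edge_sum_proj(2)[OF E] by (simp add: proj_zero_iff free_algebra_diff_closed)
  then have "proj (gen (Proj {w})) = proj (\<Sum>e\<in>?E. gen (Edge e) * gen (Ghost e))"
    using gen_closed(1)[OF wv] edge_sum_proj(2)[OF E] by (intro proj_eqI)
  then show "qq 1 {w} = (\<Oplus>\<^bsub>Q\<^esub>e\<in>?E. ss e \<otimes>\<^bsub>Q\<^esub> tt e)"
    using edge_sum_proj(1)[OF E] by (simp add: qq_def)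
next
  fix w assume w: "w \<in> breaking_vertices G H - S"
  let ?E = "{e \<in> out_edges G w. erange G e \<notin> H}"
  have E: "finite ?E" "?E \<subseteq> edges G" and wv: "{w} \<in> gen_vertices G"
    using w by (auto simp: breaking_vertices_def out_edges_def intro: gen_vertices.singleton)
  \<comment> \<open>A point outside all edge images is not seen by the subtracted terms, so
    \<open>p_w^H\<close> acts there as the identity.\<close>
  obtain x where x: "x \<in> X {w}" "x \<notin> (\<Union>e\<in>out_edges G w. f e ` X (erange G e))"
    using uncovered[OF w] by blast
  let ?g = "gen (Proj {w}) - (\<Sum>e\<in>?E. gen (Edge e) * gen (Ghost e)) :: ('v, 'e, 'k) free_elem"
  have "rep ?g (\<lambda>_. 1) (x, 0) = 1"
    using x rep_edge_sum[OF E, of "\<lambda>_. 1" x 0] by (auto simp: rep_minus)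
  moreover have g: "?g \<in> carrier F" using gen_closed(1)[OF wv] edge_sum_proj(2)[OF E] by (rule free_algebra_diff_closed)
  ultimately have "proj ?g \<noteq> \<zero>\<^bsub>Q\<^esub>" using rep_kernel[OF g] by (metis zero_neq_one)
  moreover have "proj ?g = qq 1 {w} \<ominus>\<^bsub>Q\<^esub> (\<Oplus>\<^bsub>Q\<^esub>e\<in>?E. ss e \<otimes>\<^bsub>Q\<^esub> tt e)"
    using gen_closed(1)[OF wv] edge_sum_proj[OF E] by (simp add: qq_def flip: proj_minus)
  ultimately show "qq 1 {w} \<ominus>\<^bsub>Q\<^esub> (\<Oplus>\<^bsub>Q\<^esub>e\<in>?E. ss e \<otimes>\<^bsub>Q\<^esub> tt e) \<noteq> \<zero>\<^bsub>Q\<^esub>" by simp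
qed (fact qst_closed trace_exists | erule generated_by_letters cycle_not_inv; assumption)+

end

theorem corollary4p3:
  fixes G :: "('v, 'e) ultragraph" and K :: "'k::field itself"
    and H :: "'v set set" and S :: "'v set"
  assumes "ultragraph G" and "admissible_pair G H S"
  shows
    "(left_primitive_ideal (graded_ideal K G H S) (leavitt_path_algebra K G) \<longleftrightarrow>
        (S = breaking_vertices G H
          \<and> downward_directed G (gen_vertices G - H)
          \<and> (\<forall>p. loop_outside G H p \<longrightarrow> has_exit_outside G H p))
      \<or> (\<exists>w \<in> breaking_vertices G H. S = breaking_vertices G H - {w}
          \<and> (\<forall>A \<in> gen_vertices G - H. connects G A {w})))
   \<and> (right_primitive_ideal (graded_ideal K G H S) (leavitt_path_algebra K G) \<longleftrightarrow>
        (S = breaking_vertices G H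
          \<and> downward_directed G (gen_vertices G - H)
          \<and> (\<forall>p. loop_outside G H p \<longrightarrow> has_exit_outside G H p))
      \<or> (\<exists>w \<in> breaking_vertices G H. S = breaking_vertices G H - {w}
          \<and> (\<forall>A \<in> gen_vertices G - H. connects G A {w})))"
proof -
  obtain X :: "'v set \<Rightarrow> ('v set set \<times> nat) set" and f where "branching_system G H S X f"
    using branching_system_exists[OF assms] by blast
  then interpret branching_representation G H S X f K by (rule branching_representation.intro)
  interpret P: leavitt_quotient G Q H S "qq :: 'k \<Rightarrow> _" ss tt by (rule leavitt_quotient)
  have "left_primitive_ideal J L \<longleftrightarrow> left_primitive Q" "right_primitive_ideal J L \<longleftrightarrow> left_primitive (rng_op Q)"
    unfolding left_primitive_ideal_def right_primitive_ideal_def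
    using J.rng_ideal_axioms right_primitive_iff_rng_op[OF Q.rng_axioms] rng_ideal_graded_ideal[OF assms] by auto
  \<comment> \<open>\<open>P.op\<close> keeps \<open>G\<close>, \<open>H\<close> and
    \<open>S\<close>, so the condition for the opposite rng is literally the same.\<close>
  then show ?thesis
    using P.left_primitive_iff leavitt_quotient.left_primitive_iff[OF P.op] by simp
qed

end
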